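(* Let $f:R\to S$ be a ring homomorphism of commutative Gorenstein rings with the weak MCM extending property. Then $$f(\mathrm{ca}(R))\subseteq \mathrm{ca}(S).$$
   Context: All rings are Noetherian and all modules are finitely generated. A commutative Noetherian ring $R$ is Gorenstein if it has finite injective dimension as a module over itself. For $R$ Gorenstein, an $R$-module $M$ is maximal Cohen-Macaulay if $\mathrm{Ext}^i_R(M,R)=0$ for all $i>0$; $\mathrm{MCM}(R)$ is the full subcategory of such modules. The stable category $\underline{\mathrm{MCM}}(R)$ has the same objects, and morphisms are $R$-homomorphisms modulo those factoring through a projective module; it is an $R$-linear triangulated category whose shift functor is the cosyzygy functor $\Omega^{-1}$ (the inverse of the syzygy functor $\Omega$). For an object $X$ of a triangulated category, $\langle X\rangle$ is the smallest full subcategory containing $X$ and closed under finite direct sums, direct summands and shifts. A ring homomorphism $f:R\to S$ of Gorenstein rings has the weak MCM extending property if for every $N\in\mathrm{MCM}(S)$ there are $M\in\mathrm{MCM}(R)$ and $N'\in\mathrm{MCM}(S)$ such that $N'$ is a direct summand of $M\otimes_R S$ and $N\in\langle N'\rangle$ (in $\underline{\mathrm{MCM}}(S)$). The cohomology annihilator of a commutative Noetherian ring $R$ is $\mathrm{ca}(R)=\bigcup_{n\ge 0}\mathrm{ca}^n(R)$, where $\mathrm{ca}^n(R)=\bigcap_{M,N}\mathrm{ann}_R\mathrm{Ext}_R^n(M,N)$, the intersection running over all finitely generated $R$-modules $M,N$. *)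

theory Defs
  imports "HOL-Algebra.Module" "HOL-Algebra.Ring_Divisibility" "HOL-Algebra.Free_Abelian_Groups"
begin

text \<open>
  Quantifiers over "all \<open>R\<close>-modules" have to range over a fixed HOL type. For a ring with
  elements of type \<open>'a\<close> we use modules whose elements have type \<open>(nat \<Rightarrow> 'a) set\<close>. Every
  finitely generated module \<open>M\<close> has an isomorphic copy there (lemma \<open>fg_module_small_copy\<close> below): an
  element of \<open>M\<close> is sent to the set of its coordinate vectors with respect to a finite generating
  family. The type is also large enough for injective resolutions: put
  \<open>k = max |R| |nat|\<close> and assume that \<open>R\<close> is not the zero ring (otherwise every module is
  zero). The type has at least \<open>2^k\<close> elements, and a module with at most \<open>2^k\<close> elements embeds into an
  injective module \<open>Hom_Z(R, D)\<close>, \<open>D\<close> a divisible hull, again with at most \<open>2^k\<close> elements.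
  The fields \<open>mult\<close> and \<open>one\<close> of a module record carry no information.
\<close>

type_synonym 'a small_module = "('a, (nat \<Rightarrow> 'a) set) module"

section \<open>Modules and homomorphisms\<close>

definition fg_module :: "('a, 'c) ring_scheme \<Rightarrow> ('a, 'm) module \<Rightarrow> bool" where
  "fg_module R M \<longleftrightarrow> module R M \<and>
     (\<exists>A. finite A \<and> A \<subseteq> carrier M \<and>
        (\<forall>x \<in> carrier M. \<exists>c \<in> A \<rightarrow> carrier R. x = (\<Oplus>\<^bsub>M\<^esub>a\<in>A. c a \<odot>\<^bsub>M\<^esub> a)))"

definition zero_module :: "('a, 'm) module \<Rightarrow> bool" where
  "zero_module M \<longleftrightarrow> carrier M = {\<zero>\<^bsub>M\<^esub>}"

definition regular_module :: "('a, 'c) ring_scheme \<Rightarrow> ('a, 'a) module" where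
  "regular_module R = \<lparr>carrier = carrier R, monoid.mult = monoid.mult R, one = one R,
     ring.zero = \<zero>\<^bsub>R\<^esub>, ring.add = ring.add R, smult = monoid.mult R\<rparr>"

text \<open>
  Homomorphisms are extensional functions, so that equality of homomorphisms is equality of
  HOL functions; accordingly they are composed with \<^const>\<open>compose\<close>.
\<close>

definition module_Hom ::
    "('a, 'c) ring_scheme \<Rightarrow> ('a, 'm) module \<Rightarrow> ('a, 'n) module \<Rightarrow> ('m \<Rightarrow> 'n) set" where
  "module_Hom R M N = {h \<in> carrier M \<rightarrow>\<^sub>E carrier N.
     (\<forall>x \<in> carrier M. \<forall>y \<in> carrier M. h (x \<oplus>\<^bsub>M\<^esub> y) = h x \<oplus>\<^bsub>N\<^esub> h y) \<and>
     (\<forall>r \<in> carrier R. \<forall>x \<in> carrier M. h (r \<odot>\<^bsub>M\<^esub> x) = r \<odot>\<^bsub>N\<^esub> h x)}"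

definition module_iso :: "('a, 'c) ring_scheme \<Rightarrow> ('a, 'm) module \<Rightarrow> ('a, 'n) module \<Rightarrow> bool" where
  "module_iso R M N \<longleftrightarrow> (\<exists>h \<in> module_Hom R M N. bij_betw h (carrier M) (carrier N))"

definition hom_module ::
    "('a, 'c) ring_scheme \<Rightarrow> ('a, 'm) module \<Rightarrow> ('a, 'n) module \<Rightarrow> ('a, 'm \<Rightarrow> 'n) module" where
  "hom_module R M N = \<lparr>carrier = module_Hom R M N, monoid.mult = undefined, one = undefined,
     ring.zero = (\<lambda>x\<in>carrier M. \<zero>\<^bsub>N\<^esub>),
     ring.add = (\<lambda>g h. \<lambda>x\<in>carrier M. g x \<oplus>\<^bsub>N\<^esub> h x),
     smult = (\<lambda>r h. \<lambda>x\<in>carrier M. r \<odot>\<^bsub>N\<^esub> h x)\<rparr>"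

definition direct_sum :: "('a, 'm) module \<Rightarrow> ('a, 'n) module \<Rightarrow> ('a, 'm \<times> 'n) module" where
  "direct_sum M N = \<lparr>carrier = carrier M \<times> carrier N, monoid.mult = undefined, one = undefined,
     ring.zero = (\<zero>\<^bsub>M\<^esub>, \<zero>\<^bsub>N\<^esub>),
     ring.add = (\<lambda>(x, y) (x', y'). (x \<oplus>\<^bsub>M\<^esub> x', y \<oplus>\<^bsub>N\<^esub> y')),
     smult = (\<lambda>r (x, y). (r \<odot>\<^bsub>M\<^esub> x, r \<odot>\<^bsub>N\<^esub> y))\<rparr>"

text \<open>Union over representatives in \<open>smult\<close>: for a submodule \<open>H\<close> all the cosets united are equal.\<close>

definition quotient_module :: "('a, 'm) module \<Rightarrow> 'm set \<Rightarrow> ('a, 'm set) module" where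
  "quotient_module M H = \<lparr>carrier = a_rcosets\<^bsub>M\<^esub> H, monoid.mult = undefined, one = undefined,
     ring.zero = H, ring.add = set_add M,
     smult = (\<lambda>r X. \<Union>x\<in>X. a_r_coset M H (r \<odot>\<^bsub>M\<^esub> x))\<rparr>"

definition direct_summand :: "('a, 'c) ring_scheme \<Rightarrow> ('a, 'm) module \<Rightarrow> ('a, 'n) module \<Rightarrow> bool" where
  "direct_summand R N T \<longleftrightarrow>
     (\<exists>X :: 'a small_module. fg_module R X \<and> module_iso R T (direct_sum N X))"

definition annihilator :: "('a, 'c) ring_scheme \<Rightarrow> ('a, 'm) module \<Rightarrow> 'a set" where
  "annihilator R M = {r \<in> carrier R. \<forall>x \<in> carrier M. r \<odot>\<^bsub>M\<^esub> x = \<zero>\<^bsub>M\<^esub>}"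

text \<open>
  Testing projectivity (of finitely generated modules) and injectivity on small modules is enough:
  a finitely generated module is, up to isomorphism, a quotient of a small free module, and for
  injectivity Baer's criterion needs only ideals of \<open>R\<close>.
\<close>

definition projective_module :: "('a, 'c) ring_scheme \<Rightarrow> ('a, 'm) module \<Rightarrow> bool" where
  "projective_module R P \<longleftrightarrow> module R P \<and>
     (\<forall>(A :: 'a small_module) (B :: 'a small_module). \<forall>g \<in> module_Hom R A B. \<forall>h \<in> module_Hom R P B.
        module R A \<and> module R B \<and> g ` carrier A = carrier B \<longrightarrow>
        (\<exists>k \<in> module_Hom R P A. compose (carrier P) g k = h))"

definition injective_module :: "('a, 'c) ring_scheme \<Rightarrow> ('a, 'm) module \<Rightarrow> bool" where
  "injective_module R I \<longleftrightarrow> module R I \<and>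
     (\<forall>(A :: 'a small_module) (B :: 'a small_module). \<forall>g \<in> module_Hom R A B. \<forall>h \<in> module_Hom R A I.
        module R A \<and> module R B \<and> inj_on g (carrier A) \<longrightarrow>
        (\<exists>k \<in> module_Hom R B I. compose (carrier A) k g = h))"

definition short_exact ::
    "('a, 'c) ring_scheme \<Rightarrow> ('a, 'l) module \<Rightarrow> ('a, 'm) module \<Rightarrow> ('a, 'n) module \<Rightarrow> bool" where
  "short_exact R L M N \<longleftrightarrow> (\<exists>g \<in> module_Hom R L M. \<exists>h \<in> module_Hom R M N.
     inj_on g (carrier L) \<and> g ` carrier L = a_kernel M N h \<and> h ` carrier M = carrier N)"

section \<open>Ext, Gorenstein rings and the cohomology annihilator\<close>

definition projective_resolution ::
    "('a, 'c) ring_scheme \<Rightarrow> ('a, 'm) module \<Rightarrow> (nat \<Rightarrow> 'a small_module) \<Rightarrow>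
     (nat \<Rightarrow> (nat \<Rightarrow> 'a) set \<Rightarrow> (nat \<Rightarrow> 'a) set) \<Rightarrow> ((nat \<Rightarrow> 'a) set \<Rightarrow> 'm) \<Rightarrow> bool" where
  "projective_resolution R M P d e \<longleftrightarrow>
     (\<forall>n. fg_module R (P n) \<and> projective_module R (P n)) \<and>
     (\<forall>n. d n \<in> module_Hom R (P (Suc n)) (P n)) \<and>
     e \<in> module_Hom R (P 0) M \<and>
     e ` carrier (P 0) = carrier M \<and>
     d 0 ` carrier (P (Suc 0)) = a_kernel (P 0) M e \<and>
     (\<forall>n. d (Suc n) ` carrier (P (Suc (Suc n))) = a_kernel (P (Suc n)) (P n) (d n))"

definition ext_cocycles ::
    "('a, 'c) ring_scheme \<Rightarrow> (nat \<Rightarrow> ('a, 'p) module) \<Rightarrow> (nat \<Rightarrow> 'p \<Rightarrow> 'p) \<Rightarrow> ('a, 'n) module \<Rightarrow>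
     nat \<Rightarrow> ('p \<Rightarrow> 'n) set" where
  "ext_cocycles R P d N n =
     a_kernel (hom_module R (P n) N) (hom_module R (P (Suc n)) N)
       (\<lambda>h. compose (carrier (P (Suc n))) h (d n))"

definition ext_coboundaries ::
    "('a, 'c) ring_scheme \<Rightarrow> (nat \<Rightarrow> ('a, 'p) module) \<Rightarrow> (nat \<Rightarrow> 'p \<Rightarrow> 'p) \<Rightarrow> ('a, 'n) module \<Rightarrow>
     nat \<Rightarrow> ('p \<Rightarrow> 'n) set" where
  "ext_coboundaries R P d N n =
     (case n of
        0 \<Rightarrow> {\<zero>\<^bsub>hom_module R (P 0) N\<^esub>}
      | Suc m \<Rightarrow> (\<lambda>h. compose (carrier (P (Suc m))) h (d m)) ` module_Hom R (P m) N)"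

text \<open>
  \<open>Ext\<close> is computed from a chosen resolution by finitely generated projectives; over a Noetherian
  ring one exists for every finitely generated \<open>M\<close>, and up to isomorphism the result does not depend
  on the choice.
\<close>

definition Ext ::
    "('a, 'c) ring_scheme \<Rightarrow> nat \<Rightarrow> ('a, 'm) module \<Rightarrow> ('a, 'n) module \<Rightarrow>
     ('a, ((nat \<Rightarrow> 'a) set \<Rightarrow> 'n) set) module" where
  "Ext R n M N =
     (let (P, d, e) = (SOME (P, d, e). projective_resolution R M P d e)
      in quotient_module ((hom_module R (P n) N)\<lparr>carrier := ext_cocycles R P d N n\<rparr>)
           (ext_coboundaries R P d N n))"

definition injective_resolution ::
    "('a, 'c) ring_scheme \<Rightarrow> ('a, 'm) module \<Rightarrow> (nat \<Rightarrow> 'a small_module) \<Rightarrow>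
     (nat \<Rightarrow> (nat \<Rightarrow> 'a) set \<Rightarrow> (nat \<Rightarrow> 'a) set) \<Rightarrow> ('m \<Rightarrow> (nat \<Rightarrow> 'a) set) \<Rightarrow> bool" where
  "injective_resolution R M I d e \<longleftrightarrow>
     (\<forall>n. injective_module R (I n)) \<and>
     (\<forall>n. d n \<in> module_Hom R (I n) (I (Suc n))) \<and>
     e \<in> module_Hom R M (I 0) \<and>
     inj_on e (carrier M) \<and>
     e ` carrier M = a_kernel (I 0) (I (Suc 0)) (d 0) \<and>
     (\<forall>n. d n ` carrier (I n) = a_kernel (I (Suc n)) (I (Suc (Suc n))) (d (Suc n)))"

definition finite_injective_dimension :: "('a, 'c) ring_scheme \<Rightarrow> ('a, 'm) module \<Rightarrow> bool" where
  "finite_injective_dimension R M \<longleftrightarrow>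
     (\<exists>I d e n. injective_resolution R M I d e \<and> (\<forall>i>n. zero_module (I i)))"

definition gorenstein_ring :: "('a, 'c) ring_scheme \<Rightarrow> bool" where
  "gorenstein_ring R \<longleftrightarrow>
     cring R \<and> noetherian_ring R \<and> finite_injective_dimension R (regular_module R)"

definition mcm :: "('a, 'c) ring_scheme \<Rightarrow> ('a, 'm) module \<Rightarrow> bool" where
  "mcm R M \<longleftrightarrow> fg_module R M \<and> (\<forall>i>0. zero_module (Ext R i M (regular_module R)))"

definition ca_level :: "('a, 'c) ring_scheme \<Rightarrow> nat \<Rightarrow> 'a set" where
  "ca_level R n =
     (\<Inter>(M, N) \<in> {(M :: 'a small_module, N :: 'a small_module). fg_module R M \<and> fg_module R N}.
        annihilator R (Ext R n M N))"

definition ca :: "('a, 'c) ring_scheme \<Rightarrow> 'a set" where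
  "ca R = (\<Union>n. ca_level R n)"

section \<open>The stable category\<close>

definition factors_through_projective ::
    "('a, 'c) ring_scheme \<Rightarrow> ('a, 'm) module \<Rightarrow> ('a, 'n) module \<Rightarrow> ('m \<Rightarrow> 'n) \<Rightarrow> bool" where
  "factors_through_projective R M N h \<longleftrightarrow>
     (\<exists>P :: 'a small_module. fg_module R P \<and> projective_module R P \<and>
        (\<exists>u \<in> module_Hom R M P. \<exists>v \<in> module_Hom R P N. h = compose (carrier M) v u))"

definition stable_rel ::
    "('a, 'c) ring_scheme \<Rightarrow> ('a, 'm) module \<Rightarrow> ('a, 'n) module \<Rightarrow> (('m \<Rightarrow> 'n) \<times> ('m \<Rightarrow> 'n)) set" where
  "stable_rel R M N = {(g, h). g \<in> module_Hom R M N \<and> h \<in> module_Hom R M N \<and>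
     factors_through_projective R M N (\<lambda>x\<in>carrier M. g x \<ominus>\<^bsub>N\<^esub> h x)}"

definition stable_hom ::
    "('a, 'c) ring_scheme \<Rightarrow> ('a, 'm) module \<Rightarrow> ('a, 'n) module \<Rightarrow> ('m \<Rightarrow> 'n) set set" where
  "stable_hom R M N = module_Hom R M N // stable_rel R M N"

definition stable_id :: "('a, 'c) ring_scheme \<Rightarrow> ('a, 'm) module \<Rightarrow> ('m \<Rightarrow> 'm) set" where
  "stable_id R M = stable_rel R M M `` {\<lambda>x\<in>carrier M. x}"

definition stable_comp ::
    "('a, 'c) ring_scheme \<Rightarrow> ('a, 'l) module \<Rightarrow> ('a, 'n) module \<Rightarrow>
     ('m \<Rightarrow> 'n) set \<Rightarrow> ('l \<Rightarrow> 'm) set \<Rightarrow> ('l \<Rightarrow> 'n) set" where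
  "stable_comp R L N G F = (\<Union>g\<in>G. \<Union>f\<in>F. stable_rel R L N `` {compose (carrier L) g f})"

definition stable_iso :: "('a, 'c) ring_scheme \<Rightarrow> ('a, 'm) module \<Rightarrow> ('a, 'n) module \<Rightarrow> bool" where
  "stable_iso R M N \<longleftrightarrow> (\<exists>F \<in> stable_hom R M N. \<exists>G \<in> stable_hom R N M.
     stable_comp R M M G F = stable_id R M \<and> stable_comp R N N F G = stable_id R N)"

text \<open>
  \<open>stable_closure R X\<close> is the smallest full subcategory (a class of objects) of the stable category of
  maximal Cohen-Macaulay modules that contains \<open>X\<close> and is closed under finite direct sums, direct
  summands and shifts. Sums and summands are taken in the stable category; closure under stable
  isomorphism is the case of a zero complement in the rule \<open>summand\<close>. A cosyzygy of \<open>A\<close> is a maximal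
  Cohen-Macaulay cokernel \<open>B\<close> of an embedding of \<open>A\<close> into a projective; it is unique up to stable
  isomorphism.
\<close>

inductive stable_closure :: "('a, 'c) ring_scheme \<Rightarrow> 'a small_module \<Rightarrow> 'a small_module \<Rightarrow> bool"
  for R :: "('a, 'c) ring_scheme" and X :: "'a small_module" where
  base: "mcm R X \<Longrightarrow> stable_closure R X X"
| zero: "mcm R Z \<Longrightarrow> zero_module Z \<Longrightarrow> stable_closure R X Z"
| sum: "stable_closure R X A \<Longrightarrow> stable_closure R X B \<Longrightarrow> mcm R C \<Longrightarrow>
    stable_iso R C (direct_sum A B) \<Longrightarrow> stable_closure R X C"
| summand: "stable_closure R X A \<Longrightarrow> mcm R B \<Longrightarrow> mcm R (C :: 'a small_module) \<Longrightarrow>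
    stable_iso R A (direct_sum B C) \<Longrightarrow> stable_closure R X B"
| cosyzygy: "stable_closure R X A \<Longrightarrow> mcm R B \<Longrightarrow> fg_module R (P :: 'a small_module) \<Longrightarrow>
    projective_module R P \<Longrightarrow> short_exact R A P B \<Longrightarrow> stable_closure R X B"
| syzygy: "stable_closure R X A \<Longrightarrow> mcm R B \<Longrightarrow> fg_module R (P :: 'a small_module) \<Longrightarrow>
    projective_module R P \<Longrightarrow> short_exact R B P A \<Longrightarrow> stable_closure R X B"

section \<open>Base change and the weak MCM extending property\<close>

text \<open>
  For \<open>f : R \<rightarrow> S\<close>, the \<open>S\<close>-module \<open>M \<otimes>\<^sub>R S\<close> is the free abelian group on pairs \<open>(x, s)\<close> modulo the subgroup
  generated by the bilinearity relations and \<open>(r x, s) - (x, f(r) s)\<close>. \<open>S\<close> acts on the second factor.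
  The numerator of the quotient is only an abelian group on which the multiplicative
  monoid of \<open>S\<close> acts by endomorphisms preserving the relations; the quotient is an \<open>S\<close>-module.
\<close>

definition tensor_relations ::
    "('a, 'c) ring_scheme \<Rightarrow> ('b, 'd) ring_scheme \<Rightarrow> ('a \<Rightarrow> 'b) \<Rightarrow> ('a, 'm) module \<Rightarrow>
     ('m \<times> 'b \<Rightarrow>\<^sub>0 int) set" where
  "tensor_relations R S f M =
     {frag_of (x \<oplus>\<^bsub>M\<^esub> y, s) - frag_of (x, s) - frag_of (y, s) | x y s.
        x \<in> carrier M \<and> y \<in> carrier M \<and> s \<in> carrier S} \<union>
     {frag_of (x, s \<oplus>\<^bsub>S\<^esub> t) - frag_of (x, s) - frag_of (x, t) | x s t.
        x \<in> carrier M \<and> s \<in> carrier S \<and> t \<in> carrier S} \<union>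
     {frag_of (r \<odot>\<^bsub>M\<^esub> x, s) - frag_of (x, f r \<otimes>\<^bsub>S\<^esub> s) | r x s.
        r \<in> carrier R \<and> x \<in> carrier M \<and> s \<in> carrier S}"

definition base_change ::
    "('a, 'c) ring_scheme \<Rightarrow> ('b, 'd) ring_scheme \<Rightarrow> ('a \<Rightarrow> 'b) \<Rightarrow> ('a, 'm) module \<Rightarrow>
     ('b, ('m \<times> 'b \<Rightarrow>\<^sub>0 int) set) module" where
  "base_change R S f M =
     quotient_module
       \<lparr>carrier = carrier (free_Abelian_group (carrier M \<times> carrier S)),
        monoid.mult = undefined, one = undefined, ring.zero = 0, ring.add = (+),
        smult = (\<lambda>s. frag_extend (\<lambda>(x, t). frag_of (x, s \<otimes>\<^bsub>S\<^esub> t)))\<rparr>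
       (generate (free_Abelian_group (carrier M \<times> carrier S)) (tensor_relations R S f M))"

definition weak_mcm_extending ::
    "('a, 'c) ring_scheme \<Rightarrow> ('b, 'd) ring_scheme \<Rightarrow> ('a \<Rightarrow> 'b) \<Rightarrow> bool" where
  "weak_mcm_extending R S f \<longleftrightarrow>
     (\<forall>N :: 'b small_module. mcm S N \<longrightarrow>
        (\<exists>(M :: 'a small_module) (N' :: 'b small_module). mcm R M \<and> mcm S N' \<and>
           direct_summand S N' (base_change R S f M) \<and> stable_closure S N' N))"

section \<open>Finitely generated modules have small copies\<close>

lemma module_transport:
  fixes M :: "('a, 'm) module" and \<phi> :: "'m \<Rightarrow> 'n"
  assumes M: "module R M" and inj: "inj_on \<phi> (carrier M)"
  obtains M' :: "('a, 'n) module"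
    where "module R M'" "carrier M' = \<phi> ` carrier M"
      "restrict \<phi> (carrier M) \<in> module_Hom R M M'"
proof -
  interpret module R M by fact
  let ?i = "inv_into (carrier M) \<phi>"
  define M' :: "('a, 'n) module" where
    "M' = \<lparr>carrier = \<phi> ` carrier M, monoid.mult = undefined, one = undefined,
       ring.zero = \<phi> \<zero>\<^bsub>M\<^esub>, ring.add = (\<lambda>x y. \<phi> (?i x \<oplus>\<^bsub>M\<^esub> ?i y)), smult = (\<lambda>r x. \<phi> (r \<odot>\<^bsub>M\<^esub> ?i x))\<rparr>"
  have [simp]: "?i (\<phi> x) = x" if "x \<in> carrier M" for x
    using inj that by simp
  have ag: "abelian_group M'"
  proof (rule abelian_groupI)
    fix x assume "x \<in> carrier M'"
    then obtain a where a: "a \<in> carrier M" "x = \<phi> a" by (auto simp: M'_def)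
    show "\<exists>y \<in> carrier M'. y \<oplus>\<^bsub>M'\<^esub> x = \<zero>\<^bsub>M'\<^esub>"
      by (rule bexI[of _ "\<phi> (\<ominus>\<^bsub>M\<^esub> a)"]) (auto simp: M'_def a M.l_neg)
  qed (auto simp: M'_def M.a_ac)
  have "module R M'"
    by (rule moduleI[OF R.is_cring ag])
      (auto simp: M'_def smult_l_distr smult_r_distr smult_assoc1)
  moreover have "restrict \<phi> (carrier M) \<in> module_Hom R M M'"
    by (auto simp: module_Hom_def M'_def)
  ultimately show thesis
    by (intro that[of M']) (auto simp: M'_def)
qed

lemma module_iso_fg:
  assumes M: "fg_module R M" and N: "module R N" and iso: "module_iso R M N"
  shows "fg_module R N"
proof -
  from M interpret M: module R M by (simp add: fg_module_def)
  from N interpret N: module R N .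
  from M obtain A where A: "finite A" "A \<subseteq> carrier M"
    and gen: "\<And>x. x \<in> carrier M \<Longrightarrow> \<exists>c \<in> A \<rightarrow> carrier R. x = (\<Oplus>\<^bsub>M\<^esub>a\<in>A. c a \<odot>\<^bsub>M\<^esub> a)"
    unfolding fg_module_def by blast
  from iso obtain h where h: "h \<in> module_Hom R M N" and bij: "bij_betw h (carrier M) (carrier N)"
    by (auto simp: module_iso_def)
  have hc: "\<And>x. x \<in> carrier M \<Longrightarrow> h x \<in> carrier N"
    and ha: "\<And>x y. x \<in> carrier M \<Longrightarrow> y \<in> carrier M \<Longrightarrow> h (x \<oplus>\<^bsub>M\<^esub> y) = h x \<oplus>\<^bsub>N\<^esub> h y"
    and hs: "\<And>r x. r \<in> carrier R \<Longrightarrow> x \<in> carrier M \<Longrightarrow> h (r \<odot>\<^bsub>M\<^esub> x) = r \<odot>\<^bsub>N\<^esub> h x"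
    using h by (auto simp: module_Hom_def)
  have h0: "h \<zero>\<^bsub>M\<^esub> = \<zero>\<^bsub>N\<^esub>"
    using hs[of "\<zero>\<^bsub>R\<^esub>" "\<zero>\<^bsub>M\<^esub>"] hc[of "\<zero>\<^bsub>M\<^esub>"] by simp
  have inj: "inj_on h (carrier M)" using bij by (simp add: bij_betw_def)
  have sum: "h (\<Oplus>\<^bsub>M\<^esub>a\<in>B. g a) = (\<Oplus>\<^bsub>N\<^esub>a\<in>B. h (g a))"
    if "finite B" "g \<in> B \<rightarrow> carrier M" for B and g :: "'c \<Rightarrow> 'c"
    using that
  proof (induction B)
    case empty then show ?case by (simp add: h0)
  next
    case (insert b B)
    then have "g b \<in> carrier M" "g \<in> B \<rightarrow> carrier M" by auto
    with insert show ?case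
      by (simp add: ha M.finsum_closed Pi_def hc)
  qed
  show ?thesis
    unfolding fg_module_def
  proof (intro conjI exI[of _ "h ` A"] ballI)
    show "finite (h ` A)" "h ` A \<subseteq> carrier N" using A hc by auto
    fix y assume "y \<in> carrier N"
    then obtain x where x: "x \<in> carrier M" "y = h x" using bij by (auto simp: bij_betw_def)
    obtain c where c: "c \<in> A \<rightarrow> carrier R" "x = (\<Oplus>\<^bsub>M\<^esub>a\<in>A. c a \<odot>\<^bsub>M\<^esub> a)" using gen x(1) by blast
    have injA: "inj_on h A" using inj A(2) by (rule inj_on_subset)
    let ?c = "\<lambda>y. c (inv_into A h y)"
    have "y = (\<Oplus>\<^bsub>N\<^esub>a\<in>A. h (c a \<odot>\<^bsub>M\<^esub> a))"
      unfolding x c(2) using A c(1) by (intro sum Pi_I M.smult_closed) (auto dest: Pi_mem)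
    also have "\<dots> = (\<Oplus>\<^bsub>N\<^esub>a\<in>A. ?c (h a) \<odot>\<^bsub>N\<^esub> h a)"
      using A(2) c(1) injA by (intro N.finsum_cong' refl Pi_I) (simp_all add: Pi_iff hc hs subsetD)
    also have "\<dots> = (\<Oplus>\<^bsub>N\<^esub>b\<in>h ` A. ?c b \<odot>\<^bsub>N\<^esub> b)"
      using A(2) c(1) injA
      by (intro N.finsum_reindex[symmetric]) (simp_all add: Pi_iff hc subset_iff)
    finally show "\<exists>c \<in> h ` A \<rightarrow> carrier R. y = (\<Oplus>\<^bsub>N\<^esub>b\<in>h ` A. c b \<odot>\<^bsub>N\<^esub> b)"
      using c(1) injA by (intro bexI[of _ ?c]) auto
  qed fact
qed

lemma fg_module_small_copy:
  fixes M :: "('a, 'm) module"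
  assumes fg: "fg_module R M"
  shows "\<exists>M' :: 'a small_module. fg_module R M' \<and> module_iso R M M'"
proof -
  from fg have M: "module R M" by (simp add: fg_module_def)
  then interpret module R M .
  from fg obtain A where A: "finite A" "A \<subseteq> carrier M"
    and gen: "\<And>x. x \<in> carrier M \<Longrightarrow> \<exists>c \<in> A \<rightarrow> carrier R. x = (\<Oplus>\<^bsub>M\<^esub>a\<in>A. c a \<odot>\<^bsub>M\<^esub> a)"
    unfolding fg_module_def by blast
  obtain e :: "'m \<Rightarrow> nat" where e: "inj_on e A"
    using finite_imp_inj_to_nat_seg[OF A(1)] by blast
  let ?s = "\<lambda>c :: nat \<Rightarrow> 'a. \<Oplus>\<^bsub>M\<^esub>a\<in>A. c (e a) \<odot>\<^bsub>M\<^esub> a"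
  define \<phi> where "\<phi> x = {c. x = ?s c}" for x
  have ne: "\<phi> x \<noteq> {}" if "x \<in> carrier M" for x
  proof -
    obtain c where c: "c \<in> A \<rightarrow> carrier R" "x = (\<Oplus>\<^bsub>M\<^esub>a\<in>A. c a \<odot>\<^bsub>M\<^esub> a)" using gen \<open>x \<in> carrier M\<close> by blast
    have "(\<Oplus>\<^bsub>M\<^esub>a\<in>A. c a \<odot>\<^bsub>M\<^esub> a) = ?s (\<lambda>i. c (inv_into A e i))"
      using A(2) c(1) e by (intro M.finsum_cong' refl Pi_I smult_closed) (auto simp only: inv_into_f_f dest: Pi_mem)
    with c(2) have "(\<lambda>i. c (inv_into A e i)) \<in> \<phi> x"
      unfolding \<phi>_def mem_Collect_eq by (rule trans)
    then show ?thesis by blast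
  qed
  have inj: "inj_on \<phi> (carrier M)"
  proof (rule inj_onI)
    fix x y assume "x \<in> carrier M" "\<phi> x = \<phi> y"
    then obtain c where "c \<in> \<phi> x" "c \<in> \<phi> y" using ne by blast
    then show "x = y" unfolding \<phi>_def mem_Collect_eq by (elim ssubst) simp
  qed
  obtain M' :: "'a small_module" where M': "module R M'" "carrier M' = \<phi> ` carrier M"
      "restrict \<phi> (carrier M) \<in> module_Hom R M M'"
    by (rule module_transport[OF M inj])
  have "module_iso R M M'"
    unfolding module_iso_def
    by (rule bexI[OF _ M'(3)]) (use inj M'(2) in \<open>simp add: bij_betw_def inj_on_restrict_eq\<close>)
  with module_iso_fg[OF fg M'(1)] show ?thesis by blast
qed

end

theory Submission
  imports Defs
begin

text \<open>
  The stable class of multiplication by \<open>r\<close> on \<open>M\<close> vanishes iff multiplication by \<open>r\<close> is a finite sum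
  \<open>x \<mapsto> \<Sum> \<phi>\<^sub>i(x) m\<^sub>i\<close> with functionals \<open>\<phi>\<^sub>i\<close>; call \<open>r\<close> a scalar of finite rank on \<open>M\<close>. If \<open>r\<close> annihilates
  all \<open>Ext\<^sup>n\<close>, it has finite rank on every \<open>n\<close>-th syzygy \<open>\<Omega>\<^sup>n M\<close>, because it kills the class of
  \<open>0 \<rightarrow> \<Omega>\<^sup>n M \<rightarrow> P \<rightarrow> \<Omega>\<^sup>n\<^sup>-\<^sup>1 M \<rightarrow> 0\<close>; when \<open>M\<close> is maximal Cohen-Macaulay, functionals extend along the
  embeddings of syzygies, and finite rank descends from \<open>\<Omega>\<^sup>n M\<close> to \<open>M\<close>. So \<open>r \<in> ca(R)\<close> has finite
  rank on all of \<open>MCM(R)\<close>. Finite rank passes through base change, to direct summands and through the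
  stable closure, so \<open>f(r)\<close> has finite rank on all of \<open>MCM(S)\<close>. If \<open>S\<close> has injective dimension \<open>m\<close>, then
  \<open>\<Omega>\<^sup>m\<^sup>+\<^sup>1 M\<close> is maximal Cohen-Macaulay for every \<open>M\<close>, and a scalar of finite rank on it annihilates
  \<open>Ext\<^sup>m\<^sup>+\<^sup>2(M, N)\<close>.
\<close>

section \<open>Homomorphisms and submodules\<close>

text \<open>Finite rank replaces vanishing in the stable category because it mentions only
  functionals and elements. It makes sense for modules of any element type, such as the base change,
  and base change of a finite rank map reduces to base change of one functional. It also removes the
  triangulated structure: invariance under shifts becomes a statement about one short exact sequence
  with projective middle term. To pass to the kernel, projectivity of the middle term suffices. To
  pass to the cokernel, functionals on the kernel must extend to the middle term, and vanishing of
  \<open>Ext\<close> into the ring provides this; here the Cohen-Macaulay condition enters.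

  \<open>Ext\<close> is computed from one chosen resolution, and independence of the choice is never
  established. Dimension shifting is therefore done by hand: cocycles with values in a module of
  finite injective dimension are shown to be coboundaries in high degrees of any acyclic complex of
  projectives, and this is applied to the chosen resolution of \<open>M\<close>, cut off at a syzygy
  and spliced with the chosen resolution of that syzygy.\<close>

definition mod_hom ::
    "('a, 'c) ring_scheme \<Rightarrow> ('a, 'm) module \<Rightarrow> ('a, 'n) module \<Rightarrow> ('m \<Rightarrow> 'n) \<Rightarrow> bool" where
  "mod_hom R M N h \<longleftrightarrow> (\<forall>x \<in> carrier M. h x \<in> carrier N) \<and>
     (\<forall>x \<in> carrier M. \<forall>y \<in> carrier M. h (x \<oplus>\<^bsub>M\<^esub> y) = h x \<oplus>\<^bsub>N\<^esub> h y) \<and>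
     (\<forall>r \<in> carrier R. \<forall>x \<in> carrier M. h (r \<odot>\<^bsub>M\<^esub> x) = r \<odot>\<^bsub>N\<^esub> h x)"

text \<open>\<open>mod_hom\<close> drops extensionality, so that composites and sums can be written
  as plain lambda terms; \<open>restrict\<close> reappears only where the given definitions are
  met.\<close>

lemma module_Hom_iff: "h \<in> module_Hom R M N \<longleftrightarrow> h \<in> extensional (carrier M) \<and> mod_hom R M N h"
  by (auto simp: module_Hom_def mod_hom_def PiE_def)

lemma mod_homI:
  assumes "\<And>x. x \<in> carrier M \<Longrightarrow> h x \<in> carrier N"
    and "\<And>x y. x \<in> carrier M \<Longrightarrow> y \<in> carrier M \<Longrightarrow> h (x \<oplus>\<^bsub>M\<^esub> y) = h x \<oplus>\<^bsub>N\<^esub> h y"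
    and "\<And>r x. r \<in> carrier R \<Longrightarrow> x \<in> carrier M \<Longrightarrow> h (r \<odot>\<^bsub>M\<^esub> x) = r \<odot>\<^bsub>N\<^esub> h x"
  shows "mod_hom R M N h"
  using assms by (simp add: mod_hom_def)

lemma mod_homD:
  assumes "mod_hom R M N h"
  shows "x \<in> carrier M \<Longrightarrow> h x \<in> carrier N"
    and "x \<in> carrier M \<Longrightarrow> y \<in> carrier M \<Longrightarrow> h (x \<oplus>\<^bsub>M\<^esub> y) = h x \<oplus>\<^bsub>N\<^esub> h y"
    and "r \<in> carrier R \<Longrightarrow> x \<in> carrier M \<Longrightarrow> h (r \<odot>\<^bsub>M\<^esub> x) = r \<odot>\<^bsub>N\<^esub> h x"
  using assms by (auto simp: mod_hom_def)

lemma mod_hom_zero: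
  assumes "mod_hom R M N h" "module R M" "module R N"
  shows "h \<zero>\<^bsub>M\<^esub> = \<zero>\<^bsub>N\<^esub>"
proof -
  interpret M: module R M by fact
  interpret N: module R N by fact
  show ?thesis
    using mod_homD(3)[OF assms(1), of "\<zero>\<^bsub>R\<^esub>" "\<zero>\<^bsub>M\<^esub>"] mod_homD(1)[OF assms(1), of "\<zero>\<^bsub>M\<^esub>"] by simp
qed

lemma mod_hom_minus:
  assumes h: "mod_hom R M N h" and M: "module R M" and N: "module R N"
    and x: "x \<in> carrier M" and y: "y \<in> carrier M"
  shows "h (x \<ominus>\<^bsub>M\<^esub> y) = h x \<ominus>\<^bsub>N\<^esub> h y"
proof -
  interpret M: module R M by fact
  interpret N: module R N by fact
  have inv: "\<ominus>\<^bsub>M\<^esub> y = (\<ominus>\<^bsub>R\<^esub> \<one>\<^bsub>R\<^esub>) \<odot>\<^bsub>M\<^esub> y"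
    using M.smult_l_minus[of "\<one>\<^bsub>R\<^esub>" y] y by simp
  have "h (\<ominus>\<^bsub>M\<^esub> y) = \<ominus>\<^bsub>N\<^esub> h y"
    unfolding inv using N.smult_l_minus[of "\<one>\<^bsub>R\<^esub>" "h y"] y mod_homD[OF h] by simp
  then show ?thesis
    using x y mod_homD[OF h] by (simp add: a_minus_def)
qed

lemma mod_hom_cong:
  assumes "mod_hom R M N h" "module R M" "\<And>x. x \<in> carrier M \<Longrightarrow> k x = h x"
  shows "mod_hom R M N k"
proof -
  interpret M: module R M by fact
  show ?thesis using assms(3) mod_homD[OF assms(1)] by (intro mod_homI) auto
qed

lemma restrict_in_module_Hom:
  assumes "mod_hom R M N h" "module R M"
  shows "restrict h (carrier M) \<in> module_Hom R M N"
  by (auto simp: module_Hom_iff intro: mod_hom_cong[OF assms])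

lemma mod_hom_comp:
  assumes "mod_hom R L M g" "mod_hom R M N h"
  shows "mod_hom R L N (\<lambda>x. h (g x))"
  using mod_homD[OF assms(1)] mod_homD[OF assms(2)] by (intro mod_homI) auto

lemma mod_hom_id: "mod_hom R M M (\<lambda>x. x)"
  by (simp add: mod_hom_def)

lemma mod_hom_const_zero:
  assumes "module R N" shows "mod_hom R M N (\<lambda>x. \<zero>\<^bsub>N\<^esub>)"
proof -
  interpret N: module R N by fact
  show ?thesis by (intro mod_homI) auto
qed

lemma mod_hom_add:
  assumes "mod_hom R M N g" "mod_hom R M N h" "module R N"
  shows "mod_hom R M N (\<lambda>x. g x \<oplus>\<^bsub>N\<^esub> h x)"
proof -
  interpret N: module R N by fact
  show ?thesis
    using mod_homD[OF assms(1)] mod_homD[OF assms(2)]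
    by (intro mod_homI) (auto simp: N.M.a_ac N.smult_r_distr)
qed

lemma mod_hom_smult:
  assumes "mod_hom R M N h" "module R N" "r \<in> carrier R"
  shows "mod_hom R M N (\<lambda>x. r \<odot>\<^bsub>N\<^esub> h x)"
proof -
  interpret N: module R N by fact
  show ?thesis
    using mod_homD[OF assms(1)] assms(3)
    by (intro mod_homI) (auto simp: N.smult_r_distr N.R.m_comm simp flip: N.smult_assoc1)
qed

lemma mod_hom_diff:
  assumes "mod_hom R M N g" "mod_hom R M N h" "module R N"
  shows "mod_hom R M N (\<lambda>x. g x \<ominus>\<^bsub>N\<^esub> h x)"
proof -
  interpret N: module R N by fact
  show ?thesis
    using mod_homD[OF assms(1)] mod_homD[OF assms(2)]
    by (intro mod_homI)
      (auto simp: a_minus_def N.M.a_ac N.M.minus_add N.smult_r_distr N.smult_r_minus)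
qed

lemma regular_module:
  assumes "cring R" shows "module R (regular_module R)"
proof -
  interpret cring R by fact
  have "abelian_group (regular_module R)"
  proof (rule abelian_groupI)
    fix x assume "x \<in> carrier (regular_module R)"
    then show "\<exists>y \<in> carrier (regular_module R).
        y \<oplus>\<^bsub>regular_module R\<^esub> x = \<zero>\<^bsub>regular_module R\<^esub>"
      by (intro bexI[of _ "\<ominus>\<^bsub>R\<^esub> x"]) (auto simp: regular_module_def l_neg)
  qed (auto simp: regular_module_def a_ac)
  then show ?thesis
    by (rule moduleI[OF assms]) (auto simp: regular_module_def l_distr r_distr m_assoc)
qed

lemma regular_module_simps [simp]:
  "carrier (regular_module R) = carrier R"
  "x \<oplus>\<^bsub>regular_module R\<^esub> y = x \<oplus>\<^bsub>R\<^esub> y"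
  "\<zero>\<^bsub>regular_module R\<^esub> = \<zero>\<^bsub>R\<^esub>"
  "x \<odot>\<^bsub>regular_module R\<^esub> y = x \<otimes>\<^bsub>R\<^esub> y"
  by (simp_all add: regular_module_def)

lemma mod_hom_smult_elem:
  assumes "module R N" "n \<in> carrier N"
  shows "mod_hom R (regular_module R) N (\<lambda>r. r \<odot>\<^bsub>N\<^esub> n)"
proof -
  interpret N: module R N by fact
  show ?thesis using assms(2) by (intro mod_homI) (auto simp: N.smult_l_distr N.smult_assoc1)
qed

lemma direct_sum_simps [simp]:
  "carrier (direct_sum M N) = carrier M \<times> carrier N"
  "(x, y) \<oplus>\<^bsub>direct_sum M N\<^esub> (x', y') = (x \<oplus>\<^bsub>M\<^esub> x', y \<oplus>\<^bsub>N\<^esub> y')"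
  "\<zero>\<^bsub>direct_sum M N\<^esub> = (\<zero>\<^bsub>M\<^esub>, \<zero>\<^bsub>N\<^esub>)"
  "r \<odot>\<^bsub>direct_sum M N\<^esub> (x, y) = (r \<odot>\<^bsub>M\<^esub> x, r \<odot>\<^bsub>N\<^esub> y)"
  by (simp_all add: direct_sum_def)

lemma direct_sum_module:
  assumes "module R M" "module R N" shows "module R (direct_sum M N)"
proof -
  interpret M: module R M by fact
  interpret N: module R N by fact
  have "abelian_group (direct_sum M N)"
  proof (rule abelian_groupI)
    fix x assume "x \<in> carrier (direct_sum M N)"
    then show "\<exists>y \<in> carrier (direct_sum M N). y \<oplus>\<^bsub>direct_sum M N\<^esub> x = \<zero>\<^bsub>direct_sum M N\<^esub>"
      by (intro bexI[of _ "(\<ominus>\<^bsub>M\<^esub> fst x, \<ominus>\<^bsub>N\<^esub> snd x)"]) (auto simp: M.M.l_neg N.M.l_neg)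
  qed (auto simp: M.M.a_ac N.M.a_ac)
  then show ?thesis
    by (rule moduleI[OF M.R.is_cring])
      (auto simp: M.smult_l_distr N.smult_l_distr M.smult_r_distr N.smult_r_distr
         M.smult_assoc1 N.smult_assoc1)
qed

lemma mod_hom_direct_sum:
  assumes "module R M" "module R N"
  shows "mod_hom R (direct_sum M N) M fst" "mod_hom R (direct_sum M N) N snd"
    "mod_hom R M (direct_sum M N) (\<lambda>x. (x, \<zero>\<^bsub>N\<^esub>))" "mod_hom R N (direct_sum M N) (\<lambda>y. (\<zero>\<^bsub>M\<^esub>, y))"
proof -
  interpret M: module R M by fact
  interpret N: module R N by fact
  show "mod_hom R (direct_sum M N) M fst" "mod_hom R (direct_sum M N) N snd"
    "mod_hom R M (direct_sum M N) (\<lambda>x. (x, \<zero>\<^bsub>N\<^esub>))" "mod_hom R N (direct_sum M N) (\<lambda>y. (\<zero>\<^bsub>M\<^esub>, y))"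
    by (auto intro!: mod_homI)
qed

lemma mod_hom_inv:
  assumes h: "mod_hom R M N h" and bij: "bij_betw h (carrier M) (carrier N)" and M: "module R M"
  shows "mod_hom R N M (inv_into (carrier M) h)"
proof -
  interpret M: module R M by fact
  have inv: "inv_into (carrier M) h (h x) = x" if "x \<in> carrier M" for x
    using bij that by (simp add: bij_betw_def)
  have cN: "carrier N = h ` carrier M" using bij by (simp add: bij_betw_def)
  show ?thesis
    by (rule mod_homI) (auto simp: cN inv simp flip: mod_homD(2,3)[OF h])
qed

lemma in_a_kernel_iff: "x \<in> a_kernel M N h \<longleftrightarrow> x \<in> carrier M \<and> h x = \<zero>\<^bsub>N\<^esub>"
  by (simp add: a_kernel_def kernel_def)

lemma submodule_kernel:
  assumes h: "mod_hom R M N h" and M: "module R M" and N: "module R N"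
  shows "submodule {x \<in> carrier M. h x = \<zero>\<^bsub>N\<^esub>} R M"
proof -
  interpret M: module R M by fact
  interpret N: module R N by fact
  note hD = mod_homD[OF h] and h0 = mod_hom_zero[OF assms]
  have "h (\<ominus>\<^bsub>M\<^esub> x) = \<zero>\<^bsub>N\<^esub>" if "x \<in> carrier M" "h x = \<zero>\<^bsub>N\<^esub>" for x
    using mod_hom_minus[OF assms M.M.zero_closed that(1)] that h0 by (simp add: a_minus_def)
  then show ?thesis by (intro M.submoduleI) (auto simp: hD h0)
qed

lemma submodule_image:
  assumes h: "mod_hom R M N h" and M: "module R M" and N: "module R N"
  shows "submodule (h ` carrier M) R N"
proof -
  interpret M: module R M by fact
  interpret N: module R N by fact
  note hD = mod_homD[OF h] and h0 = mod_hom_zero[OF assms]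
  show ?thesis
  proof (rule N.submoduleI)
    show "\<zero>\<^bsub>N\<^esub> \<in> h ` carrier M" using h0 by (metis M.M.zero_closed image_eqI)
    fix y assume "y \<in> h ` carrier M"
    then obtain x where x: "x \<in> carrier M" "y = h x" by auto
    have "\<ominus>\<^bsub>N\<^esub> y = h (\<zero>\<^bsub>M\<^esub> \<ominus>\<^bsub>M\<^esub> x)"
      using mod_hom_minus[OF assms M.M.zero_closed x(1)] x h0 hD by (simp add: a_minus_def)
    then show "\<ominus>\<^bsub>N\<^esub> y \<in> h ` carrier M" using x by simp
  next
    fix x y assume "x \<in> h ` carrier M" "y \<in> h ` carrier M"
    then show "x \<oplus>\<^bsub>N\<^esub> y \<in> h ` carrier M"
      by (auto simp flip: hD(2))
  qed (auto simp: hD simp flip: hD(3))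
qed

lemma submodule_module:
  assumes "submodule H R M" "module R M" shows "module R (M\<lparr>carrier := H\<rparr>)"
  using assms by (rule submodule.submodule_is_module)

lemma mod_hom_submodule_incl:
  assumes "submodule H R M" "module R M" shows "mod_hom R (M\<lparr>carrier := H\<rparr>) M (\<lambda>x. x)"
  using module.submoduleE(1)[OF assms(2,1)] by (intro mod_homI) auto

lemma mod_hom_into_submodule:
  assumes "mod_hom R M N h" "\<And>x. x \<in> carrier M \<Longrightarrow> h x \<in> H"
  shows "mod_hom R M (N\<lparr>carrier := H\<rparr>) h"
  using mod_homD[OF assms(1)] assms(2) by (intro mod_homI) auto

text \<open>The homomorphism theorem, with the image of \<open>d\<close> in place of a quotient by
  its kernel, so that no cosets appear.\<close>

lemma mod_hom_factor:
  assumes d: "mod_hom R P Q d" and h: "mod_hom R P N h"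
    and P: "module R P" and Q: "module R Q" and N: "module R N"
    and ker: "\<And>x. x \<in> carrier P \<Longrightarrow> d x = \<zero>\<^bsub>Q\<^esub> \<Longrightarrow> h x = \<zero>\<^bsub>N\<^esub>"
  obtains k where "mod_hom R (Q\<lparr>carrier := d ` carrier P\<rparr>) N k"
    "\<And>x. x \<in> carrier P \<Longrightarrow> k (d x) = h x"
proof -
  interpret P: module R P by fact
  interpret Q: module R Q by fact
  interpret N: module R N by fact
  note dD = mod_homD[OF d] and hD = mod_homD[OF h]
  define k where "k y = h (inv_into (carrier P) d y)" for y
  have k: "k (d x) = h x" if x: "x \<in> carrier P" for x
  proof -
    let ?x = "inv_into (carrier P) d (d x)"
    have x': "?x \<in> carrier P" "d ?x = d x"
      using x by (auto intro: inv_into_into f_inv_into_f)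
    \<comment> \<open>Two preimages of the same point differ by an element of the kernel of
      \<open>d\<close>, where \<open>h\<close> vanishes; hence the chosen preimage does not
      matter.\<close>
    have "h (?x \<ominus>\<^bsub>P\<^esub> x) = \<zero>\<^bsub>N\<^esub>"
      using x x' mod_hom_minus[OF d P Q x'(1) x] dD by (intro ker) (auto simp: a_minus_def Q.M.r_neg)
    then have "h ?x \<ominus>\<^bsub>N\<^esub> h x = \<zero>\<^bsub>N\<^esub>" using mod_hom_minus[OF h P N x'(1) x] by simp
    then show ?thesis using x x' hD by (metis k_def N.M.minus_minus N.M.minus_equality N.M.a_inv_closed a_minus_def)
  qed
  show thesis
  proof (rule that[OF _ k])
    show "mod_hom R (Q\<lparr>carrier := d ` carrier P\<rparr>) N k"
      by (rule mod_homI) (auto simp: k hD simp flip: dD(2,3))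
  qed
qed

text \<open>The lifting property for bare homomorphisms. \<open>A\<close> and \<open>B\<close> stay
  small because projectivity is tested on small modules only.\<close>

lemma projective_lift:
  fixes A B :: "'a small_module"
  assumes P: "projective_module R P" and A: "module R A" and B: "module R B"
    and g: "mod_hom R A B g" and surj: "\<And>y. y \<in> carrier B \<Longrightarrow> \<exists>x \<in> carrier A. g x = y"
    and h: "mod_hom R P B h"
  obtains k where "mod_hom R P A k" "\<And>x. x \<in> carrier P \<Longrightarrow> g (k x) = h x"
proof -
  have PM: "module R P" using P by (simp add: projective_module_def)
  let ?g = "restrict g (carrier A)" and ?h = "restrict h (carrier P)"
  have "?g \<in> module_Hom R A B" "?h \<in> module_Hom R P B"
    using restrict_in_module_Hom g h A PM by blast+
  moreover have "?g ` carrier A = carrier B"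
    using surj mod_homD(1)[OF g] by force
  ultimately obtain k where k: "k \<in> module_Hom R P A" "compose (carrier P) ?g k = ?h"
    using P A B unfolding projective_module_def by blast
  have kM: "mod_hom R P A k" using k(1) by (simp add: module_Hom_iff)
  show thesis
  proof (rule that[OF kM])
    fix x assume x: "x \<in> carrier P"
    then have "compose (carrier P) ?g k x = h x" using k(2) by simp
    then show "g (k x) = h x" using x mod_homD(1)[OF kM x] by (simp add: compose_def)
  qed
qed

text \<open>Injectivity in the form suited to complexes: \<open>d\<close> may have a kernel as long
  as \<open>h\<close> vanishes on it. The map induced on the image of \<open>d\<close> is extended
  along the inclusion of that image.\<close>

lemma injective_extend:
  fixes P Q :: "'a small_module"
  assumes I: "injective_module R I" and P: "module R P" and Q: "module R Q"
    and d: "mod_hom R P Q d" and h: "mod_hom R P I h"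
    and ker: "\<And>x. x \<in> carrier P \<Longrightarrow> d x = \<zero>\<^bsub>Q\<^esub> \<Longrightarrow> h x = \<zero>\<^bsub>I\<^esub>"
  obtains k where "mod_hom R Q I k" "\<And>x. x \<in> carrier P \<Longrightarrow> k (d x) = h x"
proof -
  have IM: "module R I" using I by (simp add: injective_module_def)
  let ?A = "Q\<lparr>carrier := d ` carrier P\<rparr>"
  have sub: "submodule (d ` carrier P) R Q" by (rule submodule_image[OF d P Q])
  have A: "module R ?A" by (rule submodule_module[OF sub Q])
  obtain h' where h': "mod_hom R ?A I h'" "\<And>x. x \<in> carrier P \<Longrightarrow> h' (d x) = h x"
    using mod_hom_factor[OF d h P Q IM ker] by blast
  let ?g = "restrict (\<lambda>x. x) (carrier ?A)" and ?h = "restrict h' (carrier ?A)"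
  have g: "?g \<in> module_Hom R ?A Q" and "?h \<in> module_Hom R ?A I"
    using restrict_in_module_Hom[OF mod_hom_submodule_incl[OF sub Q] A]
      restrict_in_module_Hom[OF h'(1) A] by blast+
  moreover have "inj_on ?g (carrier ?A)" by (auto simp: inj_on_def)
  ultimately obtain k where k: "k \<in> module_Hom R Q I" "compose (carrier ?A) k ?g = ?h"
    using I A Q unfolding injective_module_def by blast
  show thesis
  proof (rule that)
    show "mod_hom R Q I k" using k(1) by (simp add: module_Hom_iff)
    fix x assume x: "x \<in> carrier P"
    then have "compose (carrier ?A) k ?g (d x) = h x" using k(2) h'(2) by simp
    then show "k (d x) = h x" using x by (simp add: compose_def)
  qed
qed

section \<open>Homomorphisms of finite rank\<close>

text \<open>
  For a finitely generated module these are the homomorphisms that factor through a projective module.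
\<close>

inductive finite_rank ::
    "('a, 'c) ring_scheme \<Rightarrow> ('a, 'm) module \<Rightarrow> ('a, 'n) module \<Rightarrow> ('m \<Rightarrow> 'n) \<Rightarrow> bool"
  for R M N where
  zero: "(\<And>x. x \<in> carrier M \<Longrightarrow> t x = \<zero>\<^bsub>N\<^esub>) \<Longrightarrow> finite_rank R M N t"
| add: "finite_rank R M N t \<Longrightarrow> mod_hom R M (regular_module R) \<phi> \<Longrightarrow> n \<in> carrier N \<Longrightarrow>
    (\<And>x. x \<in> carrier M \<Longrightarrow> t' x = t x \<oplus>\<^bsub>N\<^esub> \<phi> x \<odot>\<^bsub>N\<^esub> n) \<Longrightarrow> finite_rank R M N t'"

lemma finite_rank_cong:
  assumes "finite_rank R M N t" "\<And>x. x \<in> carrier M \<Longrightarrow> t' x = t x"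
  shows "finite_rank R M N t'"
  using assms(1)
proof cases
  case zero then show ?thesis using assms(2) by (simp add: finite_rank.zero)
next
  case (add t0 \<phi> n)
  show ?thesis by (rule finite_rank.add[OF add(1-3)]) (simp add: assms(2) add(4))
qed

lemma finite_rank_mod_hom:
  assumes "finite_rank R M N t" and M: "module R M" and N: "module R N"
  shows "mod_hom R M N t"
  using assms(1)
proof induction
  case (zero t)
  show ?case by (rule mod_hom_cong[OF mod_hom_const_zero[OF N] M zero])
next
  case (add t \<phi> n t')
  show ?case
    by (rule mod_hom_cong[OF mod_hom_add[OF add.IH
          mod_hom_comp[OF add.hyps(2) mod_hom_smult_elem[OF N add.hyps(3)]] N] M add.hyps(4)])
qed

lemma finite_rank_add:
  assumes "finite_rank R M N s" "finite_rank R M N t" and M: "module R M" and N: "module R N"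
  shows "finite_rank R M N (\<lambda>x. s x \<oplus>\<^bsub>N\<^esub> t x)"
  using assms(2)
proof induction
  case (zero t)
  interpret N: module R N by fact
  show ?case
    using zero mod_homD(1)[OF finite_rank_mod_hom[OF assms(1) M N]]
    by - (rule finite_rank_cong[OF assms(1)], simp)
next
  case (add t \<phi> n t')
  interpret N: module R N by fact
  show ?case
    using add.hyps(3,4) mod_homD(1)[OF finite_rank_mod_hom[OF assms(1) M N]]
      mod_homD(1)[OF finite_rank_mod_hom[OF add.hyps(1) M N]] mod_homD(1)[OF add.hyps(2)]
    by - (rule finite_rank.add[OF add.IH add.hyps(2,3)], simp add: N.M.a_assoc)
qed

text \<open>A functional composed with \<open>g\<close> is a functional, and \<open>h\<close> moves
  the vector \<open>n\<close> to \<open>h n\<close>. With closure under sums, finite rank maps thus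
  behave like a two-sided ideal.\<close>

lemma finite_rank_comp:
  assumes "finite_rank R M N t" and g: "mod_hom R L M g" and h: "mod_hom R N K h"
    and M: "module R M" and N: "module R N" and K: "module R K"
  shows "finite_rank R L K (\<lambda>x. h (t (g x)))"
  using assms(1)
proof induction
  case (zero t)
  show ?case
    by (rule finite_rank.zero) (simp add: zero mod_homD(1)[OF g] mod_hom_zero[OF h N K])
next
  case (add t \<phi> n t')
  interpret N: module R N by fact
  show ?case
    using add.hyps(3,4) mod_homD(1)[OF finite_rank_mod_hom[OF add.hyps(1) M N]] mod_homD(1)[OF add.hyps(2)]
    by - (rule finite_rank.add[OF add.IH mod_hom_comp[OF g add.hyps(2)] mod_homD(1)[OF h add.hyps(3)]],
      simp add: mod_homD[OF h] mod_homD(1)[OF g])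
qed

text \<open>Only the finitely many vectors are lifted, one preimage each, while the functionals
  stay; so a finite rank map lifts along any surjection, whatever its source.\<close>

lemma finite_rank_lift:
  assumes "finite_rank R M B t" and g: "mod_hom R A B g"
    and surj: "\<And>y. y \<in> carrier B \<Longrightarrow> \<exists>x \<in> carrier A. g x = y"
    and M: "module R M" and A: "module R A" and B: "module R B"
  obtains t' where "finite_rank R M A t'" "\<And>x. x \<in> carrier M \<Longrightarrow> g (t' x) = t x"
  using assms(1)
proof (induction arbitrary: thesis)
  case (zero t)
  then show ?case
    using mod_hom_zero[OF g A B] by (intro zero(2)[of "\<lambda>x. \<zero>\<^bsub>A\<^esub>"] finite_rank.zero) simp_all
next
  case (add t \<phi> n t')
  interpret A: module R A by fact
  obtain s where s: "finite_rank R M A s" "\<And>x. x \<in> carrier M \<Longrightarrow> g (s x) = t x"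
    using add.IH by blast
  obtain m where m: "m \<in> carrier A" "g m = n" using surj add.hyps(3) by blast
  show ?case
  proof (rule add.prems)
    show "finite_rank R M A (\<lambda>x. s x \<oplus>\<^bsub>A\<^esub> \<phi> x \<odot>\<^bsub>A\<^esub> m)"
      by (rule finite_rank.add[OF s(1) add.hyps(2) m(1)]) simp
  qed (use add.hyps s m mod_homD[OF g] mod_homD(1)[OF finite_rank_mod_hom[OF s(1) M A]]
        mod_homD(1)[OF add.hyps(2)] in auto)
qed

text \<open>Dual to lifting: the vectors stay and only functionals are extended, so extension of
  maps into \<open>N\<close> is reduced to extension of maps into the ring.\<close>

lemma finite_rank_extend:
  assumes "finite_rank R A N t" and g: "mod_hom R A P g"
    and ext: "\<And>\<phi>. mod_hom R A (regular_module R) \<phi> \<Longrightarrow>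
      \<exists>\<psi>. mod_hom R P (regular_module R) \<psi> \<and> (\<forall>x \<in> carrier A. \<psi> (g x) = \<phi> x)"
  obtains t' where "finite_rank R P N t'" "\<And>x. x \<in> carrier A \<Longrightarrow> t' (g x) = t x"
  using assms(1)
proof (induction arbitrary: thesis)
  case (zero t)
  have "finite_rank R P N (\<lambda>x. \<zero>\<^bsub>N\<^esub>)" by (rule finite_rank.zero) simp
  then show ?case using zero by auto
next
  case (add t \<phi> n t')
  obtain s where s: "finite_rank R P N s" "\<And>x. x \<in> carrier A \<Longrightarrow> s (g x) = t x"
    using add.IH by blast
  obtain \<psi> where \<psi>: "mod_hom R P (regular_module R) \<psi>" "\<And>x. x \<in> carrier A \<Longrightarrow> \<psi> (g x) = \<phi> x"
    using ext[OF add.hyps(2)] by blast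
  show ?case
  proof (rule add.prems)
    show "finite_rank R P N (\<lambda>x. s x \<oplus>\<^bsub>N\<^esub> \<psi> x \<odot>\<^bsub>N\<^esub> n)"
      by (rule finite_rank.add[OF s(1) \<psi>(1) add.hyps(3)]) simp
  qed (use add.hyps s \<psi> in auto)
qed

abbreviation finite_rank_scalar :: "('a, 'c) ring_scheme \<Rightarrow> ('a, 'm) module \<Rightarrow> 'a \<Rightarrow> bool" where
  "finite_rank_scalar R M r \<equiv> finite_rank R M M (\<lambda>x. r \<odot>\<^bsub>M\<^esub> x)"

section \<open>Spans and finite generation\<close>

text \<open>Spans are inductive so that closure properties follow by rule induction instead of
  computations with finite sums; \<open>lspan_finite\<close> is the bridge to the definition of
  finite generation.\<close>

inductive_set lspan :: "('a, 'c) ring_scheme \<Rightarrow> ('a, 'm) module \<Rightarrow> 'm set \<Rightarrow> 'm set"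
  for R M A where
  zero: "\<zero>\<^bsub>M\<^esub> \<in> lspan R M A"
| add: "a \<in> A \<Longrightarrow> r \<in> carrier R \<Longrightarrow> x \<in> lspan R M A \<Longrightarrow> r \<odot>\<^bsub>M\<^esub> a \<oplus>\<^bsub>M\<^esub> x \<in> lspan R M A"

lemma submodule_zero: "submodule H R M \<Longrightarrow> \<zero>\<^bsub>M\<^esub> \<in> H"
  by (auto simp: submodule_def dest: subgroup.one_closed)

lemma lspan_minimal:
  assumes H: "submodule H R M" and M: "module R M" and A: "A \<subseteq> H"
  shows "lspan R M A \<subseteq> H"
proof
  note HE = module.submoduleE[OF M H]
  fix x assume "x \<in> lspan R M A"
  then show "x \<in> H"
  proof induction
    case zero show ?case by (rule submodule_zero[OF H])
  next
    case (add a r x)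
    then show ?case using HE(4,5) A by (simp add: subsetD)
  qed
qed

lemma lspan_mono: "A \<subseteq> B \<Longrightarrow> lspan R M A \<subseteq> lspan R M B"
proof
  fix x assume "A \<subseteq> B" "x \<in> lspan R M A"
  then show "x \<in> lspan R M B" by (induction rule: lspan.induct[OF \<open>x \<in> lspan R M A\<close>]) (auto intro: lspan.intros)
qed

lemma lspan_submodule:
  assumes "module R M" "A \<subseteq> carrier M"
  shows "submodule (lspan R M A) R M"
proof -
  interpret M: module R M by fact
  have sub: "lspan R M A \<subseteq> carrier M"
    by (rule lspan_minimal[OF M.carrier_is_submodule assms])
  have add: "x \<oplus>\<^bsub>M\<^esub> y \<in> lspan R M A" if "x \<in> lspan R M A" "y \<in> lspan R M A" for x y
    using that(1)
  proof induction
    case zero then show ?case using that(2) sub by auto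
  next
    case (add a r x)
    then have "r \<odot>\<^bsub>M\<^esub> a \<oplus>\<^bsub>M\<^esub> x \<oplus>\<^bsub>M\<^esub> y = r \<odot>\<^bsub>M\<^esub> a \<oplus>\<^bsub>M\<^esub> (x \<oplus>\<^bsub>M\<^esub> y)"
      using assms(2) sub that(2) by (intro M.M.a_assoc) auto
    then show ?case using add by (auto intro: lspan.add)
  qed
  have smult: "s \<odot>\<^bsub>M\<^esub> x \<in> lspan R M A" if "x \<in> lspan R M A" "s \<in> carrier R" for s x
    using that(1)
  proof induction
    case zero then show ?case using that(2) by (auto intro: lspan.zero)
  next
    case (add a r x)
    then have "s \<odot>\<^bsub>M\<^esub> (r \<odot>\<^bsub>M\<^esub> a \<oplus>\<^bsub>M\<^esub> x) = (s \<otimes>\<^bsub>R\<^esub> r) \<odot>\<^bsub>M\<^esub> a \<oplus>\<^bsub>M\<^esub> s \<odot>\<^bsub>M\<^esub> x"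
      using assms(2) sub that(2) by (subst M.smult_r_distr) (auto simp: M.smult_assoc1)
    then show ?case using add that(2) by (auto intro: lspan.add)
  qed
  have "\<ominus>\<^bsub>M\<^esub> x \<in> lspan R M A" if "x \<in> lspan R M A" for x
    using smult[OF that, of "\<ominus>\<^bsub>R\<^esub> \<one>\<^bsub>R\<^esub>"] M.smult_l_minus[of "\<one>\<^bsub>R\<^esub>" x] that sub by auto
  then show ?thesis using sub add smult by (intro M.submoduleI) (auto intro: lspan.zero)
qed

lemma lspan_superset:
  assumes "module R M" "A \<subseteq> carrier M" shows "A \<subseteq> lspan R M A"
proof
  interpret M: module R M by fact
  fix a assume "a \<in> A"
  then show "a \<in> lspan R M A"
    using lspan.add[OF \<open>a \<in> A\<close> M.R.one_closed lspan.zero, of M] assms(2) by auto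
qed

lemma lspan_finite:
  assumes M: "module R M" and A: "finite A" "A \<subseteq> carrier M"
  shows "x \<in> lspan R M A \<longleftrightarrow> (\<exists>c \<in> A \<rightarrow> carrier R. x = (\<Oplus>\<^bsub>M\<^esub>a\<in>A. c a \<odot>\<^bsub>M\<^esub> a))"
proof
  interpret M: module R M by fact
  assume "x \<in> lspan R M A"
  then show "\<exists>c \<in> A \<rightarrow> carrier R. x = (\<Oplus>\<^bsub>M\<^esub>a\<in>A. c a \<odot>\<^bsub>M\<^esub> a)"
  proof induction
    case zero
    have "(\<Oplus>\<^bsub>M\<^esub>a\<in>A. \<zero>\<^bsub>R\<^esub> \<odot>\<^bsub>M\<^esub> a) = \<zero>\<^bsub>M\<^esub>"
      using A by (intro M.M.add.finprod_one_eqI) auto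
    then show ?case by (intro bexI[of _ "\<lambda>_. \<zero>\<^bsub>R\<^esub>"]) auto
  next
    case (add b r x)
    then obtain c where c: "c \<in> A \<rightarrow> carrier R" "x = (\<Oplus>\<^bsub>M\<^esub>a\<in>A. c a \<odot>\<^bsub>M\<^esub> a)" by blast
    have b: "b \<in> carrier M" using add A by auto
    have cl: "(\<lambda>a. c a \<odot>\<^bsub>M\<^esub> a) \<in> (A - {b}) \<rightarrow> carrier M" "c b \<in> carrier R"
      using A(2) c(1) add(1) by auto
    \<comment> \<open>The new generator \<open>b\<close> may already occur in the sum, so its
      coefficient is increased rather than set.\<close>
    let ?c = "c(b := r \<oplus>\<^bsub>R\<^esub> c b)"
    have A': "A = insert b (A - {b})" using add by auto
    have "(\<Oplus>\<^bsub>M\<^esub>a\<in>A. ?c a \<odot>\<^bsub>M\<^esub> a) = ?c b \<odot>\<^bsub>M\<^esub> b \<oplus>\<^bsub>M\<^esub> (\<Oplus>\<^bsub>M\<^esub>a\<in>A - {b}. ?c a \<odot>\<^bsub>M\<^esub> a)"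
      using A cl b add(2) by (subst A', subst M.M.finsum_insert) (auto simp: Pi_iff)
    also have "(\<Oplus>\<^bsub>M\<^esub>a\<in>A - {b}. ?c a \<odot>\<^bsub>M\<^esub> a) = (\<Oplus>\<^bsub>M\<^esub>a\<in>A - {b}. c a \<odot>\<^bsub>M\<^esub> a)"
      using cl by (intro M.M.finsum_cong') auto
    also have "?c b \<odot>\<^bsub>M\<^esub> b \<oplus>\<^bsub>M\<^esub> \<dots> = r \<odot>\<^bsub>M\<^esub> b \<oplus>\<^bsub>M\<^esub> (c b \<odot>\<^bsub>M\<^esub> b \<oplus>\<^bsub>M\<^esub> (\<Oplus>\<^bsub>M\<^esub>a\<in>A - {b}. c a \<odot>\<^bsub>M\<^esub> a))"
      using cl b add(2) by (simp add: M.smult_l_distr M.M.a_assoc M.M.finsum_closed)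
    also have "c b \<odot>\<^bsub>M\<^esub> b \<oplus>\<^bsub>M\<^esub> (\<Oplus>\<^bsub>M\<^esub>a\<in>A - {b}. c a \<odot>\<^bsub>M\<^esub> a) = x"
      using A cl b c(2) by (subst (asm) A', subst (asm) M.M.finsum_insert) auto
    finally show ?case
      using c(1) cl(2) add(2) by (intro bexI[of _ ?c]) (auto simp: c(2)[symmetric] Pi_iff)
  qed
next
  interpret M: module R M by fact
  assume "\<exists>c \<in> A \<rightarrow> carrier R. x = (\<Oplus>\<^bsub>M\<^esub>a\<in>A. c a \<odot>\<^bsub>M\<^esub> a)"
  then obtain c where c: "c \<in> A \<rightarrow> carrier R" "x = (\<Oplus>\<^bsub>M\<^esub>a\<in>A. c a \<odot>\<^bsub>M\<^esub> a)" by blast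
  have "(\<Oplus>\<^bsub>M\<^esub>a\<in>B. c a \<odot>\<^bsub>M\<^esub> a) \<in> lspan R M A" if "B \<subseteq> A" for B
    using finite_subset[OF that A(1)] that
  proof (induction B rule: finite_induct)
    case empty then show ?case by (simp add: lspan.zero)
  next
    case (insert b B)
    then have "(\<Oplus>\<^bsub>M\<^esub>a\<in>insert b B. c a \<odot>\<^bsub>M\<^esub> a) = c b \<odot>\<^bsub>M\<^esub> b \<oplus>\<^bsub>M\<^esub> (\<Oplus>\<^bsub>M\<^esub>a\<in>B. c a \<odot>\<^bsub>M\<^esub> a)"
      using A(2) c(1) by (intro M.M.finsum_insert) auto
    then show ?case using insert c(1) by (auto intro: lspan.add)
  qed
  then show "x \<in> lspan R M A" using c by simp
qed

lemma fg_module_iff: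
  "fg_module R M \<longleftrightarrow> module R M \<and> (\<exists>A. finite A \<and> A \<subseteq> carrier M \<and> carrier M \<subseteq> lspan R M A)"
proof -
  have "(\<forall>x \<in> carrier M. \<exists>c \<in> A \<rightarrow> carrier R. x = (\<Oplus>\<^bsub>M\<^esub>a\<in>A. c a \<odot>\<^bsub>M\<^esub> a)) \<longleftrightarrow> carrier M \<subseteq> lspan R M A"
    if "module R M" "finite A" "A \<subseteq> carrier M" for A
    using lspan_finite[OF that] by blast
  then show ?thesis unfolding fg_module_def by blast
qed

lemma fg_module_module: "fg_module R M \<Longrightarrow> module R M"
  by (simp add: fg_module_def)

lemma lspan_image:
  assumes h: "mod_hom R M N h" and M: "module R M" and N: "module R N" and A: "A \<subseteq> carrier M"
    and x: "x \<in> lspan R M A"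
  shows "h x \<in> lspan R N (h ` A)"
proof -
  note sub = module.submoduleE(1)[OF M lspan_submodule[OF M A]]
  interpret M: module R M by fact
  from x show ?thesis
  proof induction
    case zero
    then show ?case using mod_hom_zero[OF h M N] by (simp add: lspan.zero)
  next
    case (add a r x)
    then have "a \<in> carrier M" "x \<in> carrier M" using sub A by auto
    then have "h (r \<odot>\<^bsub>M\<^esub> a \<oplus>\<^bsub>M\<^esub> x) = r \<odot>\<^bsub>N\<^esub> h a \<oplus>\<^bsub>N\<^esub> h x" using add mod_homD[OF h] by simp
    then show ?case using add by (auto intro!: lspan.add)
  qed
qed

lemma fg_module_surj:
  assumes M: "fg_module R M" and N: "module R N" and h: "mod_hom R M N h"
    and surj: "\<And>y. y \<in> carrier N \<Longrightarrow> \<exists>x \<in> carrier M. h x = y"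
  shows "fg_module R N"
proof -
  obtain A where A: "finite A" "A \<subseteq> carrier M" "carrier M \<subseteq> lspan R M A"
    using M by (auto simp: fg_module_iff)
  have "carrier N \<subseteq> lspan R N (h ` A)"
    using surj lspan_image[OF h fg_module_module[OF M] N A(2)] A(3) by blast
  then show ?thesis
    using A N mod_homD(1)[OF h] by (auto simp: fg_module_iff intro!: exI[of _ "h ` A"])
qed

text \<open>The rules of \<open>lspan\<close> refer to the operations of the module but never to its
  carrier.\<close>

lemma lspan_submodule_carrier: "lspan R (M\<lparr>carrier := H\<rparr>) A = lspan R M A"
proof (intro equalityI subsetI)
  show "x \<in> lspan R M A" if "x \<in> lspan R (M\<lparr>carrier := H\<rparr>) A" for x
    using that by induction (auto intro: lspan.intros)
  show "x \<in> lspan R (M\<lparr>carrier := H\<rparr>) A" if "x \<in> lspan R M A" for x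
    using that
  proof induction
    case zero show ?case using lspan.zero[where M = "M\<lparr>carrier := H\<rparr>"] by simp
  next
    case (add a r x) then show ?case using lspan.add[where M = "M\<lparr>carrier := H\<rparr>"] by simp
  qed
qed

section \<open>Submodules of finitely generated modules over a Noetherian ring\<close>

lemma submodule_Int:
  assumes "submodule H R M" "submodule K R M" "module R M"
  shows "submodule (H \<inter> K) R M"
proof -
  interpret M: module R M by fact
  have "\<zero>\<^bsub>M\<^esub> \<in> H" "\<zero>\<^bsub>M\<^esub> \<in> K"
    using assms(1,2) by (auto simp: submodule_def dest: subgroup.one_closed)
  then show ?thesis
    using M.submoduleE[OF assms(1)] M.submoduleE[OF assms(2)] by (intro M.submoduleI) auto
qed

lemma lspan_insertE:
  assumes "x \<in> lspan R M (insert a A)" and M: "module R M" and A: "insert a A \<subseteq> carrier M"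
  obtains r y where "r \<in> carrier R" "y \<in> lspan R M A" "x = r \<odot>\<^bsub>M\<^esub> a \<oplus>\<^bsub>M\<^esub> y"
  using assms(1)
proof (induction arbitrary: thesis)
  case zero
  interpret M: module R M by fact
  show ?case using A by (intro zero[of "\<zero>\<^bsub>R\<^esub>" "\<zero>\<^bsub>M\<^esub>"]) (auto intro: lspan.zero)
next
  case (add b s x)
  interpret M: module R M by fact
  have sub: "lspan R M A \<subseteq> carrier M" using M.submoduleE(1)[OF lspan_submodule[OF M]] A by auto
  obtain r y where ry: "r \<in> carrier R" "y \<in> lspan R M A" "x = r \<odot>\<^bsub>M\<^esub> a \<oplus>\<^bsub>M\<^esub> y" using add.IH by blast
  have c: "a \<in> carrier M" "b \<in> carrier M" "y \<in> carrier M" using add A sub ry by auto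
  show ?case
  proof (cases "b = a")
    case True
    then show ?thesis using ry c add(2)
      by (intro add.prems[of "s \<oplus>\<^bsub>R\<^esub> r" y]) (auto simp: M.smult_l_distr M.M.a_assoc)
  next
    case False
    then have "s \<odot>\<^bsub>M\<^esub> b \<oplus>\<^bsub>M\<^esub> y \<in> lspan R M A" using add(1,2) ry by (auto intro: lspan.add)
    then show ?thesis using ry c add(2)
      by (intro add.prems[of r "s \<odot>\<^bsub>M\<^esub> b \<oplus>\<^bsub>M\<^esub> y"]) (auto simp: M.M.a_ac)
  qed
qed

text \<open>Induction on the number of generators. The coefficients of \<open>a\<close> in elements
  of \<open>H\<close>, taken modulo the span of \<open>A\<close>, form a finitely generated ideal.
  Finitely many elements of \<open>H\<close> realise its generators, and after subtracting a
  combination of them an element of \<open>H\<close> lies in the span of \<open>A\<close>, where the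
  induction hypothesis applies.\<close>

lemma noetherian_submodule_lspan:
  fixes R :: "('a, 'c) ring_scheme" and M :: "('a, 'm) module"
  assumes R: "noetherian_ring R" and M: "module R M" and A: "finite A" "A \<subseteq> carrier M"
    and H: "submodule H R M" "H \<subseteq> lspan R M A"
  shows "\<exists>B. finite B \<and> B \<subseteq> H \<and> H \<subseteq> lspan R M B"
  using A H
proof (induction A arbitrary: H rule: finite_induct)
  case empty
  have "H \<subseteq> {\<zero>\<^bsub>M\<^esub>}"
  proof
    fix x assume "x \<in> H"
    then have "x \<in> lspan R M {}" using empty by auto
    then show "x \<in> {\<zero>\<^bsub>M\<^esub>}" by cases auto
  qed
  then show ?case by (intro exI[of _ "{}"]) (auto intro: lspan.zero)
next
  case (insert a A)
  interpret M: module R M by fact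
  interpret noetherian_ring R by fact
  have a: "a \<in> carrier M" and A: "A \<subseteq> carrier M" using insert by auto
  note LA = lspan_submodule[OF M A]
  note LAE = M.submoduleE[OF LA] and HE = M.submoduleE[OF \<open>submodule H R M\<close>]
  \<comment> \<open>Stated for arbitrary \<open>K\<close> because it is used twice: for
    \<open>H\<close>, and for the span of the chosen elements of \<open>H\<close>.\<close>
  have leading_ideal: "ideal {r \<in> carrier R. \<exists>x \<in> K. x \<ominus>\<^bsub>M\<^esub> r \<odot>\<^bsub>M\<^esub> a \<in> lspan R M A} R"
    (is "ideal ?I R") if K: "submodule K R M" for K
  proof -
    note KE = M.submoduleE[OF K]
    have K0: "\<zero>\<^bsub>M\<^esub> \<in> K" using K by (auto simp: submodule_def dest: subgroup.one_closed)
    have smult: "s \<otimes>\<^bsub>R\<^esub> r \<in> ?I" if "s \<in> carrier R" "r \<in> ?I" for r s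
    proof -
      from that obtain x where x: "x \<in> K" "x \<ominus>\<^bsub>M\<^esub> r \<odot>\<^bsub>M\<^esub> a \<in> lspan R M A" "r \<in> carrier R" by auto
      then have "s \<odot>\<^bsub>M\<^esub> x \<ominus>\<^bsub>M\<^esub> (s \<otimes>\<^bsub>R\<^esub> r) \<odot>\<^bsub>M\<^esub> a = s \<odot>\<^bsub>M\<^esub> (x \<ominus>\<^bsub>M\<^esub> r \<odot>\<^bsub>M\<^esub> a)"
        using that a KE(1) by (auto simp: a_minus_def M.smult_r_distr M.smult_r_minus M.smult_assoc1 subsetD)
      then have "s \<odot>\<^bsub>M\<^esub> x \<ominus>\<^bsub>M\<^esub> (s \<otimes>\<^bsub>R\<^esub> r) \<odot>\<^bsub>M\<^esub> a \<in> lspan R M A"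
        using LAE(4)[OF that(1) x(2)] by simp
      then show ?thesis using that(1) x(3) KE(4)[OF that(1) x(1)] by blast
    qed
    have add: "r \<oplus>\<^bsub>R\<^esub> s \<in> ?I" if "r \<in> ?I" "s \<in> ?I" for r s
    proof -
      from that obtain x y where xy: "x \<in> K" "x \<ominus>\<^bsub>M\<^esub> r \<odot>\<^bsub>M\<^esub> a \<in> lspan R M A" "r \<in> carrier R"
          "y \<in> K" "y \<ominus>\<^bsub>M\<^esub> s \<odot>\<^bsub>M\<^esub> a \<in> lspan R M A" "s \<in> carrier R" by auto
      then have "x \<oplus>\<^bsub>M\<^esub> y \<ominus>\<^bsub>M\<^esub> (r \<oplus>\<^bsub>R\<^esub> s) \<odot>\<^bsub>M\<^esub> a = (x \<ominus>\<^bsub>M\<^esub> r \<odot>\<^bsub>M\<^esub> a) \<oplus>\<^bsub>M\<^esub> (y \<ominus>\<^bsub>M\<^esub> s \<odot>\<^bsub>M\<^esub> a)"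
        using that a KE(1) by (auto simp: a_minus_def M.smult_l_distr M.M.minus_add M.M.a_ac subsetD)
      then have "x \<oplus>\<^bsub>M\<^esub> y \<ominus>\<^bsub>M\<^esub> (r \<oplus>\<^bsub>R\<^esub> s) \<odot>\<^bsub>M\<^esub> a \<in> lspan R M A"
        using LAE(5)[OF xy(2,5)] by simp
      then show ?thesis using xy KE(5)[OF xy(1,4)] by blast
    qed
    have zero: "\<zero>\<^bsub>R\<^esub> \<in> ?I" using K0 a by (auto intro!: bexI[of _ "\<zero>\<^bsub>M\<^esub>"] simp: a_minus_def lspan.zero M.M.minus_equality[of "\<zero>\<^bsub>M\<^esub>" "\<zero>\<^bsub>M\<^esub>"])
    have "subgroup ?I (add_monoid R)"
    proof (rule M.R.add.subgroupI)
      fix r assume "r \<in> ?I"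
      moreover from this have "inv\<^bsub>add_monoid R\<^esub> r = (\<ominus>\<^bsub>R\<^esub> \<one>\<^bsub>R\<^esub>) \<otimes>\<^bsub>R\<^esub> r"
        using M.R.l_minus[of "\<one>\<^bsub>R\<^esub>" r] by (auto simp: a_inv_def)
      ultimately show "\<ominus>\<^bsub>R\<^esub> r \<in> ?I" using smult[of "\<ominus>\<^bsub>R\<^esub> \<one>\<^bsub>R\<^esub>" r] by (simp add: a_inv_def)
    qed (use zero add in blast)+
    then show ?thesis
      using smult M.R.m_comm by (intro idealI M.R.ring_axioms) fastforce+
  qed
  let ?I = "{r \<in> carrier R. \<exists>x \<in> H. x \<ominus>\<^bsub>M\<^esub> r \<odot>\<^bsub>M\<^esub> a \<in> lspan R M A}"
  obtain G where G: "G \<subseteq> carrier R" "finite G" "?I = Idl\<^bsub>R\<^esub> G"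
    using finetely_gen[OF leading_ideal[OF \<open>submodule H R M\<close>]] by blast
  have "G \<subseteq> ?I" using G M.R.genideal_self by simp
  then have "\<forall>g \<in> G. \<exists>x. x \<in> H \<and> x \<ominus>\<^bsub>M\<^esub> g \<odot>\<^bsub>M\<^esub> a \<in> lspan R M A" by auto
  then obtain k where k: "\<And>g. g \<in> G \<Longrightarrow> k g \<in> H" "\<And>g. g \<in> G \<Longrightarrow> k g \<ominus>\<^bsub>M\<^esub> g \<odot>\<^bsub>M\<^esub> a \<in> lspan R M A"
    by metis
  let ?K = "lspan R M (k ` G)"
  have kG: "k ` G \<subseteq> H" using k by auto
  have K: "submodule ?K R M" "?K \<subseteq> H"
    using lspan_submodule[OF M] lspan_minimal[OF \<open>submodule H R M\<close> M kG] kG HE(1) by auto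
  \<comment> \<open>The right-hand side is again an ideal and contains \<open>G\<close>. So every
    leading coefficient of \<open>H\<close> already occurs for an element of the finitely generated
    \<open>?K\<close>.\<close>
  have "Idl\<^bsub>R\<^esub> G \<subseteq> {r \<in> carrier R. \<exists>x \<in> ?K. x \<ominus>\<^bsub>M\<^esub> r \<odot>\<^bsub>M\<^esub> a \<in> lspan R M A}"
    using k(2) G(1) lspan_superset[OF M, of "k ` G"] kG HE(1)
    by (intro M.R.genideal_minimal leading_ideal[OF K(1)]) blast
  then have lead: "\<exists>x \<in> ?K. x \<ominus>\<^bsub>M\<^esub> r \<odot>\<^bsub>M\<^esub> a \<in> lspan R M A" if "r \<in> ?I" for r
    using that G(3) by blast
  obtain B where B: "finite B" "B \<subseteq> H \<inter> lspan R M A" "H \<inter> lspan R M A \<subseteq> lspan R M B"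
    using insert.IH[OF A submodule_Int[OF \<open>submodule H R M\<close> LA M]] by auto
  have BC: "B \<union> k ` G \<subseteq> carrier M" using B(2) kG HE(1) by auto
  note LE = M.submoduleE[OF lspan_submodule[OF M BC]]
  show ?case
  proof (intro exI[of _ "B \<union> k ` G"] conjI subsetI)
    fix x assume x: "x \<in> H"
    obtain r y where ry: "r \<in> carrier R" "y \<in> lspan R M A" "x = r \<odot>\<^bsub>M\<^esub> a \<oplus>\<^bsub>M\<^esub> y"
      using lspan_insertE[OF _ M insert.prems(1)] x insert.prems(3) by blast
    have c: "y \<in> carrier M" "x \<in> carrier M" using LAE(1) HE(1) ry x by auto
    then have "x \<ominus>\<^bsub>M\<^esub> r \<odot>\<^bsub>M\<^esub> a = y"
      using ry a by (simp add: a_minus_def M.M.a_ac M.M.r_neg1 M.M.r_neg)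
    then have "x \<ominus>\<^bsub>M\<^esub> r \<odot>\<^bsub>M\<^esub> a \<in> lspan R M A" using ry by simp
    then have "r \<in> ?I" using x ry(1) by blast
    then obtain z where z: "z \<in> ?K" "z \<ominus>\<^bsub>M\<^esub> r \<odot>\<^bsub>M\<^esub> a \<in> lspan R M A" using lead by blast
    have zc: "z \<in> carrier M" "z \<in> H" using z K HE(1) by auto
    \<comment> \<open>\<open>x\<close> and \<open>z\<close> have the same coefficient
      \<open>r\<close> at \<open>a\<close>, so it cancels in the difference.\<close>
    have "x \<ominus>\<^bsub>M\<^esub> z = y \<oplus>\<^bsub>M\<^esub> \<ominus>\<^bsub>M\<^esub> (z \<ominus>\<^bsub>M\<^esub> r \<odot>\<^bsub>M\<^esub> a)"
      using zc c a ry by (simp add: a_minus_def M.M.minus_add M.M.a_ac)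
    then have "x \<ominus>\<^bsub>M\<^esub> z \<in> lspan R M A" using z ry LAE by auto
    moreover have "x \<ominus>\<^bsub>M\<^esub> z \<in> H" using x zc HE by (auto simp: a_minus_def)
    ultimately have "x \<ominus>\<^bsub>M\<^esub> z \<in> lspan R M (B \<union> k ` G)"
      using B(3) lspan_mono[of B "B \<union> k ` G"] by blast
    moreover have "z \<in> lspan R M (B \<union> k ` G)" using z lspan_mono[of "k ` G" "B \<union> k ` G"] by blast
    ultimately have "x \<ominus>\<^bsub>M\<^esub> z \<oplus>\<^bsub>M\<^esub> z \<in> lspan R M (B \<union> k ` G)" using LE(5) by blast
    moreover have "x \<ominus>\<^bsub>M\<^esub> z \<oplus>\<^bsub>M\<^esub> z = x" using zc c by (simp add: a_minus_def M.M.a_assoc M.M.l_neg)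
    ultimately show "x \<in> lspan R M (B \<union> k ` G)" by simp
  qed (use B G kG in auto)
qed

lemma fg_submodule:
  assumes "noetherian_ring R" "fg_module R M" "submodule H R M"
  shows "fg_module R (M\<lparr>carrier := H\<rparr>)"
proof -
  have M: "module R M" using assms(2) by (rule fg_module_module)
  obtain A where "finite A" "A \<subseteq> carrier M" "carrier M \<subseteq> lspan R M A"
    using assms(2) by (auto simp: fg_module_iff)
  moreover from this have "H \<subseteq> lspan R M A" using module.submoduleE(1)[OF M assms(3)] by simp
  ultimately obtain B where "finite B" "B \<subseteq> H" "H \<subseteq> lspan R M B"
    using noetherian_submodule_lspan[OF assms(1) M _ _ assms(3), of A] by auto
  then show ?thesis
    using submodule_module[OF assms(3) M]
    by (auto simp: fg_module_iff lspan_submodule_carrier intro!: exI[of _ B])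
qed

section \<open>Finite free modules and projective resolutions\<close>

definition free_module :: "('a, 'c) ring_scheme \<Rightarrow> 'm set \<Rightarrow> ('a, 'm \<Rightarrow> 'a) module" where
  "free_module R A = \<lparr>carrier = A \<rightarrow>\<^sub>E carrier R, monoid.mult = undefined, one = undefined,
     ring.zero = (\<lambda>a\<in>A. \<zero>\<^bsub>R\<^esub>), ring.add = (\<lambda>f g. \<lambda>a\<in>A. f a \<oplus>\<^bsub>R\<^esub> g a),
     smult = (\<lambda>r f. \<lambda>a\<in>A. r \<otimes>\<^bsub>R\<^esub> f a)\<rparr>"

lemma free_module_simps [simp]:
  "carrier (free_module R A) = A \<rightarrow>\<^sub>E carrier R"
  "f \<oplus>\<^bsub>free_module R A\<^esub> g = (\<lambda>a\<in>A. f a \<oplus>\<^bsub>R\<^esub> g a)"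
  "\<zero>\<^bsub>free_module R A\<^esub> = (\<lambda>a\<in>A. \<zero>\<^bsub>R\<^esub>)"
  "r \<odot>\<^bsub>free_module R A\<^esub> f = (\<lambda>a\<in>A. r \<otimes>\<^bsub>R\<^esub> f a)"
  by (simp_all add: free_module_def)

lemma free_module_module:
  assumes "cring R" shows "module R (free_module R A)"
proof -
  interpret cring R by fact
  have restrict_id: "restrict g A = f"
    if "f \<in> A \<rightarrow>\<^sub>E carrier R" "\<And>a. a \<in> A \<Longrightarrow> g a = f a" for f g
    using that(2) PiE_arb[OF that(1)] by (intro ext) (metis restrict_apply)
  have "abelian_group (free_module R A)"
  proof (rule abelian_groupI)
    fix x assume x: "x \<in> carrier (free_module R A)"
    have "(\<lambda>a\<in>A. (\<lambda>a\<in>A. \<ominus>\<^bsub>R\<^esub> x a) a \<oplus>\<^bsub>R\<^esub> x a) = (\<lambda>a\<in>A. \<zero>\<^bsub>R\<^esub>)"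
      by (rule restrict_ext) (use x in \<open>simp add: PiE_iff l_neg\<close>)
    moreover have "(\<lambda>a\<in>A. \<ominus>\<^bsub>R\<^esub> x a) \<in> carrier (free_module R A)"
      using x by (simp add: PiE_iff)
    ultimately show "\<exists>y \<in> carrier (free_module R A). y \<oplus>\<^bsub>free_module R A\<^esub> x = \<zero>\<^bsub>free_module R A\<^esub>"
      unfolding free_module_simps by blast
  next
    fix x y z
    assume "x \<in> carrier (free_module R A)" "y \<in> carrier (free_module R A)" "z \<in> carrier (free_module R A)"
    then show "x \<oplus>\<^bsub>free_module R A\<^esub> y \<oplus>\<^bsub>free_module R A\<^esub> z = x \<oplus>\<^bsub>free_module R A\<^esub> (y \<oplus>\<^bsub>free_module R A\<^esub> z)"
      by (auto simp: PiE_iff intro!: restrict_ext a_assoc)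
  next
    fix x y assume "x \<in> carrier (free_module R A)" "y \<in> carrier (free_module R A)"
    then show "x \<oplus>\<^bsub>free_module R A\<^esub> y = y \<oplus>\<^bsub>free_module R A\<^esub> x"
      by (auto simp: PiE_iff intro!: restrict_ext a_comm)
  next
    fix x assume "x \<in> carrier (free_module R A)"
    then show "\<zero>\<^bsub>free_module R A\<^esub> \<oplus>\<^bsub>free_module R A\<^esub> x = x"
      by (auto intro!: restrict_id l_zero dest: PiE_mem)
  qed (auto simp: PiE_iff)
  then show ?thesis
  proof (rule moduleI[OF assms])
    fix x assume "x \<in> carrier (free_module R A)"
    then show "\<one>\<^bsub>R\<^esub> \<odot>\<^bsub>free_module R A\<^esub> x = x"
      by (auto intro!: restrict_id l_one dest: PiE_mem)
  next
    fix r s x y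
    assume "r \<in> carrier R" "s \<in> carrier R" "x \<in> carrier (free_module R A)"
    then show "(r \<oplus>\<^bsub>R\<^esub> s) \<odot>\<^bsub>free_module R A\<^esub> x =
        r \<odot>\<^bsub>free_module R A\<^esub> x \<oplus>\<^bsub>free_module R A\<^esub> s \<odot>\<^bsub>free_module R A\<^esub> x"
      "(r \<otimes>\<^bsub>R\<^esub> s) \<odot>\<^bsub>free_module R A\<^esub> x = r \<odot>\<^bsub>free_module R A\<^esub> (s \<odot>\<^bsub>free_module R A\<^esub> x)"
      by (auto simp: PiE_iff intro!: restrict_ext l_distr m_assoc)
  next
    fix r x y
    assume "r \<in> carrier R" "x \<in> carrier (free_module R A)" "y \<in> carrier (free_module R A)"
    then show "r \<odot>\<^bsub>free_module R A\<^esub> (x \<oplus>\<^bsub>free_module R A\<^esub> y) =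
        r \<odot>\<^bsub>free_module R A\<^esub> x \<oplus>\<^bsub>free_module R A\<^esub> r \<odot>\<^bsub>free_module R A\<^esub> y"
      by (auto simp: PiE_iff intro!: restrict_ext r_distr)
  qed (auto simp: PiE_iff)
qed

text \<open>The identity is the sum of coordinate functionals times unit vectors. The induction adds
  one coordinate at a time, the map for \<open>B\<close> being truncation to the coordinates in
  \<open>B\<close>.\<close>

lemma free_module_finite_rank_id:
  assumes R: "cring R" and A: "finite A"
  shows "finite_rank R (free_module R A) (free_module R A) (\<lambda>x. x)"
proof -
  interpret cring R by fact
  let ?F = "free_module R A"
  have "finite_rank R ?F ?F (\<lambda>c. \<lambda>a\<in>A. if a \<in> B then c a else \<zero>\<^bsub>R\<^esub>)" if "finite B" "B \<subseteq> A" for B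
    using that
  proof (induction B rule: finite_induct)
    case empty
    show ?case by (rule finite_rank.zero) auto
  next
    case (insert b B)
    have b: "mod_hom R ?F (regular_module R) (\<lambda>c. c b)"
      using insert by (intro mod_homI) (auto simp: PiE_iff)
    show ?case
    proof (rule finite_rank.add[OF insert.IH b])
      show "(\<lambda>a\<in>A. if a = b then \<one>\<^bsub>R\<^esub> else \<zero>\<^bsub>R\<^esub>) \<in> carrier ?F" by simp
      fix c assume "c \<in> carrier ?F"
      then show "(\<lambda>a\<in>A. if a \<in> insert b B then c a else \<zero>\<^bsub>R\<^esub>) =
          (\<lambda>a\<in>A. if a \<in> B then c a else \<zero>\<^bsub>R\<^esub>) \<oplus>\<^bsub>?F\<^esub> c b \<odot>\<^bsub>?F\<^esub> (\<lambda>a\<in>A. if a = b then \<one>\<^bsub>R\<^esub> else \<zero>\<^bsub>R\<^esub>)"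
        using insert by (auto simp: PiE_iff intro!: restrict_ext)
    qed (use insert in auto)
  qed
  then have "finite_rank R ?F ?F (\<lambda>c. \<lambda>a\<in>A. if a \<in> A then c a else \<zero>\<^bsub>R\<^esub>)" using A by blast
  then show ?thesis 
  proof (rule finite_rank_cong)
    fix c assume "c \<in> carrier ?F"
    then show "c = (\<lambda>a\<in>A. if a \<in> A then c a else \<zero>\<^bsub>R\<^esub>)"
      by (intro ext) (auto dest: PiE_arb)
  qed
qed

text \<open>The vectors of the rank-one summands span a submodule containing the image. For the
  identity map this gives finite generation.\<close>

lemma finite_rank_lspan:
  assumes "finite_rank R M N t" and N: "module R N"
  obtains A where "finite A" "A \<subseteq> carrier N" "\<And>x. x \<in> carrier M \<Longrightarrow> t x \<in> lspan R N A"
  using assms(1)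
proof (induction arbitrary: thesis)
  case (zero t)
  show ?case by (rule zero(2)[of "{}"]) (auto simp: zero lspan.zero)
next
  case (add t \<phi> n t')
  interpret N: module R N by fact
  obtain A where A: "finite A" "A \<subseteq> carrier N" "\<And>x. x \<in> carrier M \<Longrightarrow> t x \<in> lspan R N A"
    using add.IH by blast
  have sub: "lspan R N A \<subseteq> carrier N" using N.submoduleE(1)[OF lspan_submodule[OF N A(2)]] .
  show ?case
  proof (rule add.prems[of "insert n A"])
    fix x assume x: "x \<in> carrier M"
    have "t' x = \<phi> x \<odot>\<^bsub>N\<^esub> n \<oplus>\<^bsub>N\<^esub> t x"
      using add.hyps(3,4) x mod_homD(1)[OF add.hyps(2) x] A(3)[OF x] sub by (auto simp: N.M.a_comm)
    then show "t' x \<in> lspan R N (insert n A)"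
      using A(3)[OF x] lspan_mono[of A "insert n A" R N] mod_homD(1)[OF add.hyps(2) x]
      by (auto intro!: lspan.add)
  qed (use A add.hyps in auto)
qed

lemma finite_rank_id_fg:
  assumes "finite_rank R M M (\<lambda>x. x)" "module R M" shows "fg_module R M"
  using finite_rank_lspan[OF assms] assms(2) unfolding fg_module_iff by (metis subsetI)

text \<open>One half of the dual basis lemma: \<open>h\<close> is \<open>h\<close> after the
  identity, hence of finite rank, and finite rank maps lift along surjections.\<close>

lemma finite_rank_id_projective:
  assumes "finite_rank R P P (\<lambda>x. x)" and P: "module R P"
  shows "projective_module R P"
  unfolding projective_module_def
proof (intro conjI allI ballI impI P)
  fix A B :: "'a small_module" and g h
  assume g: "g \<in> module_Hom R A B" and h: "h \<in> module_Hom R P B"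
    and AB: "module R A \<and> module R B \<and> g ` carrier A = carrier B"
  have gm: "mod_hom R A B g" and hm: "mod_hom R P B h" using g h by (auto simp: module_Hom_iff)
  have A: "module R A" and B: "module R B" using AB by auto
  have surj: "\<exists>x \<in> carrier A. g x = y" if "y \<in> carrier B" for y using AB that by (metis imageE)
  obtain k where k: "finite_rank R P A k" "\<And>x. x \<in> carrier P \<Longrightarrow> g (k x) = h x"
    using finite_rank_lift[OF finite_rank_comp[OF assms(1) mod_hom_id hm P P B] gm surj P A B] by blast
  have "compose (carrier P) g (restrict k (carrier P)) = h"
    using k(2) h by (auto simp: fun_eq_iff compose_def module_Hom_iff extensional_def)
  then show "\<exists>k \<in> module_Hom R P A. compose (carrier P) g k = h"
    using restrict_in_module_Hom[OF finite_rank_mod_hom[OF k(1) P A] P] by blast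
qed

text \<open>The free module has one coordinate for each element of a finite generating set, and
  \<open>e\<close> sends coefficients to the linear combination.\<close>

lemma free_cover:
  fixes X :: "('a, 'm) module"
  assumes X: "fg_module R X"
  obtains F :: "'a small_module" and e where "module R F" "finite_rank R F F (\<lambda>x. x)"
    "mod_hom R F X e" "\<And>y. y \<in> carrier X \<Longrightarrow> \<exists>x \<in> carrier F. e x = y"
proof -
  interpret X: module R X using X by (rule fg_module_module)
  obtain A where A: "finite A" "A \<subseteq> carrier X"
    and gen: "\<And>x. x \<in> carrier X \<Longrightarrow> \<exists>c \<in> A \<rightarrow> carrier R. x = (\<Oplus>\<^bsub>X\<^esub>a\<in>A. c a \<odot>\<^bsub>X\<^esub> a)"
    using X unfolding fg_module_def by blast
  let ?F = "free_module R A" and ?e = "\<lambda>c. \<Oplus>\<^bsub>X\<^esub>a\<in>A. c a \<odot>\<^bsub>X\<^esub> a"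
  have F: "module R ?F" and Fid: "finite_rank R ?F ?F (\<lambda>x. x)"
    using free_module_module[OF X.R.is_cring] free_module_finite_rank_id[OF X.R.is_cring A(1)] by auto
  have in_X: "(\<lambda>a. c a \<odot>\<^bsub>X\<^esub> a) \<in> A \<rightarrow> carrier X" if "c \<in> A \<rightarrow>\<^sub>E carrier R" for c
    using that A(2) by (auto simp: PiE_mem)
  have e: "mod_hom R ?F X ?e"
  proof (rule mod_homI)
    fix c assume "c \<in> carrier ?F"
    then show "?e c \<in> carrier X" using in_X by (simp add: X.M.finsum_closed)
  next
    fix c d assume cd: "c \<in> carrier ?F" "d \<in> carrier ?F"
    have "?e (c \<oplus>\<^bsub>?F\<^esub> d) = (\<Oplus>\<^bsub>X\<^esub>a\<in>A. c a \<odot>\<^bsub>X\<^esub> a \<oplus>\<^bsub>X\<^esub> d a \<odot>\<^bsub>X\<^esub> a)"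
      using cd A(2) by (intro X.M.finsum_cong') (auto intro!: X.smult_l_distr X.M.a_closed X.smult_closed dest: PiE_mem)
    then show "?e (c \<oplus>\<^bsub>?F\<^esub> d) = ?e c \<oplus>\<^bsub>X\<^esub> ?e d"
      using cd in_X by (simp add: X.M.finsum_addf)
  next
    fix r c assume rc: "r \<in> carrier R" "c \<in> carrier ?F"
    have "?e (r \<odot>\<^bsub>?F\<^esub> c) = (\<Oplus>\<^bsub>X\<^esub>a\<in>A. r \<odot>\<^bsub>X\<^esub> (c a \<odot>\<^bsub>X\<^esub> a))"
      using rc A(2) by (intro X.M.finsum_cong') (auto intro!: X.smult_assoc1 X.smult_closed dest: PiE_mem)
    then show "?e (r \<odot>\<^bsub>?F\<^esub> c) = r \<odot>\<^bsub>X\<^esub> ?e c"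
      using rc in_X A(1) by (simp add: X.finsum_smult_ldistr)
  qed
  have e_surj: "\<exists>c \<in> carrier ?F. ?e c = x" if x: "x \<in> carrier X" for x
  proof -
    obtain c where c: "c \<in> A \<rightarrow> carrier R" "x = ?e c" using gen[OF x] by blast
    then have "?e (restrict c A) = x"
      using A(2) unfolding c(2) by (intro X.M.finsum_cong') auto
    then show ?thesis using c(1) by (intro bexI[of _ "restrict c A"]) auto
  qed
  \<comment> \<open>The elements of the free module are functions on generators of \<open>X\<close>,
    so their type depends on \<open>'m\<close>; resolutions require small modules, hence the passage
    to a small copy.\<close>
  obtain F' :: "'a small_module" and h
    where F': "fg_module R F'" and h: "h \<in> module_Hom R ?F F'" "bij_betw h (carrier ?F) (carrier F')"
    using fg_module_small_copy[OF finite_rank_id_fg[OF Fid F]] unfolding module_iso_def by blast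
  have F'M: "module R F'" using F' by (rule fg_module_module)
  let ?i = "inv_into (carrier ?F) h"
  have hm: "mod_hom R ?F F' h" using h(1) by (simp add: module_Hom_iff)
  have im: "mod_hom R F' ?F ?i" by (rule mod_hom_inv[OF hm h(2) F])
  have ih: "?i (h x) = x" if "x \<in> carrier ?F" for x
    by (rule bij_betw_inv_into_left[OF h(2) that])
  have hi: "h (?i y) = y" if "y \<in> carrier F'" for y
    by (rule bij_betw_inv_into_right[OF h(2) that])
  show thesis
  proof (rule that[OF F'M _ mod_hom_comp[OF im e]])
    show "finite_rank R F' F' (\<lambda>x. x)"
      by (rule finite_rank_cong[OF finite_rank_comp[OF Fid im hm F F F'M]]) (rule hi[symmetric])
    fix y assume "y \<in> carrier X"
    then obtain c where "c \<in> carrier ?F" "?e c = y" using e_surj by blast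
    then show "\<exists>x \<in> carrier F'. ?e (?i x) = y"
      using ih mod_homD(1)[OF hm] by (intro bexI[of _ "h c"]) auto
  qed
qed

text \<open>The other half of the dual basis lemma: a free cover splits, and the identity of
  \<open>P\<close> factors through the identity of the free module.\<close>

lemma projective_finite_rank_id:
  fixes P :: "'a small_module"
  assumes "fg_module R P" "projective_module R P"
  shows "finite_rank R P P (\<lambda>x. x)"
proof -
  have P: "module R P" using assms(1) by (rule fg_module_module)
  obtain F :: "'a small_module" and e where F: "module R F" "finite_rank R F F (\<lambda>x. x)"
    "mod_hom R F P e" "\<And>y. y \<in> carrier P \<Longrightarrow> \<exists>x \<in> carrier F. e x = y"
    using free_cover[OF assms(1)] by blast
  obtain k where k: "mod_hom R P F k" "\<And>x. x \<in> carrier P \<Longrightarrow> e (k x) = x"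
    using projective_lift[OF assms(2) F(1) P F(3,4) mod_hom_id] by blast
  show ?thesis
    by (rule finite_rank_cong[OF finite_rank_comp[OF F(2) k(1) F(3) F(1) F(1) P]]) (simp add: k(2))
qed

lemma projective_cover_exists:
  fixes X :: "('a, 'm) module"
  assumes X: "fg_module R X"
  obtains F :: "'a small_module" and e where "fg_module R F" "projective_module R F"
    "e \<in> module_Hom R F X" "e ` carrier F = carrier X"
proof -
  obtain F :: "'a small_module" and e where F: "module R F" "finite_rank R F F (\<lambda>x. x)"
    "mod_hom R F X e" "\<And>y. y \<in> carrier X \<Longrightarrow> \<exists>x \<in> carrier F. e x = y"
    using free_cover[OF X] by blast
  show thesis
  proof (rule that)
    show "restrict e (carrier F) ` carrier F = carrier X" using F(4) mod_homD(1)[OF F(3)] by force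
  qed (use restrict_in_module_Hom[OF F(3,1)] finite_rank_id_fg[OF F(2,1)]
        finite_rank_id_projective[OF F(2,1)] in auto)
qed

lemma projective_resolution_exists:
  fixes R :: "('a, 'c) ring_scheme" and M :: "('a, 'm) module"
  assumes R: "noetherian_ring R" and M: "fg_module R M"
  shows "\<exists>P d e. projective_resolution R M P d e"
proof -
  have MM: "module R M" using M by (rule fg_module_module)
  obtain P0 :: "'a small_module" and e where P0: "fg_module R P0" "projective_module R P0"
    and e: "e \<in> module_Hom R P0 M" "e ` carrier P0 = carrier M"
    using projective_cover_exists[OF M] by blast
  have ker: "submodule (a_kernel P Q h) R P" if "h \<in> module_Hom R P Q" "module R P" "module R Q"
    for P :: "'a small_module" and Q :: "('a, 'q) module" and h
    using submodule_kernel[of R P Q h] that by (simp add: module_Hom_iff a_kernel_def kernel_def)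
  \<comment> \<open>State of the recursion: the current projective, the submodule \<open>K\<close>
    of it that the next projective has to cover, and the differential leaving the current
    projective. State 0 holds a placeholder for that differential.\<close>
  let ?good = "\<lambda>n (P :: 'a small_module, K, d :: (nat \<Rightarrow> 'a) set \<Rightarrow> (nat \<Rightarrow> 'a) set).
      fg_module R P \<and> projective_module R P \<and> submodule K R P \<and>
      (n = (0::nat) \<longrightarrow> P = P0 \<and> K = a_kernel P0 M e)"
  let ?next = "\<lambda>n (P :: 'a small_module, K, d :: (nat \<Rightarrow> 'a) set \<Rightarrow> (nat \<Rightarrow> 'a) set) (P', K', d').
      d' \<in> module_Hom R P' P \<and> d' ` carrier P' = K \<and> K' = a_kernel P' P d'"
  have "\<exists>f. \<forall>n. ?good n (f n) \<and> ?next n (f n) (f (Suc n))"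
  proof (rule dependent_nat_choice)
    show "\<exists>s. ?good 0 s"
      using P0 ker[OF e(1) fg_module_module[OF P0(1)] MM]
      by (intro exI[of _ "(P0, a_kernel P0 M e, undefined)"]) simp
    fix s n assume "?good n s"
    then obtain P K d where s: "s = (P, K, d)" "fg_module R P" "projective_module R P" "submodule K R P"
      by (cases s) auto
    have P: "module R P" using s(2) by (rule fg_module_module)
    obtain P' :: "'a small_module" and d' where P': "fg_module R P'" "projective_module R P'"
      "d' \<in> module_Hom R P' (P\<lparr>carrier := K\<rparr>)" "d' ` carrier P' = carrier (P\<lparr>carrier := K\<rparr>)"
      by (rule projective_cover_exists[OF fg_submodule[OF R s(2,4)]]) blast
    have d'm: "mod_hom R P' (P\<lparr>carrier := K\<rparr>) d'" using P'(3) by (simp add: module_Hom_iff)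
    have d': "d' \<in> module_Hom R P' P"
      using P'(3) mod_hom_comp[OF d'm mod_hom_submodule_incl[OF s(4) P]] by (simp add: module_Hom_iff)
    have "?good (Suc n) (P', a_kernel P' P d', d')" "?next n s (P', a_kernel P' P d', d')"
      using P' d' ker[OF d' fg_module_module[OF P'(1)] P] by (simp_all add: s(1))
    then show "\<exists>s'. ?good (Suc n) s' \<and> ?next n s s'" 
      by (intro exI[of _ "(P', a_kernel P' P d', d')"] conjI)
  qed
  then obtain f where f': "\<forall>n. ?good n (f n) \<and> ?next n (f n) (f (Suc n))" by (rule exE)
  have f: "?good n (f n)" "?next n (f n) (f (Suc n))" for n
    by (rule conjunct1[OF spec[OF f', of n]]) (rule conjunct2[OF spec[OF f', of n]])
  \<comment> \<open>\<open>d n\<close> is read from state \<open>Suc n\<close>, because it leaves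
    \<open>P (Suc n)\<close>.\<close>
  define P K d where "P n = fst (f n)" and "K n = fst (snd (f n))" and "d n = snd (snd (f (Suc n)))" for n
  have good: "fg_module R (P n)" "projective_module R (P n)" for n
    using f(1)[of n] by (auto simp: P_def split: prod.splits)
  have start: "P 0 = P0" "K 0 = a_kernel P0 M e" using f(1)[of 0] by (auto simp: P_def K_def split: prod.splits)
  have step: "d n \<in> module_Hom R (P (Suc n)) (P n)" "d n ` carrier (P (Suc n)) = K n"
      "K (Suc n) = a_kernel (P (Suc n)) (P n) (d n)" for n
    using f(2)[of n] by (auto simp: P_def K_def d_def split: prod.splits)
  show ?thesis
    using good start step e by (intro exI[of _ P] exI[of _ d] exI[of _ e]) (simp add: projective_resolution_def)
qed

section \<open>Ext in terms of cocycles\<close>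

lemma quotient_module_simps [simp]:
  "carrier (quotient_module M H) = a_rcosets\<^bsub>M\<^esub> H"
  "\<zero>\<^bsub>quotient_module M H\<^esub> = H"
  "X \<oplus>\<^bsub>quotient_module M H\<^esub> Y = X <+>\<^bsub>M\<^esub> Y"
  "r \<odot>\<^bsub>quotient_module M H\<^esub> X = (\<Union>x\<in>X. H +>\<^bsub>M\<^esub> (r \<odot>\<^bsub>M\<^esub> x))"
  by (simp_all add: quotient_module_def)

lemma a_coset_eq_iff:
  assumes "module R M" "submodule H R M" "x \<in> carrier M"
  shows "H +>\<^bsub>M\<^esub> x = H \<longleftrightarrow> x \<in> H"
proof -
  interpret M: module R M by fact
  have "subgroup H (add_monoid M)" using assms(2) by (simp add: submodule_def)
  then show ?thesis using M.M.a_coset_join1 M.M.a_coset_join2 assms(3) by blast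
qed

lemma in_a_coset_self:
  assumes "module R M" "submodule H R M" "x \<in> carrier M"
  shows "x \<in> H +>\<^bsub>M\<^esub> x"
proof -
  interpret M: module R M by fact
  show ?thesis
    using M.M.a_rcosI[OF submodule_zero[OF assms(2)] M.submoduleE(1)[OF assms(2)] assms(3)] assms(3)
    by simp
qed

lemma zero_module_quotient_iff:
  assumes M: "module R M" and H: "submodule H R M"
  shows "zero_module (quotient_module M H) \<longleftrightarrow> carrier M \<subseteq> H"
proof -
  interpret M: module R M by fact
  have "a_rcosets\<^bsub>M\<^esub> H = {H} \<longleftrightarrow> (\<forall>x \<in> carrier M. H +>\<^bsub>M\<^esub> x = H)"
    unfolding A_RCOSETS_def' using M.M.zero_closed by blast
  then show ?thesis
    using a_coset_eq_iff[OF assms] by (auto simp: zero_module_def)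
qed

lemma annihilator_quotient_iff:
  assumes M: "module R M" and H: "submodule H R M"
  shows "r \<in> annihilator R (quotient_module M H) \<longleftrightarrow>
    r \<in> carrier R \<and> (\<forall>x \<in> carrier M. r \<odot>\<^bsub>M\<^esub> x \<in> H)"
proof -
  interpret M: module R M by fact
  \<comment> \<open>Scalar multiplication on cosets is a union over representatives. Every member
    equals \<open>H\<close>, and since a coset is non-empty the union is \<open>H\<close> and not
    empty.\<close>
  have "(\<Union>y\<in>H +>\<^bsub>M\<^esub> x. H +>\<^bsub>M\<^esub> (r \<odot>\<^bsub>M\<^esub> y)) = H"
    if r: "r \<in> carrier R" "\<forall>y \<in> carrier M. r \<odot>\<^bsub>M\<^esub> y \<in> H" and x: "x \<in> carrier M" for x
  proof -
    have "H +>\<^bsub>M\<^esub> (r \<odot>\<^bsub>M\<^esub> y) = H" if "y \<in> H +>\<^bsub>M\<^esub> x" for y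
    proof -
      have "y \<in> carrier M"
        using that M.M.a_r_coset_subset_G[OF M.submoduleE(1)[OF H] x] by auto
      then show ?thesis using a_coset_eq_iff[OF M H] r by simp
    qed
    then show ?thesis using in_a_coset_self[OF M H x] by blast
  qed
  moreover have "r \<odot>\<^bsub>M\<^esub> x \<in> H"
    if "r \<in> carrier R" "x \<in> carrier M" "(\<Union>y\<in>H +>\<^bsub>M\<^esub> x. H +>\<^bsub>M\<^esub> (r \<odot>\<^bsub>M\<^esub> y)) = H" for x
    using that in_a_coset_self[OF M H, of x] in_a_coset_self[OF M H, of "r \<odot>\<^bsub>M\<^esub> x"] by blast
  ultimately show ?thesis
    by (auto simp: annihilator_def A_RCOSETS_def')
qed

lemma hom_module_simps [simp]:
  "carrier (hom_module R M N) = module_Hom R M N"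
  "\<zero>\<^bsub>hom_module R M N\<^esub> = (\<lambda>x\<in>carrier M. \<zero>\<^bsub>N\<^esub>)"
  "g \<oplus>\<^bsub>hom_module R M N\<^esub> h = (\<lambda>x\<in>carrier M. g x \<oplus>\<^bsub>N\<^esub> h x)"
  "r \<odot>\<^bsub>hom_module R M N\<^esub> h = (\<lambda>x\<in>carrier M. r \<odot>\<^bsub>N\<^esub> h x)"
  by (simp_all add: hom_module_def)

lemma hom_module_module:
  assumes M: "module R M" and N: "module R N"
  shows "module R (hom_module R M N)"
proof -
  interpret M: module R M by fact
  interpret N: module R N by fact
  let ?H = "hom_module R M N"
  have homD: "mod_hom R M N h" if "h \<in> carrier ?H" for h
    using that by (simp add: module_Hom_iff)
  have cl: "h x \<in> carrier N" if "h \<in> carrier ?H" "x \<in> carrier M" for h x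
    using mod_homD(1)[OF homD] that by blast
  have id: "(\<lambda>x\<in>carrier M. g x) = h"
    if "h \<in> carrier ?H" "\<And>x. x \<in> carrier M \<Longrightarrow> g x = h x" for g h
    using that by (intro ext) (auto simp: module_Hom_iff extensional_def)
  have "abelian_group ?H"
  proof (rule abelian_groupI)
    fix g assume g: "g \<in> carrier ?H"
    have "restrict (\<lambda>x. \<zero>\<^bsub>N\<^esub> \<ominus>\<^bsub>N\<^esub> g x) (carrier M) \<in> carrier ?H"
      using restrict_in_module_Hom[OF mod_hom_diff[OF mod_hom_const_zero[OF N] homD[OF g] N] M] by simp
    moreover have "restrict (\<lambda>x. \<zero>\<^bsub>N\<^esub> \<ominus>\<^bsub>N\<^esub> g x) (carrier M) \<oplus>\<^bsub>?H\<^esub> g = \<zero>\<^bsub>?H\<^esub>"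
      using cl[OF g] by (auto simp: a_minus_def N.M.l_neg intro!: restrict_ext)
    ultimately show "\<exists>h \<in> carrier ?H. h \<oplus>\<^bsub>?H\<^esub> g = \<zero>\<^bsub>?H\<^esub>" by blast
    show "\<zero>\<^bsub>?H\<^esub> \<oplus>\<^bsub>?H\<^esub> g = g" using cl[OF g] by (auto intro!: id[OF g])
  next
    fix g h assume gh: "g \<in> carrier ?H" "h \<in> carrier ?H"
    show "g \<oplus>\<^bsub>?H\<^esub> h \<in> carrier ?H"
      using restrict_in_module_Hom[OF mod_hom_add[OF homD[OF gh(1)] homD[OF gh(2)] N] M] by simp
    show "g \<oplus>\<^bsub>?H\<^esub> h = h \<oplus>\<^bsub>?H\<^esub> g"
      using cl[OF gh(1)] cl[OF gh(2)] by (auto intro!: restrict_ext N.M.a_comm)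
    fix k assume k: "k \<in> carrier ?H"
    show "g \<oplus>\<^bsub>?H\<^esub> h \<oplus>\<^bsub>?H\<^esub> k = g \<oplus>\<^bsub>?H\<^esub> (h \<oplus>\<^bsub>?H\<^esub> k)"
      using cl[OF gh(1)] cl[OF gh(2)] cl[OF k] by (auto intro!: restrict_ext N.M.a_assoc)
  qed (use restrict_in_module_Hom[OF mod_hom_const_zero[OF N] M] in simp)
  then show ?thesis
  proof (rule moduleI[OF M.R.is_cring])
    fix r h assume rh: "r \<in> carrier R" "h \<in> carrier ?H"
    show "r \<odot>\<^bsub>?H\<^esub> h \<in> carrier ?H"
      using restrict_in_module_Hom[OF mod_hom_smult[OF homD[OF rh(2)] N rh(1)] M] by simp
    fix s assume s: "s \<in> carrier R"
    show "(r \<oplus>\<^bsub>R\<^esub> s) \<odot>\<^bsub>?H\<^esub> h = r \<odot>\<^bsub>?H\<^esub> h \<oplus>\<^bsub>?H\<^esub> s \<odot>\<^bsub>?H\<^esub> h"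
      "(r \<otimes>\<^bsub>R\<^esub> s) \<odot>\<^bsub>?H\<^esub> h = r \<odot>\<^bsub>?H\<^esub> (s \<odot>\<^bsub>?H\<^esub> h)"
      using cl[OF rh(2)] rh(1) s by (auto intro!: restrict_ext N.smult_l_distr N.smult_assoc1)
  next
    fix r g h assume rgh: "r \<in> carrier R" "g \<in> carrier ?H" "h \<in> carrier ?H"
    show "r \<odot>\<^bsub>?H\<^esub> (g \<oplus>\<^bsub>?H\<^esub> h) = r \<odot>\<^bsub>?H\<^esub> g \<oplus>\<^bsub>?H\<^esub> r \<odot>\<^bsub>?H\<^esub> h"
      using cl[OF rgh(2)] cl[OF rgh(3)] rgh(1) by (auto intro!: restrict_ext N.smult_r_distr)
  next
    fix h assume h: "h \<in> carrier ?H"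
    show "\<one>\<^bsub>R\<^esub> \<odot>\<^bsub>?H\<^esub> h = h" using cl[OF h] by (auto intro!: id[OF h])
  qed
qed

lemma compose_in_module_Hom:
  assumes "h \<in> module_Hom R P N" "mod_hom R Q P d" "module R Q"
  shows "compose (carrier Q) h d \<in> module_Hom R Q N"
  unfolding compose_def
  using assms by (intro restrict_in_module_Hom mod_hom_comp[of R Q P d N h]) (simp_all add: module_Hom_iff)

lemma mod_hom_precompose:
  assumes d: "mod_hom R Q P d" and P: "module R P" and Q: "module R Q" and N: "module R N"
  shows "mod_hom R (hom_module R P N) (hom_module R Q N) (\<lambda>h. compose (carrier Q) h d)"
  using mod_homD(1)[OF d]
  by (intro mod_homI)
    (auto simp: compose_in_module_Hom[OF _ d Q], auto simp: compose_def intro!: restrict_ext)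

text \<open>The counterpart of \<open>ext_cocycles\<close> for bare functions; restricting to the
  carrier translates one into the other.\<close>

definition cocycle ::
    "('a, 'c) ring_scheme \<Rightarrow> (nat \<Rightarrow> ('a, 'p) module) \<Rightarrow> (nat \<Rightarrow> 'p \<Rightarrow> 'p) \<Rightarrow> ('a, 'n) module \<Rightarrow>
     nat \<Rightarrow> ('p \<Rightarrow> 'n) \<Rightarrow> bool" where
  "cocycle R P d N n z \<longleftrightarrow>
     mod_hom R (P n) N z \<and> (\<forall>x \<in> carrier (P (Suc n)). z (d n x) = \<zero>\<^bsub>N\<^esub>)"

text \<open>The degree of the coboundary \<open>z\<close> is \<open>Suc n\<close>.\<close>

definition coboundary ::
    "('a, 'c) ring_scheme \<Rightarrow> (nat \<Rightarrow> ('a, 'p) module) \<Rightarrow> (nat \<Rightarrow> 'p \<Rightarrow> 'p) \<Rightarrow> ('a, 'n) module \<Rightarrow>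
     nat \<Rightarrow> ('p \<Rightarrow> 'n) \<Rightarrow> bool" where
  "coboundary R P d N n z \<longleftrightarrow>
     (\<exists>y. mod_hom R (P n) N y \<and> (\<forall>x \<in> carrier (P (Suc n)). z x = y (d n x)))"

lemma restrict_submoduleI:
  assumes "module R M" "submodule K R M" "submodule H R M" "H \<subseteq> K"
  shows "submodule H R (M\<lparr>carrier := K\<rparr>)"
  using module.module_incl_imp_submodule[OF submodule_module[OF assms(2,1)], of H]
    submodule_module[OF assms(3,1)] assms(4) by simp

locale module_complex =
  fixes R :: "('a, 'c) ring_scheme" and P :: "nat \<Rightarrow> ('a, 'p) module" and d :: "nat \<Rightarrow> 'p \<Rightarrow> 'p"
  assumes modules: "\<And>n. module R (P n)"
    and d_hom: "\<And>n. mod_hom R (P (Suc n)) (P n) (d n)"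
    and d_d: "\<And>n x. x \<in> carrier (P (Suc (Suc n))) \<Longrightarrow> d n (d (Suc n) x) = \<zero>\<^bsub>P n\<^esub>"
begin

context
  fixes N :: "('a, 'n) module"
  assumes N: "module R N"
begin

lemma ext_cocycles_iff:
  "z \<in> ext_cocycles R P d N n \<longleftrightarrow> z \<in> extensional (carrier (P n)) \<and> cocycle R P d N n z"
  by (auto simp: ext_cocycles_def in_a_kernel_iff cocycle_def module_Hom_iff compose_def restrict_def
      fun_eq_iff)

lemma restrict_in_ext_cocycles:
  assumes "cocycle R P d N n z" shows "restrict z (carrier (P n)) \<in> ext_cocycles R P d N n"
proof -
  have "mod_hom R (P n) N (restrict z (carrier (P n)))"
    by (rule mod_hom_cong[OF _ modules, where h = z]) (use assms in \<open>auto simp: cocycle_def\<close>)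
  then show ?thesis
    using assms mod_homD(1)[OF d_hom] by (simp add: ext_cocycles_iff cocycle_def)
qed

lemma ext_coboundaries_iff:
  "z \<in> ext_coboundaries R P d N (Suc n) \<longleftrightarrow>
     z \<in> extensional (carrier (P (Suc n))) \<and> coboundary R P d N n z"
proof
  assume "z \<in> ext_coboundaries R P d N (Suc n)"
  then show "z \<in> extensional (carrier (P (Suc n))) \<and> coboundary R P d N n z"
    by (auto simp: ext_coboundaries_def coboundary_def module_Hom_iff compose_def)
next
  assume "z \<in> extensional (carrier (P (Suc n))) \<and> coboundary R P d N n z"
  then obtain y where z: "z \<in> extensional (carrier (P (Suc n)))" "mod_hom R (P n) N y"
    "\<And>x. x \<in> carrier (P (Suc n)) \<Longrightarrow> z x = y (d n x)" by (auto simp: coboundary_def)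
  let ?y = "restrict y (carrier (P n))"
  have "?y \<in> module_Hom R (P n) N" by (rule restrict_in_module_Hom[OF z(2) modules])
  moreover have "z = compose (carrier (P (Suc n))) ?y (d n)"
    using z mod_homD(1)[OF d_hom] by (intro ext) (auto simp: compose_def extensional_def)
  ultimately show "z \<in> ext_coboundaries R P d N (Suc n)" by (simp add: ext_coboundaries_def)
qed

lemma ext_cocycles_submodule: "submodule (ext_cocycles R P d N n) R (hom_module R (P n) N)"
  using submodule_kernel[OF mod_hom_precompose[OF d_hom modules modules N] hom_module_module
      hom_module_module, OF modules N modules N, of n]
  by (simp add: ext_cocycles_def a_kernel_def kernel_def)

lemma ext_coboundaries_submodule:
  "submodule (ext_coboundaries R P d N n) R
     ((hom_module R (P n) N)\<lparr>carrier := ext_cocycles R P d N n\<rparr>)"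
proof (rule restrict_submoduleI[OF hom_module_module[OF modules N] ext_cocycles_submodule])
  interpret N: module R N by (rule N)
  note H = hom_module_module[OF modules N]
  show "submodule (ext_coboundaries R P d N n) R (hom_module R (P n) N)"
  proof (cases n)
    case 0
    \<comment> \<open>In degree 0 the set of coboundaries is a singleton; it is seen as the image of
      a constant zero map, so that \<open>submodule_image\<close> covers this case too.\<close>
    have "submodule ((\<lambda>h. \<zero>\<^bsub>hom_module R (P 0) N\<^esub>) ` carrier (hom_module R (P 0) N)) R (hom_module R (P 0) N)"
      by (rule submodule_image[OF mod_hom_const_zero[OF H] H H])
    moreover have "carrier (hom_module R (P 0) N) \<noteq> {}"
      using restrict_in_module_Hom[OF mod_hom_const_zero[OF N] modules] by auto
    ultimately show ?thesis using 0 by (simp add: ext_coboundaries_def image_constant_conv)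
  next
    case (Suc m)
    show ?thesis
      using submodule_image[OF mod_hom_precompose[OF d_hom modules modules N] H H] Suc
      by (simp add: ext_coboundaries_def)
  qed
  show "ext_coboundaries R P d N n \<subseteq> ext_cocycles R P d N n"
  proof (cases n)
    case 0
    have "\<zero>\<^bsub>hom_module R (P 0) N\<^esub> \<in> ext_cocycles R P d N 0"
      by (rule submodule_zero[OF ext_cocycles_submodule])
    then show ?thesis using 0 by (simp add: ext_coboundaries_def)
  next
    case (Suc m)
    have "cocycle R P d N (Suc m) z" if z: "z \<in> extensional (carrier (P (Suc m)))" "coboundary R P d N m z" for z
    proof -
      obtain y where y: "mod_hom R (P m) N y" "\<And>x. x \<in> carrier (P (Suc m)) \<Longrightarrow> z x = y (d m x)"
        using z by (auto simp: coboundary_def)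
      have "mod_hom R (P (Suc m)) N z"
        by (rule mod_hom_cong[OF mod_hom_comp[OF d_hom y(1)] modules y(2)])
      then show ?thesis
        using y mod_homD(1)[OF d_hom] d_d mod_hom_zero[OF y(1) modules N] by (simp add: cocycle_def)
    qed
    then show ?thesis using Suc ext_coboundaries_iff ext_cocycles_iff by blast
  qed
qed

lemma ext_quotient_module:
  "module R ((hom_module R (P n) N)\<lparr>carrier := ext_cocycles R P d N n\<rparr>)"
  by (rule submodule_module[OF ext_cocycles_submodule hom_module_module[OF modules N]])

lemma zero_module_ext_quotient_iff:
  "zero_module (quotient_module ((hom_module R (P (Suc n)) N)\<lparr>carrier := ext_cocycles R P d N (Suc n)\<rparr>)
      (ext_coboundaries R P d N (Suc n))) \<longleftrightarrow>
    (\<forall>z. cocycle R P d N (Suc n) z \<longrightarrow> coboundary R P d N n z)"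
proof -
  have "coboundary R P d N n z"
    if sub: "ext_cocycles R P d N (Suc n) \<subseteq> ext_coboundaries R P d N (Suc n)" and z: "cocycle R P d N (Suc n) z" for z
  proof -
    have "restrict z (carrier (P (Suc n))) \<in> ext_cocycles R P d N (Suc n)"
      by (rule restrict_in_ext_cocycles[OF z])
    then have "restrict z (carrier (P (Suc n))) \<in> ext_coboundaries R P d N (Suc n)" using sub by blast
    then show ?thesis by (simp add: ext_coboundaries_iff coboundary_def)
  qed
  then show ?thesis
    unfolding zero_module_quotient_iff[OF ext_quotient_module ext_coboundaries_submodule]
    by (auto simp: ext_cocycles_iff ext_coboundaries_iff)
qed

lemma annihilator_ext_quotient_iff:
  "r \<in> annihilator R (quotient_module ((hom_module R (P (Suc n)) N)\<lparr>carrier := ext_cocycles R P d N (Suc n)\<rparr>)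
      (ext_coboundaries R P d N (Suc n))) \<longleftrightarrow>
    r \<in> carrier R \<and> (\<forall>z. cocycle R P d N (Suc n) z \<longrightarrow> coboundary R P d N n (\<lambda>x. r \<odot>\<^bsub>N\<^esub> z x))"
proof -
  have "coboundary R P d N n (\<lambda>x. r \<odot>\<^bsub>N\<^esub> z x)"
    if sub: "\<forall>z \<in> ext_cocycles R P d N (Suc n).
        (\<lambda>x\<in>carrier (P (Suc n)). r \<odot>\<^bsub>N\<^esub> z x) \<in> ext_coboundaries R P d N (Suc n)"
      and z: "cocycle R P d N (Suc n) z" for z
  proof -
    have "restrict z (carrier (P (Suc n))) \<in> ext_cocycles R P d N (Suc n)"
      by (rule restrict_in_ext_cocycles[OF z])
    then have "(\<lambda>x\<in>carrier (P (Suc n)). r \<odot>\<^bsub>N\<^esub> restrict z (carrier (P (Suc n))) x)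
        \<in> ext_coboundaries R P d N (Suc n)"
      using sub by blast
    then show ?thesis by (simp add: ext_coboundaries_iff coboundary_def)
  qed
  then show ?thesis
    unfolding annihilator_quotient_iff[OF ext_quotient_module ext_coboundaries_submodule]
    by (auto simp: ext_cocycles_iff ext_coboundaries_iff coboundary_def)
qed

text \<open>In degree 0 the zero map is the only coboundary, so annihilation of a class means that
  \<open>r\<close> kills the values of the cocycle. This serves elements of the cohomology
  annihilator of level 0.\<close>

lemma annihilator_ext_quotient_zero:
  assumes "r \<in> annihilator R (quotient_module ((hom_module R (P 0) N)\<lparr>carrier := ext_cocycles R P d N 0\<rparr>)
      (ext_coboundaries R P d N 0))"
    and z: "cocycle R P d N 0 z" and x: "x \<in> carrier (P 0)"
  shows "r \<odot>\<^bsub>N\<^esub> z x = \<zero>\<^bsub>N\<^esub>"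
proof -
    have "restrict z (carrier (P 0)) \<in> ext_cocycles R P d N 0"
      by (rule restrict_in_ext_cocycles[OF z])
  then have "(\<lambda>x\<in>carrier (P 0). r \<odot>\<^bsub>N\<^esub> restrict z (carrier (P 0)) x) = (\<lambda>x\<in>carrier (P 0). \<zero>\<^bsub>N\<^esub>)"
    using assms(1) unfolding annihilator_quotient_iff[OF ext_quotient_module ext_coboundaries_submodule]
    by (auto simp: ext_coboundaries_def)
  from fun_cong[OF this, of x] show ?thesis using x by simp
qed

end

end

text \<open>Exactness starts in degree 1: the cokernel of \<open>d 0\<close> is the module being
  resolved.\<close>

locale acyclic_complex = module_complex +
  assumes exact: "\<And>n x. x \<in> carrier (P (Suc n)) \<Longrightarrow> d n x = \<zero>\<^bsub>P n\<^esub> \<Longrightarrow>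
      \<exists>y \<in> carrier (P (Suc (Suc n))). x = d (Suc n) y"

text \<open>Names the Hilbert choice hidden in \<open>Ext\<close>, so that all statements about
  \<open>Ext\<close> of a module \<open>M\<close> refer to the same complex.\<close>

definition chosen_resolution ::
    "('a, 'c) ring_scheme \<Rightarrow> ('a, 'm) module \<Rightarrow>
     (nat \<Rightarrow> 'a small_module) \<times> (nat \<Rightarrow> (nat \<Rightarrow> 'a) set \<Rightarrow> (nat \<Rightarrow> 'a) set) \<times> ((nat \<Rightarrow> 'a) set \<Rightarrow> 'm)" where
  "chosen_resolution R M = (SOME (P, d, e). projective_resolution R M P d e)"

abbreviation "res_module R M \<equiv> fst (chosen_resolution R M)"
abbreviation "res_diff R M \<equiv> fst (snd (chosen_resolution R M))"
abbreviation "res_aug R M \<equiv> snd (snd (chosen_resolution R M))"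

lemma Ext_eq:
  "Ext R n M N = quotient_module
     ((hom_module R (res_module R M n) N)\<lparr>carrier := ext_cocycles R (res_module R M) (res_diff R M) N n\<rparr>)
     (ext_coboundaries R (res_module R M) (res_diff R M) N n)"
  by (simp add: Ext_def chosen_resolution_def Let_def split_def)

lemma chosen_resolution:
  assumes "noetherian_ring R" "fg_module R M"
  shows "projective_resolution R M (res_module R M) (res_diff R M) (res_aug R M)"
proof -
  have "\<exists>t. case t of (P, d, e) \<Rightarrow> projective_resolution R M P d e"
    using projective_resolution_exists[OF assms] by auto
  from someI_ex[OF this] show ?thesis by (simp add: chosen_resolution_def split_def)
qed

locale noetherian_fg =
  fixes R :: "('a, 'c) ring_scheme" and M :: "('a, 'm) module"
  assumes noetherian: "noetherian_ring R" and fg: "fg_module R M"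
begin

abbreviation "P \<equiv> res_module R M"
abbreviation "d \<equiv> res_diff R M"
abbreviation "e \<equiv> res_aug R M"

lemma M_module: "module R M"
  using fg by (rule fg_module_module)

lemma resolution: "projective_resolution R M P d e"
  by (rule chosen_resolution[OF noetherian fg])

lemma P_fg: "fg_module R (P n)" and P_projective: "projective_module R (P n)"
  and e_hom: "mod_hom R (P 0) M e" and e_image: "e ` carrier (P 0) = carrier M"
  and e_kernel: "d 0 ` carrier (P (Suc 0)) = a_kernel (P 0) M e"
  using resolution by (auto simp: projective_resolution_def module_Hom_iff)

lemma P_id: "finite_rank R (P n) (P n) (\<lambda>x. x)"
  by (rule projective_finite_rank_id[OF P_fg P_projective])

sublocale acyclic_complex R P d
proof (intro acyclic_complex.intro module_complex.intro acyclic_complex_axioms.intro)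
  have im: "d (Suc n) ` carrier (P (Suc (Suc n))) = a_kernel (P (Suc n)) (P n) (d n)" for n
    using resolution by (simp add: projective_resolution_def)
  show "module R (P n)" for n by (rule fg_module_module[OF P_fg])
  show "mod_hom R (P (Suc n)) (P n) (d n)" for n
    using resolution by (simp add: projective_resolution_def module_Hom_iff)
  show "d n (d (Suc n) x) = \<zero>\<^bsub>P n\<^esub>" if "x \<in> carrier (P (Suc (Suc n)))" for n x
    using in_a_kernel_iff[of "d (Suc n) x" "P (Suc n)" "P n" "d n", folded im] that by blast
  show "\<exists>y \<in> carrier (P (Suc (Suc n))). x = d (Suc n) y"
    if "x \<in> carrier (P (Suc n))" "d n x = \<zero>\<^bsub>P n\<^esub>" for n x
    using in_a_kernel_iff[of x "P (Suc n)" "P n" "d n", folded im] that by blast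
qed

lemma e_surj: "y \<in> carrier M \<Longrightarrow> \<exists>x \<in> carrier (P 0). e x = y"
  unfolding e_image[symmetric] by blast

lemma e_eq_zero_iff: "x \<in> carrier (P 0) \<Longrightarrow> e x = \<zero>\<^bsub>M\<^esub> \<longleftrightarrow> (\<exists>y \<in> carrier (P (Suc 0)). x = d 0 y)"
  using in_a_kernel_iff[of x "P 0" M e, folded e_kernel] by blast

lemma zero_module_Ext_iff:
  fixes N :: "('a, 'n) module"
  assumes "module R N"
  shows "zero_module (Ext R (Suc n) M N) \<longleftrightarrow> (\<forall>z. cocycle R P d N (Suc n) z \<longrightarrow> coboundary R P d N n z)"
  unfolding Ext_eq by (rule zero_module_ext_quotient_iff[OF assms])

lemma annihilator_Ext_Suc_iff:
  fixes N :: "('a, 'n) module"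
  assumes "module R N"
  shows "r \<in> annihilator R (Ext R (Suc n) M N) \<longleftrightarrow>
    r \<in> carrier R \<and> (\<forall>z. cocycle R P d N (Suc n) z \<longrightarrow> coboundary R P d N n (\<lambda>x. r \<odot>\<^bsub>N\<^esub> z x))"
  unfolding Ext_eq by (rule annihilator_ext_quotient_iff[OF assms])

lemma annihilator_Ext_zero:
  fixes N :: "('a, 'n) module"
  assumes "module R N" "r \<in> annihilator R (Ext R 0 M N)" "cocycle R P d N 0 z" "x \<in> carrier (P 0)"
  shows "r \<odot>\<^bsub>N\<^esub> z x = \<zero>\<^bsub>N\<^esub>"
  using annihilator_ext_quotient_zero[OF assms(1) _ assms(3,4)] assms(2) unfolding Ext_eq by blast

end

section \<open>Scalars of finite rank along short exact sequences\<close>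

lemma mod_hom_factor_surj:
  assumes d: "mod_hom R P Q d" and h: "mod_hom R P N h"
    and P: "module R P" and Q: "module R Q" and N: "module R N"
    and surj: "\<And>y. y \<in> carrier Q \<Longrightarrow> \<exists>x \<in> carrier P. d x = y"
    and ker: "\<And>x. x \<in> carrier P \<Longrightarrow> d x = \<zero>\<^bsub>Q\<^esub> \<Longrightarrow> h x = \<zero>\<^bsub>N\<^esub>"
  obtains k where "mod_hom R Q N k" "\<And>x. x \<in> carrier P \<Longrightarrow> k (d x) = h x"
proof -
  have "d ` carrier P = carrier Q" using surj mod_homD(1)[OF d] by force
  then have "Q\<lparr>carrier := d ` carrier P\<rparr> = Q" by simp
  then show thesis
    using mod_hom_factor[OF d h P Q N ker] that by metis
qed

lemma mod_hom_scalar: "module R M \<Longrightarrow> r \<in> carrier R \<Longrightarrow> mod_hom R M M (\<lambda>x. r \<odot>\<^bsub>M\<^esub> x)"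
  by (rule mod_hom_smult[OF mod_hom_id])

text \<open>
  Multiplication by \<open>r\<close> on \<open>A\<close> extends to \<open>t : P \<rightarrow> A\<close>; then \<open>r - g t\<close> vanishes on \<open>A\<close> and so
  induces \<open>B \<rightarrow> P\<close>, through which multiplication by \<open>r\<close> on \<open>B\<close> factors.
\<close>

lemma finite_rank_scalar_cokernel:
  assumes A: "module R A" and P: "module R P" and B: "module R B"
    and g: "mod_hom R A P g" and h: "mod_hom R P B h"
    and surj: "\<And>y. y \<in> carrier B \<Longrightarrow> \<exists>x \<in> carrier P. h x = y"
    and hg: "\<And>a. a \<in> carrier A \<Longrightarrow> h (g a) = \<zero>\<^bsub>B\<^esub>"
    and ker: "\<And>x. x \<in> carrier P \<Longrightarrow> h x = \<zero>\<^bsub>B\<^esub> \<Longrightarrow> \<exists>a \<in> carrier A. x = g a"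
    and ext: "\<And>\<phi>. mod_hom R A (regular_module R) \<phi> \<Longrightarrow>
      \<exists>\<psi>. mod_hom R P (regular_module R) \<psi> \<and> (\<forall>x \<in> carrier A. \<psi> (g x) = \<phi> x)"
    and id: "finite_rank R P P (\<lambda>x. x)"
    and r: "r \<in> carrier R" and rA: "finite_rank_scalar R A r"
  shows "finite_rank_scalar R B r"
proof -
  interpret P: module R P by fact
  interpret B: module R B by fact
  obtain t where t: "finite_rank R P A t" "\<And>a. a \<in> carrier A \<Longrightarrow> t (g a) = r \<odot>\<^bsub>A\<^esub> a"
    using finite_rank_extend[OF rA g ext] by blast
  have tm: "mod_hom R P A t" by (rule finite_rank_mod_hom[OF t(1) P A])
  let ?u = "\<lambda>x. r \<odot>\<^bsub>P\<^esub> x \<ominus>\<^bsub>P\<^esub> g (t x)"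
  have u: "mod_hom R P P ?u"
    by (rule mod_hom_diff[OF mod_hom_scalar[OF P r] mod_hom_comp[OF tm g] P])
  have "?u x = \<zero>\<^bsub>P\<^esub>" if x: "x \<in> carrier P" "h x = \<zero>\<^bsub>B\<^esub>" for x
  proof -
    obtain a where a: "a \<in> carrier A" "x = g a" using ker[OF x] by blast
    then show ?thesis using t(2) r mod_homD[OF g] by (simp add: a_minus_def P.M.r_neg)
  qed
  then obtain w where w: "mod_hom R B P w" "\<And>x. x \<in> carrier P \<Longrightarrow> w (h x) = ?u x"
    using mod_hom_factor_surj[OF h u P B P surj] by blast
  have "r \<odot>\<^bsub>B\<^esub> y = h (w y)" if y: "y \<in> carrier B" for y
  proof -
    obtain x where x: "x \<in> carrier P" "h x = y" using surj[OF y] by blast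
    have "h (?u x) = r \<odot>\<^bsub>B\<^esub> y \<ominus>\<^bsub>B\<^esub> h (g (t x))"
      using mod_hom_minus[OF h P B] x r mod_homD[OF h] mod_homD(1)[OF g mod_homD(1)[OF tm x(1)]]
      by simp
    then show ?thesis using w(2)[OF x(1)] x hg mod_homD(1)[OF tm] r y by (auto simp: a_minus_def
        B.M.minus_equality[of "\<zero>\<^bsub>B\<^esub>" "\<zero>\<^bsub>B\<^esub>"])
  qed
  then show ?thesis
    by (intro finite_rank_cong[OF finite_rank_comp[OF id w(1) h P P B]])
qed

text \<open>Multiplication by \<open>r\<close> on \<open>A\<close> lifts to
  \<open>t : A \<rightarrow> P\<close>. Then \<open>r - t h\<close> has values in the kernel of
  \<open>h\<close>, which is the image of \<open>B\<close>, and on that image it is multiplication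
  by \<open>r\<close> because \<open>h\<close> vanishes there. So the sequence splits up to the
  factor \<open>r\<close>.\<close>

lemma scalar_retraction:
  assumes B: "module R B" and P: "module R P" and A: "module R A"
    and g: "mod_hom R B P g" and h: "mod_hom R P A h"
    and inj: "inj_on g (carrier B)"
    and surj: "\<And>y. y \<in> carrier A \<Longrightarrow> \<exists>x \<in> carrier P. h x = y"
    and hg: "\<And>b. b \<in> carrier B \<Longrightarrow> h (g b) = \<zero>\<^bsub>A\<^esub>"
    and ker: "\<And>x. x \<in> carrier P \<Longrightarrow> h x = \<zero>\<^bsub>A\<^esub> \<Longrightarrow> \<exists>b \<in> carrier B. x = g b"
    and r: "r \<in> carrier R" and rA: "finite_rank_scalar R A r"
  obtains w where "mod_hom R P B w" "\<And>b. b \<in> carrier B \<Longrightarrow> w (g b) = r \<odot>\<^bsub>B\<^esub> b"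
proof -
  interpret P: module R P by fact
  interpret A: module R A by fact
  interpret B: module R B by fact
  obtain t where t: "finite_rank R A P t" "\<And>y. y \<in> carrier A \<Longrightarrow> h (t y) = r \<odot>\<^bsub>A\<^esub> y"
    using finite_rank_lift[OF rA h surj A P A] by blast
  have tm: "mod_hom R A P t" by (rule finite_rank_mod_hom[OF t(1) A P])
  let ?u = "\<lambda>x. r \<odot>\<^bsub>P\<^esub> x \<ominus>\<^bsub>P\<^esub> t (h x)"
  have u: "mod_hom R P P ?u"
    by (rule mod_hom_diff[OF mod_hom_scalar[OF P r] mod_hom_comp[OF h tm] P])
  have u_image: "?u x \<in> g ` carrier B" if x: "x \<in> carrier P" for x
  proof -
    have "h (?u x) = r \<odot>\<^bsub>A\<^esub> h x \<ominus>\<^bsub>A\<^esub> h (t (h x))"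
      using mod_hom_minus[OF h P A] x r mod_homD[OF h] mod_homD(1)[OF tm] by simp
    also have "\<dots> = \<zero>\<^bsub>A\<^esub>"
      using t(2)[OF mod_homD(1)[OF h x]] mod_homD(1)[OF h x] r by (simp add: a_minus_def A.M.r_neg)
    finally show ?thesis using ker[OF mod_homD(1)[OF u x]] by blast
  qed
  let ?I = "P\<lparr>carrier := g ` carrier B\<rparr>"
  have "mod_hom R B ?I g" by (rule mod_hom_into_submodule[OF g]) simp
  moreover have "bij_betw g (carrier B) (carrier ?I)" using inj by (simp add: bij_betw_def)
  ultimately have inv: "mod_hom R ?I B (inv_into (carrier B) g)" using B by (rule mod_hom_inv)
  have "mod_hom R P ?I ?u" by (rule mod_hom_into_submodule[OF u u_image])
  from mod_hom_comp[OF this inv] show thesis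
  proof (rule that)
    fix b assume b: "b \<in> carrier B"
    then have gb: "g b \<in> carrier P" by (rule mod_homD(1)[OF g])
    have "?u (g b) = g (r \<odot>\<^bsub>B\<^esub> b)"
      using b gb hg r mod_homD(3)[OF g] mod_hom_zero[OF tm A P] P.M.minus_equality[of "\<zero>\<^bsub>P\<^esub>" "\<zero>\<^bsub>P\<^esub>"]
      by (simp add: a_minus_def)
    then show "inv_into (carrier B) g (?u (g b)) = r \<odot>\<^bsub>B\<^esub> b"
      using inj b r by simp
  qed
qed

text \<open>The retraction up to \<open>r\<close> writes multiplication by \<open>r\<close> on
  \<open>B\<close> as a composite through \<open>P\<close>, whose identity has finite rank.\<close>

lemma finite_rank_scalar_kernel:
  assumes B: "module R B" and P: "module R P" and A: "module R A"
    and g: "mod_hom R B P g" and h: "mod_hom R P A h"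
    and inj: "inj_on g (carrier B)"
    and surj: "\<And>y. y \<in> carrier A \<Longrightarrow> \<exists>x \<in> carrier P. h x = y"
    and hg: "\<And>b. b \<in> carrier B \<Longrightarrow> h (g b) = \<zero>\<^bsub>A\<^esub>"
    and ker: "\<And>x. x \<in> carrier P \<Longrightarrow> h x = \<zero>\<^bsub>A\<^esub> \<Longrightarrow> \<exists>b \<in> carrier B. x = g b"
    and id: "finite_rank R P P (\<lambda>x. x)"
    and r: "r \<in> carrier R" and rA: "finite_rank_scalar R A r"
  shows "finite_rank_scalar R B r"
proof -
  obtain w where w: "mod_hom R P B w" "\<And>b. b \<in> carrier B \<Longrightarrow> w (g b) = r \<odot>\<^bsub>B\<^esub> b"
    using scalar_retraction[OF B P A g h inj surj hg ker r rA] by blast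
  show ?thesis
    by (rule finite_rank_cong[OF finite_rank_comp[OF id g w(1) P P B]]) (simp add: w(2))
qed

section \<open>Syzygies in the chosen resolution\<close>

context noetherian_fg
begin

lemma R_cring: "cring R"
  using M_module by (simp add: module_def)

text \<open>With \<open>d n : P (Suc n) \<rightarrow> P n\<close>, this is \<open>\<Omega>\<^sup>n\<^sup>+\<^sup>1 M\<close>.\<close>

definition "syzygy n = (P n)\<lparr>carrier := d n ` carrier (P (Suc n))\<rparr>"

lemma syzygy_simps [simp]:
  "carrier (syzygy n) = d n ` carrier (P (Suc n))"
  "\<zero>\<^bsub>syzygy n\<^esub> = \<zero>\<^bsub>P n\<^esub>"
  "x \<oplus>\<^bsub>syzygy n\<^esub> y = x \<oplus>\<^bsub>P n\<^esub> y"
  "r \<odot>\<^bsub>syzygy n\<^esub> x = r \<odot>\<^bsub>P n\<^esub> x"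
  by (simp_all add: syzygy_def)

lemma syzygy_submodule: "submodule (d n ` carrier (P (Suc n))) R (P n)"
  by (rule submodule_image[OF d_hom modules modules])

lemma syzygy_module: "module R (syzygy n)"
  unfolding syzygy_def by (rule submodule_module[OF syzygy_submodule modules])

lemma syzygy_incl: "mod_hom R (syzygy n) (P n) (\<lambda>x. x)"
  unfolding syzygy_def by (rule mod_hom_submodule_incl[OF syzygy_submodule modules])

lemma d_syzygy: "mod_hom R (P (Suc n)) (syzygy n) (d n)"
  unfolding syzygy_def by (rule mod_hom_into_submodule[OF d_hom]) simp

lemma syzygy_exact:
  "x \<in> carrier (P (Suc n)) \<Longrightarrow> d n x = \<zero>\<^bsub>P n\<^esub> \<Longrightarrow> x \<in> carrier (syzygy (Suc n))"
  using exact by (fastforce simp: image_iff)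

lemma syzygy_fg: "fg_module R (syzygy n)"
  by (rule fg_module_surj[OF P_fg syzygy_module d_syzygy]) auto

text \<open>The composite of \<open>\<phi>\<close> with \<open>d n\<close> is a cocycle of degree
  \<open>Suc n\<close>; a map on \<open>P n\<close> of which it is the coboundary is precisely an
  extension of \<open>\<phi>\<close>.\<close>

lemma extend_functional:
  assumes "zero_module (Ext R (Suc n) M (regular_module R))"
    and \<phi>: "mod_hom R (syzygy n) (regular_module R) \<phi>"
  shows "\<exists>\<psi>. mod_hom R (P n) (regular_module R) \<psi> \<and> (\<forall>x \<in> carrier (syzygy n). \<psi> x = \<phi> x)"
proof -
  note reg = regular_module[OF R_cring]
  have "cocycle R P d (regular_module R) (Suc n) (\<lambda>x. \<phi> (d n x))"
    using mod_hom_comp[OF d_syzygy \<phi>] d_d mod_hom_zero[OF \<phi> syzygy_module reg]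
    by (simp add: cocycle_def)
  then have "coboundary R P d (regular_module R) n (\<lambda>x. \<phi> (d n x))"
    using assms(1) zero_module_Ext_iff[OF reg] by blast
  then show ?thesis by (auto simp: coboundary_def)
qed

text \<open>Finite rank descends one syzygy at a time: \<open>syzygy (Suc n)\<close> embeds in
  \<open>P (Suc n)\<close> with cokernel \<open>syzygy n\<close>, and at the bottom
  \<open>syzygy 0\<close> embeds in \<open>P 0\<close> with cokernel \<open>M\<close>. Extension of
  functionals from \<open>syzygy n\<close> uses \<open>Ext\<close> in degree \<open>Suc n\<close>,
  so the whole descent draws on several positive degrees.\<close>

lemma finite_rank_scalar_of_syzygy:
  assumes mcm: "\<forall>i>0. zero_module (Ext R i M (regular_module R))"
    and r: "r \<in> carrier R" and s: "finite_rank_scalar R (syzygy n) r"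
  shows "finite_rank_scalar R M r"
  using s
proof (induction n)
  case 0
  show ?case
  proof (rule finite_rank_scalar_cokernel[OF syzygy_module modules M_module syzygy_incl e_hom e_surj _ _ _ P_id r 0])
    show "\<exists>\<psi>. mod_hom R (P 0) (regular_module R) \<psi> \<and> (\<forall>x \<in> carrier (syzygy 0). \<psi> x = \<phi> x)"
      if "mod_hom R (syzygy 0) (regular_module R) \<phi>" for \<phi>
      using extend_functional[OF _ that] mcm by blast
  qed (use mod_homD(1)[OF d_hom] e_eq_zero_iff in auto)
next
  case (Suc n)
  have "finite_rank_scalar R (syzygy n) r"
  proof (rule finite_rank_scalar_cokernel[OF syzygy_module modules syzygy_module syzygy_incl d_syzygy _ _ _ _ P_id r Suc.prems])
    show "\<exists>\<psi>. mod_hom R (P (Suc n)) (regular_module R) \<psi> \<and> (\<forall>x \<in> carrier (syzygy (Suc n)). \<psi> x = \<phi> x)"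
      if "mod_hom R (syzygy (Suc n)) (regular_module R) \<phi>" for \<phi>
      using extend_functional[OF _ that] mcm by blast
  qed (use d_d syzygy_exact in auto)
  then show ?case by (rule Suc.IH)
qed

text \<open>The syzygy itself is the test module: \<open>d n\<close>, seen as a map onto it, is the
  universal cocycle. That \<open>r\<close> times it is a coboundary says that multiplication by
  \<open>r\<close> extends to \<open>P n\<close>, hence factors through a module whose identity has
  finite rank.\<close>

lemma finite_rank_scalar_syzygy:
  assumes "r \<in> annihilator R (Ext R (Suc n) M (syzygy n))"
  shows "finite_rank_scalar R (syzygy n) r"
proof -
  have "cocycle R P d (syzygy n) (Suc n) (d n)"
    using d_syzygy d_d by (simp add: cocycle_def)
  then have "coboundary R P d (syzygy n) n (\<lambda>x. r \<odot>\<^bsub>syzygy n\<^esub> d n x)"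
    using assms annihilator_Ext_Suc_iff[OF syzygy_module] by blast
  then obtain y where y: "mod_hom R (P n) (syzygy n) y"
    "\<And>x. x \<in> carrier (P (Suc n)) \<Longrightarrow> r \<odot>\<^bsub>syzygy n\<^esub> d n x = y (d n x)"
    unfolding coboundary_def by blast
  show ?thesis
    by (rule finite_rank_cong[OF finite_rank_comp[OF P_id syzygy_incl y(1) modules modules syzygy_module]])
      (use y(2) in auto)
qed

end

theorem mcm_finite_rank_scalar:
  fixes R :: "('a, 'c) ring_scheme" and M :: "'a small_module"
  assumes R: "noetherian_ring R" and M: "mcm R M" and r: "r \<in> ca R"
  shows "finite_rank_scalar R M r"
proof -
  interpret noetherian_fg R M by (rule noetherian_fg.intro) (use R M in \<open>simp_all add: mcm_def\<close>)
  obtain n where n: "r \<in> ca_level R n" using r by (auto simp: ca_def)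
  have ann: "r \<in> annihilator R (Ext R n M N)" if "fg_module R N" for N :: "'a small_module"
    using n that fg by (auto simp: ca_level_def)
  have rR: "r \<in> carrier R" using ann[OF fg] by (simp add: annihilator_def)
  show ?thesis
  proof (cases n)
    case 0
    \<comment> \<open>In degree 0 the augmentation represents the identity of \<open>M\<close>, so
      \<open>r\<close> annihilates \<open>M\<close>.\<close>
    have "cocycle R P d M 0 e"
      using e_hom e_eq_zero_iff mod_homD(1)[OF d_hom] by (auto simp: cocycle_def)
    then have "r \<odot>\<^bsub>M\<^esub> e x = \<zero>\<^bsub>M\<^esub>" if "x \<in> carrier (P 0)" for x
      using annihilator_Ext_zero[OF M_module _ _ that] ann[OF fg] 0 by blast
    then show ?thesis using e_surj by (intro finite_rank.zero) metis
  next
    \<comment> \<open>Level \<open>Suc m\<close> fits \<open>syzygy m\<close>, which is the syzygy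
      of order \<open>m + 1\<close>.\<close>
    case (Suc m)
    have "\<forall>i>0. zero_module (Ext R i M (regular_module R))" using M by (simp add: mcm_def)
    then show ?thesis
      using finite_rank_scalar_of_syzygy[OF _ rR] finite_rank_scalar_syzygy ann[OF syzygy_fg] Suc by blast
  qed
qed

text \<open>The long exact sequence in degree 1, unfolded: vanishing of \<open>Ext\<close> refers to
  the chosen resolution of \<open>B\<close>, so the given sequence is first compared with it by maps
  \<open>u : P 0 \<rightarrow> Q\<close> and \<open>?v : P 1 \<rightarrow> A\<close>. The pulled
  back functional \<open>\<phi> ?v\<close> is a cocycle, hence bounded by some \<open>b\<close> on
  \<open>P 0\<close>, and \<open>\<phi>\<close> and \<open>b\<close> glue to a functional on
  \<open>Q\<close>.\<close>

lemma short_exact_extend_functional: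
  fixes R :: "('a, 'c) ring_scheme" and B :: "'a small_module" and Q :: "'a small_module"
    and A :: "('a, 'm) module"
  assumes R: "noetherian_ring R" and B: "mcm R B" and A: "module R A" and Q: "module R Q"
    and g: "mod_hom R A Q g" and h: "mod_hom R Q B h"
    and inj: "inj_on g (carrier A)"
    and surj: "\<And>y. y \<in> carrier B \<Longrightarrow> \<exists>x \<in> carrier Q. h x = y"
    and hg: "\<And>a. a \<in> carrier A \<Longrightarrow> h (g a) = \<zero>\<^bsub>B\<^esub>"
    and ker: "\<And>x. x \<in> carrier Q \<Longrightarrow> h x = \<zero>\<^bsub>B\<^esub> \<Longrightarrow> \<exists>a \<in> carrier A. x = g a"
    and \<phi>: "mod_hom R A (regular_module R) \<phi>"
  shows "\<exists>\<psi>. mod_hom R Q (regular_module R) \<psi> \<and> (\<forall>x \<in> carrier A. \<psi> (g x) = \<phi> x)"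
proof -
  interpret noetherian_fg R B by (rule noetherian_fg.intro) (use R B in \<open>simp_all add: mcm_def\<close>)
  note reg = regular_module[OF R_cring]
  interpret A: module R A by fact
  interpret Q: module R Q by fact
  interpret reg: module R "regular_module R" by fact
  obtain u where u: "mod_hom R (P 0) Q u" "\<And>x. x \<in> carrier (P 0) \<Longrightarrow> h (u x) = e x"
    using projective_lift[OF P_projective Q M_module h surj e_hom] by blast
  let ?I = "Q\<lparr>carrier := g ` carrier A\<rparr>"
  have bij: "bij_betw g (carrier A) (carrier ?I)" using inj by (simp add: bij_betw_def)
  have "mod_hom R A ?I g" by (rule mod_hom_into_submodule[OF g]) simp
  then have inv: "mod_hom R ?I A (inv_into (carrier A) g)" using bij A by (rule mod_hom_inv)
  have ud_image: "u (d 0 x) \<in> g ` carrier A" if x: "x \<in> carrier (P (Suc 0))" for x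
    using ker[OF mod_homD(1)[OF u(1)], of "d 0 x"] u(2) e_eq_zero_iff x mod_homD(1)[OF d_hom x] by auto
  let ?v = "\<lambda>x. inv_into (carrier A) g (u (d 0 x))"
  have v: "mod_hom R (P (Suc 0)) A ?v"
    by (rule mod_hom_comp[OF mod_hom_into_submodule[OF mod_hom_comp[OF d_hom u(1)] ud_image] inv])
  have gv: "g (?v x) = u (d 0 x)" if "x \<in> carrier (P (Suc 0))" for x
    using ud_image[OF that] by (rule f_inv_into_f)
  have g0: "g \<zero>\<^bsub>A\<^esub> = \<zero>\<^bsub>Q\<^esub>" by (rule mod_hom_zero[OF g A Q])
  have "?v (d (Suc 0) x) = \<zero>\<^bsub>A\<^esub>" if "x \<in> carrier (P (Suc (Suc 0)))" for x
    using d_d[OF that] mod_hom_zero[OF u(1) modules Q] inv_into_f_f[OF inj A.M.zero_closed] g0 by simp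
  then have "cocycle R P d (regular_module R) (Suc 0) (\<lambda>x. \<phi> (?v x))"
    using mod_hom_comp[OF v \<phi>] mod_hom_zero[OF \<phi> A reg] by (simp add: cocycle_def)
  then have "coboundary R P d (regular_module R) 0 (\<lambda>x. \<phi> (?v x))"
    using zero_module_Ext_iff[OF reg] B by (auto simp: mcm_def)
  then obtain b where b: "mod_hom R (P 0) (regular_module R) b"
    "\<And>x. x \<in> carrier (P (Suc 0)) \<Longrightarrow> \<phi> (?v x) = b (d 0 x)"
    unfolding coboundary_def by blast
  \<comment> \<open>\<open>Q\<close> is the quotient of \<open>A \<oplus> P 0\<close> under
    \<open>?p\<close>, so a functional on \<open>Q\<close> is a functional \<open>?q\<close> on the
    sum that vanishes on the kernel of \<open>?p\<close>.\<close>
  let ?S = "direct_sum A (P 0)"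
  have S: "module R ?S" by (rule direct_sum_module[OF A modules])
  note fst = mod_hom_direct_sum(1)[OF A modules[of 0]] and snd = mod_hom_direct_sum(2)[OF A modules[of 0]]
  let ?p = "\<lambda>s. g (fst s) \<oplus>\<^bsub>Q\<^esub> u (snd s)"
  let ?q = "\<lambda>s. \<phi> (fst s) \<oplus>\<^bsub>regular_module R\<^esub> b (snd s)"
  have p: "mod_hom R ?S Q ?p" by (rule mod_hom_add[OF mod_hom_comp[OF fst g] mod_hom_comp[OF snd u(1)] Q])
  have q: "mod_hom R ?S (regular_module R) ?q"
    by (rule mod_hom_add[OF mod_hom_comp[OF fst \<phi>] mod_hom_comp[OF snd b(1)] reg])
  have p_surj: "\<exists>s \<in> carrier ?S. ?p s = y" if y: "y \<in> carrier Q" for y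
  proof -
    obtain x where x: "x \<in> carrier (P 0)" "e x = h y" using e_surj[OF mod_homD(1)[OF h y]] by blast
    have ux: "u x \<in> carrier Q" by (rule mod_homD(1)[OF u(1) x(1)])
    have "h (y \<ominus>\<^bsub>Q\<^esub> u x) = h y \<ominus>\<^bsub>B\<^esub> h y"
      using mod_hom_minus[OF h Q M_module y ux] u(2)[OF x(1)] x(2) by simp
    also have "\<dots> = \<zero>\<^bsub>B\<^esub>"
      using abelian_group.r_neg[OF module.axioms(2)[OF M_module] mod_homD(1)[OF h y]] by (simp add: a_minus_def)
    finally obtain a where a: "a \<in> carrier A" "y \<ominus>\<^bsub>Q\<^esub> u x = g a" using ker[of "y \<ominus>\<^bsub>Q\<^esub> u x"] y ux by auto
    have "g a \<oplus>\<^bsub>Q\<^esub> u x = y" using y ux by (simp add: a(2)[symmetric] a_minus_def Q.M.a_assoc Q.M.l_neg)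
    then show ?thesis using a x by (intro bexI[of _ "(a, x)"]) auto
  qed
  \<comment> \<open>The kernel consists of pairs \<open>(- ?v z, d 0 z)\<close>, where
    \<open>?q\<close> is zero by the choice of \<open>b\<close>.\<close>
  have q_ker: "?q s = \<zero>\<^bsub>regular_module R\<^esub>" if s: "s \<in> carrier ?S" "?p s = \<zero>\<^bsub>Q\<^esub>" for s
  proof -
    obtain a x where ax: "s = (a, x)" "a \<in> carrier A" "x \<in> carrier (P 0)" using s by auto
    have c: "g a \<in> carrier Q" "u x \<in> carrier Q" using ax mod_homD(1)[OF g] mod_homD(1)[OF u(1)] by auto
    have p0: "g a \<oplus>\<^bsub>Q\<^esub> u x = \<zero>\<^bsub>Q\<^esub>" using s(2) ax by simp
    have "h (g a \<oplus>\<^bsub>Q\<^esub> u x) = e x"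
      using c mod_homD(2)[OF h] hg[OF ax(2)] u(2)[OF ax(3)] mod_homD(1)[OF e_hom ax(3)] module.axioms(2)[OF M_module]
      by (simp add: abelian_group_def abelian_monoid.l_zero)
    then have "e x = \<zero>\<^bsub>B\<^esub>" using p0 mod_hom_zero[OF h Q M_module] by simp
    then obtain z where z: "z \<in> carrier (P (Suc 0))" "x = d 0 z" using e_eq_zero_iff[OF ax(3)] by blast
    have vz: "?v z \<in> carrier A" by (rule mod_homD(1)[OF v z(1)])
    have "g (a \<oplus>\<^bsub>A\<^esub> ?v z) = \<zero>\<^bsub>Q\<^esub>"
      using mod_homD(2)[OF g ax(2) vz] gv[OF z(1)] p0 z(2) by simp
    then have "a \<oplus>\<^bsub>A\<^esub> ?v z = \<zero>\<^bsub>A\<^esub>" using inj_onD[OF inj] g0 ax(2) vz by simp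
    then have "\<phi> (a \<oplus>\<^bsub>A\<^esub> ?v z) = \<zero>\<^bsub>R\<^esub>" using mod_hom_zero[OF \<phi> A reg] by simp
    then show ?thesis using mod_homD(2)[OF \<phi> ax(2) vz] b(2)[OF z(1)] ax(1) z(2) by simp
  qed
  obtain \<psi> where \<psi>: "mod_hom R Q (regular_module R) \<psi>" "\<And>s. s \<in> carrier ?S \<Longrightarrow> \<psi> (?p s) = ?q s"
    using mod_hom_factor_surj[OF p q S Q reg p_surj q_ker] by blast
  have "\<psi> (g a) = \<phi> a" if a: "a \<in> carrier A" for a
  proof -
    interpret P0: module R "P 0" by (rule modules)
    have "(a, \<zero>\<^bsub>P 0\<^esub>) \<in> carrier ?S" using a by simp
    from \<psi>(2)[OF this] show ?thesis
      using mod_hom_zero[OF u(1) modules Q] mod_hom_zero[OF b(1) modules reg] mod_homD(1)[OF g a] mod_homD(1)[OF \<phi> a]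
      by simp
  qed
  with \<psi>(1) show ?thesis by blast
qed

section \<open>Syzygies over a ring of finite injective dimension\<close>

text \<open>A chase in the double complex of homomorphisms from \<open>Q n\<close> to
  \<open>I j\<close>: each step lowers \<open>n\<close> and raises \<open>j\<close>, with
  \<open>n + j\<close> constant. Since \<open>n > m\<close> at the start, \<open>j > m\<close> when
  \<open>n\<close> reaches 0, and there the injective module is zero.\<close>

lemma injective_resolution_coboundary:
  fixes Q :: "nat \<Rightarrow> 'a small_module" and N :: "('a, 'n) module"
  assumes N: "module R N" and I: "injective_resolution R N I \<delta> \<epsilon>" and fin: "\<And>i. i > m \<Longrightarrow> zero_module (I i)"
    and Q: "acyclic_complex R Q d" and proj: "\<And>n. projective_module R (Q n)"
    and n: "Suc m \<le> n" and z: "cocycle R Q d N (Suc n) z"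
  shows "coboundary R Q d N n z"
proof -
  interpret acyclic_complex R Q d by (rule Q)
  have inj: "injective_module R (I i)" and \<delta>: "mod_hom R (I i) (I (Suc i)) (\<delta> i)"
    and \<delta>_image: "\<delta> i ` carrier (I i) = a_kernel (I (Suc i)) (I (Suc (Suc i))) (\<delta> (Suc i))" for i
    using I by (auto simp: injective_resolution_def module_Hom_iff)
  have \<epsilon>: "mod_hom R N (I 0) \<epsilon>" "inj_on \<epsilon> (carrier N)" "\<epsilon> ` carrier N = a_kernel (I 0) (I (Suc 0)) (\<delta> 0)"
    using I by (auto simp: injective_resolution_def module_Hom_iff)
  have IM: "module R (I i)" for i using inj by (simp add: injective_module_def)
  \<comment> \<open>The values stay in the kernel of \<open>\<delta> j\<close>, both for
    \<open>z\<close> and for the bounding map \<open>y\<close>. For \<open>j = 0\<close> this kernel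
    is \<open>N\<close>, which brings the result back to maps into \<open>N\<close>.\<close>
  have shift: "\<exists>y. mod_hom R (Q n) (I j) y \<and> (\<forall>x \<in> carrier (Q n). \<delta> j (y x) = \<zero>\<^bsub>I (Suc j)\<^esub>) \<and>
      (\<forall>x \<in> carrier (Q (Suc n)). z x = y (d n x))"
    if "mod_hom R (Q (Suc n)) (I j) z" "\<forall>x \<in> carrier (Q (Suc n)). \<delta> j (z x) = \<zero>\<^bsub>I (Suc j)\<^esub>"
      "\<forall>x \<in> carrier (Q (Suc (Suc n))). z (d (Suc n) x) = \<zero>\<^bsub>I j\<^esub>" "Suc m \<le> j + n" for j n z
    using that
  proof (induction n arbitrary: j z)
    case 0
    then have "carrier (I j) = {\<zero>\<^bsub>I j\<^esub>}" using fin[of j] by (simp add: zero_module_def)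
    then have "z x = \<zero>\<^bsub>I j\<^esub>" if "x \<in> carrier (Q (Suc 0))" for x
      using mod_homD(1)[OF 0(1) that] by simp
    then show ?case
      using mod_hom_const_zero[OF IM] mod_hom_zero[OF \<delta> IM IM] by (intro exI[of _ "\<lambda>x. \<zero>\<^bsub>I j\<^esub>"]) simp
  next
    case (Suc n)
    note z = Suc.prems(1-3)
    have kill: "z x = \<zero>\<^bsub>I j\<^esub>" if x: "x \<in> carrier (Q (Suc (Suc n)))" "d (Suc n) x = \<zero>\<^bsub>Q (Suc n)\<^esub>" for x
      using exact[OF x] z(3) by blast
    \<comment> \<open>Injectivity of \<open>I j\<close> bounds \<open>z\<close> by some
      \<open>g\<close>, whose values may however leave the kernel of
      \<open>\<delta> j\<close>.\<close>
    obtain g where g: "mod_hom R (Q (Suc n)) (I j) g" "\<And>x. x \<in> carrier (Q (Suc (Suc n))) \<Longrightarrow> g (d (Suc n) x) = z x"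
      using injective_extend[OF inj modules modules d_hom z(1) kill] by blast
    have \<delta>\<delta>: "\<delta> (Suc j) (\<delta> j x) = \<zero>\<^bsub>I (Suc (Suc j))\<^esub>" if "x \<in> carrier (I j)" for x
      using in_a_kernel_iff[of "\<delta> j x" "I (Suc j)" "I (Suc (Suc j))" "\<delta> (Suc j)", folded \<delta>_image] that by blast
    have \<delta>g: "mod_hom R (Q (Suc n)) (I (Suc j)) (\<lambda>x. \<delta> j (g x))" by (rule mod_hom_comp[OF g(1) \<delta>])
    \<comment> \<open>The defect \<open>\<delta> j g\<close> is a cocycle one step further along the
      antidiagonal, so the induction hypothesis bounds it by \<open>k\<close>.\<close>
    obtain k where k: "mod_hom R (Q n) (I (Suc j)) k"
      "\<And>x. x \<in> carrier (Q n) \<Longrightarrow> \<delta> (Suc j) (k x) = \<zero>\<^bsub>I (Suc (Suc j))\<^esub>"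
      "\<And>x. x \<in> carrier (Q (Suc n)) \<Longrightarrow> \<delta> j (g x) = k (d n x)"
      using Suc.IH[OF \<delta>g] \<delta>\<delta> mod_homD(1)[OF g(1)] g(2) z(2) Suc.prems(4) by fastforce
    let ?Z = "(I (Suc j))\<lparr>carrier := \<delta> j ` carrier (I j)\<rparr>"
    have Z: "module R ?Z" by (rule submodule_module[OF submodule_image[OF \<delta> IM IM] IM])
    have k_image: "k x \<in> \<delta> j ` carrier (I j)" if "x \<in> carrier (Q n)" for x
      unfolding \<delta>_image in_a_kernel_iff using k(2) mod_homD(1)[OF k(1)] that by blast
    have \<delta>Z: "mod_hom R (I j) ?Z (\<delta> j)" by (rule mod_hom_into_submodule[OF \<delta>]) simp
    have \<delta>Z_surj: "\<exists>x \<in> carrier (I j). \<delta> j x = y" if "y \<in> carrier ?Z" for y using that by auto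
    obtain l where l: "mod_hom R (Q n) (I j) l" "\<And>x. x \<in> carrier (Q n) \<Longrightarrow> \<delta> j (l x) = k x"
      using projective_lift[OF proj IM Z \<delta>Z \<delta>Z_surj mod_hom_into_submodule[OF k(1) k_image]] by blast
    interpret Ij: module R "I j" by (rule IM)
    interpret Isj: module R "I (Suc j)" by (rule IM)
    \<comment> \<open>Projectivity of \<open>Q n\<close> lifted \<open>k\<close> through
      \<open>\<delta> j\<close> to \<open>l\<close>. Subtracting \<open>l d\<close> removes the
      defect of \<open>g\<close> and leaves its composite with \<open>d (Suc n)\<close> unchanged,
      because \<open>d d = 0\<close>.\<close>
    let ?y = "\<lambda>x. g x \<ominus>\<^bsub>I j\<^esub> l (d n x)"
    have "mod_hom R (Q (Suc n)) (I j) ?y"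
      by (rule mod_hom_diff[OF g(1) mod_hom_comp[OF d_hom l(1)] IM])
    moreover have "\<delta> j (?y x) = \<zero>\<^bsub>I (Suc j)\<^esub>" if x: "x \<in> carrier (Q (Suc n))" for x
    proof -
      have c: "d n x \<in> carrier (Q n)" by (rule mod_homD(1)[OF d_hom x])
      have "\<delta> j (?y x) = \<delta> j (g x) \<ominus>\<^bsub>I (Suc j)\<^esub> \<delta> j (l (d n x))"
        by (rule mod_hom_minus[OF \<delta> IM IM mod_homD(1)[OF g(1) x] mod_homD(1)[OF l(1) c]])
      then show ?thesis
        using k(3)[OF x] l(2)[OF c] mod_homD(1)[OF k(1) c] by (simp add: a_minus_def Isj.M.r_neg)
    qed
    moreover have "z x = ?y (d (Suc n) x)" if x: "x \<in> carrier (Q (Suc (Suc n)))" for x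
      using g(2)[OF x] d_d[OF x] mod_hom_zero[OF l(1) modules IM] mod_homD(1)[OF z(1) x]
        Ij.M.minus_equality[of "\<zero>\<^bsub>I j\<^esub>" "\<zero>\<^bsub>I j\<^esub>"] by (simp add: a_minus_def)
    ultimately show ?case by blast
  qed
  have \<delta>\<epsilon>: "\<delta> 0 (\<epsilon> x) = \<zero>\<^bsub>I (Suc 0)\<^esub>" if "x \<in> carrier N" for x
    using in_a_kernel_iff[of "\<epsilon> x" "I 0" "I (Suc 0)" "\<delta> 0", folded \<epsilon>(3)] that by blast
  have zm: "mod_hom R (Q (Suc n)) N z" and zd: "\<And>x. x \<in> carrier (Q (Suc (Suc n))) \<Longrightarrow> z (d (Suc n) x) = \<zero>\<^bsub>N\<^esub>"
    using z by (auto simp: cocycle_def)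
  obtain y where y: "mod_hom R (Q n) (I 0) y" "\<And>x. x \<in> carrier (Q n) \<Longrightarrow> \<delta> 0 (y x) = \<zero>\<^bsub>I (Suc 0)\<^esub>"
      "\<And>x. x \<in> carrier (Q (Suc n)) \<Longrightarrow> \<epsilon> (z x) = y (d n x)"
    using shift[OF mod_hom_comp[OF zm \<epsilon>(1)]] \<delta>\<epsilon> mod_homD(1)[OF zm] zd mod_hom_zero[OF \<epsilon>(1) N IM] n by auto
  \<comment> \<open>The values of \<open>y\<close> lie in the image of \<open>\<epsilon>\<close>, on
    which \<open>\<epsilon>\<close> has an inverse.\<close>
  let ?E = "(I 0)\<lparr>carrier := \<epsilon> ` carrier N\<rparr>"
  have "mod_hom R N ?E \<epsilon>" by (rule mod_hom_into_submodule[OF \<epsilon>(1)]) simp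
  moreover have "bij_betw \<epsilon> (carrier N) (carrier ?E)" using \<epsilon>(2) by (simp add: bij_betw_def)
  ultimately have inv: "mod_hom R ?E N (inv_into (carrier N) \<epsilon>)" using N by (rule mod_hom_inv)
  have y_image: "y x \<in> \<epsilon> ` carrier N" if "x \<in> carrier (Q n)" for x
    unfolding \<epsilon>(3) in_a_kernel_iff using y(2) mod_homD(1)[OF y(1)] that by blast
  have "z x = inv_into (carrier N) \<epsilon> (y (d n x))" if x: "x \<in> carrier (Q (Suc n))" for x
    using y(3)[OF x, symmetric] inv_into_f_f[OF \<epsilon>(2) mod_homD(1)[OF zm x]] by simp
  then show ?thesis
    using mod_hom_comp[OF mod_hom_into_submodule[OF y(1) y_image] inv] by (auto simp: coboundary_def)
qed

text \<open>Positive degrees of the chosen resolution of the syzygy are degrees above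
  \<open>m + 1\<close> in a resolution of \<open>M\<close> obtained by splicing, where all cocycles
  with values in the ring are coboundaries.\<close>

lemma (in noetherian_fg) syzygy_mcm:
  assumes I: "injective_resolution R (regular_module R) I \<delta> \<epsilon>" and fin: "\<And>i. i > m \<Longrightarrow> zero_module (I i)"
  shows "mcm R (syzygy m)"
proof -
  interpret K: noetherian_fg R "syzygy m"
    using noetherian syzygy_fg by (rule noetherian_fg.intro)
  note reg = regular_module[OF R_cring]
  \<comment> \<open>\<open>P 0, ..., P m\<close> are followed by \<open>K.P 0, K.P 1, ...\<close>;
    at the seam the differential is the augmentation \<open>K.e\<close>, read as a map into
    \<open>P m\<close>.\<close>
  define Q where "Q n = (if n \<le> m then P n else K.P (n - Suc m))" for n
  define D where "D n = (if n < m then d n else if n = m then K.e else K.d (n - Suc m))" for n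
  have Q: "acyclic_complex R Q D"
  proof (intro acyclic_complex.intro module_complex.intro acyclic_complex_axioms.intro)
    show "module R (Q n)" for n by (simp add: Q_def modules K.modules)
    show "mod_hom R (Q (Suc n)) (Q n) (D n)" for n
    proof -
      consider "n < m" | "n = m" | k where "n = Suc m + k"
        by (metis less_imp_Suc_add linorder_neqE_nat add_Suc)
      then show ?thesis
        using d_hom K.d_hom mod_hom_comp[OF K.e_hom syzygy_incl]
        by cases (auto simp: Q_def D_def)
    qed
    have K_zero_iff: "K.e x = \<zero>\<^bsub>P m\<^esub> \<longleftrightarrow> (\<exists>y \<in> carrier (K.P (Suc 0)). x = K.d 0 y)" if "x \<in> carrier (K.P 0)" for x
      using K.e_eq_zero_iff[OF that] by simp
    fix n
    \<comment> \<open>The two middle cases are exactness on either side of the seam: at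
      \<open>P m\<close>, and at \<open>K.P 0\<close>.\<close>
    consider "Suc n < m" | "Suc n = m" | "n = m" | k where "n = Suc m + k"
      by (metis less_imp_Suc_add linorder_neqE_nat add_Suc Suc_lessI)
    then have complex: "(\<forall>x \<in> carrier (Q (Suc (Suc n))). D n (D (Suc n) x) = \<zero>\<^bsub>Q n\<^esub>) \<and>
        (\<forall>x \<in> carrier (Q (Suc n)). D n x = \<zero>\<^bsub>Q n\<^esub> \<longrightarrow> (\<exists>y \<in> carrier (Q (Suc (Suc n))). x = D (Suc n) y))"
    proof cases
      case 1
      then show ?thesis using d_d exact by (simp add: Q_def D_def)
    next
      case 2
      have "d n (K.e x) = \<zero>\<^bsub>P n\<^esub>" if "x \<in> carrier (K.P 0)" for x
        using mod_homD(1)[OF K.e_hom that] d_d 2 by auto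
      moreover have "\<exists>y \<in> carrier (K.P 0). x = K.e y" if "x \<in> carrier (P m)" "d n x = \<zero>\<^bsub>P n\<^esub>" for x
        using K.e_surj[of x] exact[of x n] that 2 by auto
      ultimately show ?thesis using 2 by (auto simp: Q_def D_def)
    next
      case 3
      have "K.e (K.d 0 x) = \<zero>\<^bsub>P m\<^esub>" if "x \<in> carrier (K.P (Suc 0))" for x
        using K_zero_iff mod_homD(1)[OF K.d_hom that] that by blast
      then show ?thesis using 3 K_zero_iff by (simp add: Q_def D_def)
    next
      case 4
      then show ?thesis using K.d_d K.exact by (simp add: Q_def D_def)
    qed
    show "D n (D (Suc n) x) = \<zero>\<^bsub>Q n\<^esub>" if "x \<in> carrier (Q (Suc (Suc n)))" for x
      using complex that by blast
    show "\<exists>y \<in> carrier (Q (Suc (Suc n))). x = D (Suc n) y"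
      if "x \<in> carrier (Q (Suc n))" "D n x = \<zero>\<^bsub>Q n\<^esub>" for x
      using complex that by blast
  qed
  have proj: "projective_module R (Q n)" for n
    by (simp add: Q_def P_projective K.P_projective)
  have "coboundary R K.P K.d (regular_module R) i z" if z: "cocycle R K.P K.d (regular_module R) (Suc i) z" for i z
  proof -
    \<comment> \<open>\<open>K.P i\<close> sits in degree \<open>Suc m + i\<close> of the spliced
      complex, so the bound \<open>Suc m \<le> n\<close> of the preceding lemma holds for every
      \<open>i\<close>, including 0.\<close>
    have "cocycle R Q D (regular_module R) (Suc (Suc m + i)) z"
      using z by (simp add: cocycle_def Q_def D_def)
    then have "coboundary R Q D (regular_module R) (Suc m + i) z"
      by (intro injective_resolution_coboundary[OF reg I fin Q proj le_add1])
    then show ?thesis by (simp add: coboundary_def Q_def D_def)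
  qed
  then have "zero_module (Ext R (Suc i) (syzygy m) (regular_module R))" for i
    using K.zero_module_Ext_iff[OF reg] by blast
  then show ?thesis
    using syzygy_fg by (auto simp: mcm_def gr0_conv_Suc)
qed

text \<open>A cocycle \<open>z\<close> of degree \<open>n + 2\<close> factors as \<open>z'\<close>
  after the map onto \<open>syzygy (Suc n)\<close>, the kernel of
  \<open>P (Suc n) \<rightarrow> syzygy n\<close>. The retraction \<open>w\<close> up to
  \<open>r\<close> of that sequence extends \<open>r z'\<close> to \<open>P (Suc n)\<close>, which
  exhibits \<open>r z\<close> as a coboundary.\<close>

lemma (in noetherian_fg) annihilator_Ext_of_syzygy:
  fixes N :: "('a, 'n) module"
  assumes r: "r \<in> carrier R" and s: "finite_rank_scalar R (syzygy n) r" and N: "module R N"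
  shows "r \<in> annihilator R (Ext R (Suc (Suc n)) M N)"
  unfolding annihilator_Ext_Suc_iff[OF N]
proof (intro conjI r allI impI)
  fix z assume "cocycle R P d N (Suc (Suc n)) z"
  then have z: "mod_hom R (P (Suc (Suc n))) N z"
    "\<And>x. x \<in> carrier (P (Suc (Suc (Suc n)))) \<Longrightarrow> z (d (Suc (Suc n)) x) = \<zero>\<^bsub>N\<^esub>"
    by (auto simp: cocycle_def)
  obtain w where w: "mod_hom R (P (Suc n)) (syzygy (Suc n)) w"
    "\<And>b. b \<in> carrier (syzygy (Suc n)) \<Longrightarrow> w b = r \<odot>\<^bsub>syzygy (Suc n)\<^esub> b"
    by (rule scalar_retraction[OF syzygy_module modules syzygy_module syzygy_incl d_syzygy _ _ _ _ r s])
      (use d_d syzygy_exact in auto)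
  have kill: "z x = \<zero>\<^bsub>N\<^esub>" if "x \<in> carrier (P (Suc (Suc n)))" "d (Suc n) x = \<zero>\<^bsub>syzygy (Suc n)\<^esub>" for x
    using exact[of x "Suc n"] that z(2) by auto
  have surj: "\<exists>x \<in> carrier (P (Suc (Suc n))). d (Suc n) x = y" if "y \<in> carrier (syzygy (Suc n))" for y
    using that by auto
  obtain z' where z': "mod_hom R (syzygy (Suc n)) N z'" "\<And>x. x \<in> carrier (P (Suc (Suc n))) \<Longrightarrow> z' (d (Suc n) x) = z x"
    using mod_hom_factor_surj[OF d_syzygy z(1) modules syzygy_module N surj kill] by blast
  have "r \<odot>\<^bsub>N\<^esub> z x = z' (w (d (Suc n) x))" if x: "x \<in> carrier (P (Suc (Suc n)))" for x
    using w(2)[of "d (Suc n) x"] mod_homD(3)[OF z'(1) r, of "d (Suc n) x"] z'(2)[OF x] x by simp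
  then show "coboundary R P d N (Suc n) (\<lambda>x. r \<odot>\<^bsub>N\<^esub> z x)"
    using mod_hom_comp[OF w(1) z'(1)] by (auto simp: coboundary_def)
qed

theorem ca_if_finite_rank_scalars:
  fixes R :: "('a, 'c) ring_scheme"
  assumes R: "gorenstein_ring R" and r: "r \<in> carrier R"
    and scalars: "\<And>M :: 'a small_module. mcm R M \<Longrightarrow> finite_rank_scalar R M r"
  shows "r \<in> ca R"
proof -
  obtain I \<delta> \<epsilon> m where I: "injective_resolution R (regular_module R) I \<delta> \<epsilon>" "\<And>i. i > m \<Longrightarrow> zero_module (I i)"
    using R by (auto simp: gorenstein_ring_def finite_injective_dimension_def)
  have "r \<in> annihilator R (Ext R (Suc (Suc m)) M N)" if M: "fg_module R M" and N: "fg_module R N"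
    for M N :: "'a small_module"
  proof -
    interpret noetherian_fg R M by (rule noetherian_fg.intro) (use R M in \<open>simp_all add: gorenstein_ring_def\<close>)
    show ?thesis
      by (rule annihilator_Ext_of_syzygy[OF r scalars[OF syzygy_mcm[OF I]] fg_module_module[OF N]])
  qed
  \<comment> \<open>\<open>m\<close> comes from an injective resolution of the ring, so one level
    serves all pairs of modules.\<close>
  then have "r \<in> ca_level R (Suc (Suc m))" by (auto simp: ca_level_def)
  then show ?thesis by (auto simp: ca_def)
qed

section \<open>Base change\<close>

locale base_change_module =
  fixes R :: "('a, 'c) ring_scheme" and S :: "('b, 'd) ring_scheme" and f :: "'a \<Rightarrow> 'b"
    and M :: "('a, 'm) module"
  assumes S_cring: "cring S" and f_hom: "f \<in> ring_hom R S" and M_module: "module R M"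
begin

sublocale M: module R M by (rule M_module)
sublocale S: cring S by (rule S_cring)

abbreviation "X \<equiv> carrier M \<times> carrier S"
abbreviation "act s \<equiv> frag_extend (\<lambda>(x, t). frag_of (x, s \<otimes>\<^bsub>S\<^esub> t))"

definition G :: "('b, 'm \<times> 'b \<Rightarrow>\<^sub>0 int) module" where
  "G = \<lparr>carrier = carrier (free_Abelian_group X), monoid.mult = undefined, one = undefined,
     ring.zero = 0, ring.add = (+), smult = act\<rparr>"

definition H :: "('m \<times> 'b \<Rightarrow>\<^sub>0 int) set" where
  "H = generate (free_Abelian_group X) (tensor_relations R S f M)"

abbreviation "T \<equiv> base_change R S f M"

lemma T_eq: "T = quotient_module G H"
  by (simp add: base_change_def G_def H_def)

lemma G_simps [simp]:
  "u \<in> carrier G \<longleftrightarrow> Poly_Mapping.keys u \<subseteq> X"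
  "\<zero>\<^bsub>G\<^esub> = 0" "u \<oplus>\<^bsub>G\<^esub> v = u + v" "s \<odot>\<^bsub>G\<^esub> u = act s u"
  by (simp_all add: G_def)

lemma f_closed: "r \<in> carrier R \<Longrightarrow> f r \<in> carrier S"
  using f_hom by (rule ring_hom_closed)

lemma relations_subset: "tensor_relations R S f M \<subseteq> carrier (free_Abelian_group X)"
proof -
  have "Poly_Mapping.keys (frag_of a - frag_of b - frag_of c) \<subseteq> X" "Poly_Mapping.keys (frag_of a - frag_of b) \<subseteq> X"
    if "a \<in> X" "b \<in> X" "c \<in> X" for a b c
    using that keys_diff[of "frag_of a - frag_of b" "frag_of c"] keys_diff[of "frag_of a" "frag_of b"] by auto
  then show ?thesis by (auto simp: tensor_relations_def f_closed)
qed

lemma H_subgroup: "subgroup H (free_Abelian_group X)"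
  unfolding H_def by (rule group.generate_is_subgroup[OF group_free_Abelian_group relations_subset])

lemma H_subset: "u \<in> H \<Longrightarrow> Poly_Mapping.keys u \<subseteq> X"
  using subsetD[OF subgroup.subset[OF H_subgroup], of u] by simp

lemma H_zero: "0 \<in> H"
  using subgroup.one_closed[OF H_subgroup] by simp

lemma H_add: "u \<in> H \<Longrightarrow> v \<in> H \<Longrightarrow> u + v \<in> H"
  using subgroup.m_closed[OF H_subgroup] by simp

lemma H_minus: "u \<in> H \<Longrightarrow> - u \<in> H"
  using subgroup.m_inv_closed[OF H_subgroup] H_subset by fastforce

lemma H_diff: "u \<in> H \<Longrightarrow> v \<in> H \<Longrightarrow> u - v \<in> H"
  using H_add[OF _ H_minus, of u v] by simp

lemma H_relations:
  "x \<in> carrier M \<Longrightarrow> y \<in> carrier M \<Longrightarrow> s \<in> carrier S \<Longrightarrow>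
    frag_of (x \<oplus>\<^bsub>M\<^esub> y, s) - frag_of (x, s) - frag_of (y, s) \<in> H"
  "x \<in> carrier M \<Longrightarrow> s \<in> carrier S \<Longrightarrow> t \<in> carrier S \<Longrightarrow>
    frag_of (x, s \<oplus>\<^bsub>S\<^esub> t) - frag_of (x, s) - frag_of (x, t) \<in> H"
  "r \<in> carrier R \<Longrightarrow> x \<in> carrier M \<Longrightarrow> s \<in> carrier S \<Longrightarrow>
    frag_of (r \<odot>\<^bsub>M\<^esub> x, s) - frag_of (x, f r \<otimes>\<^bsub>S\<^esub> s) \<in> H"
proof -
  show "frag_of (x \<oplus>\<^bsub>M\<^esub> y, s) - frag_of (x, s) - frag_of (y, s) \<in> H"
    if "x \<in> carrier M" "y \<in> carrier M" "s \<in> carrier S"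
    unfolding H_def tensor_relations_def
    by (rule generate.incl, rule UnI1, rule UnI1, rule CollectI, intro exI conjI, rule refl) (fact that)+
  show "frag_of (x, s \<oplus>\<^bsub>S\<^esub> t) - frag_of (x, s) - frag_of (x, t) \<in> H"
    if "x \<in> carrier M" "s \<in> carrier S" "t \<in> carrier S"
    unfolding H_def tensor_relations_def
    by (rule generate.incl, rule UnI1, rule UnI2, rule CollectI, intro exI conjI, rule refl) (fact that)+
  show "frag_of (r \<odot>\<^bsub>M\<^esub> x, s) - frag_of (x, f r \<otimes>\<^bsub>S\<^esub> s) \<in> H"
    if "r \<in> carrier R" "x \<in> carrier M" "s \<in> carrier S"
    unfolding H_def tensor_relations_def
    by (rule generate.incl, rule UnI2, rule CollectI, intro exI conjI, rule refl) (fact that)+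
qed

text \<open>The induction rule of \<open>generate\<close> treats inverses and products separately; a
  single rule for differences covers both, since an inverse is a difference from 0.\<close>

lemma H_induct [consumes 1, case_names relation zero diff]:
  assumes u: "u \<in> H"
    and rel: "\<And>u. u \<in> tensor_relations R S f M \<Longrightarrow> Q u"
    and zero: "Q 0" and diff: "\<And>u v. u \<in> H \<Longrightarrow> v \<in> H \<Longrightarrow> Q u \<Longrightarrow> Q v \<Longrightarrow> Q (u - v)"
  shows "Q u"
proof -
  have incl: "v \<in> H" if "v \<in> tensor_relations R S f M" for v
    using that unfolding H_def by (rule generate.incl)
  have neg: "Q (- v)" if "v \<in> H" "Q v" for v
    using diff[OF H_zero that(1) zero that(2)] by simp
  have "u \<in> H \<and> Q u"
    using u[unfolded H_def]
  proof induction
    case (inv v)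
    then have "inv\<^bsub>free_Abelian_group X\<^esub> v = - v"
      using subsetD[OF relations_subset, of v] by (intro inv_free_Abelian_group) simp
    then show ?case using inv incl rel neg H_minus by simp
  next
    case (eng u v)
    then have "u - (- v) \<in> H \<and> Q (u - (- v))"
      using H_minus H_diff neg diff by blast
    then show ?case by simp
  qed (use incl rel zero H_zero in simp_all)
  then show ?thesis ..
qed

lemma act_closed:
  assumes "s \<in> carrier S" "Poly_Mapping.keys u \<subseteq> X"
  shows "Poly_Mapping.keys (act s u) \<subseteq> X"
  using keys_frag_extend[of "\<lambda>(x, t). frag_of (x, s \<otimes>\<^bsub>S\<^esub> t)" u] assms by fastforce

lemma act_H:
  assumes s: "s \<in> carrier S" and u: "u \<in> H" shows "act s u \<in> H"
  using u
proof (induction rule: H_induct)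
  case (relation u)
  then show ?case
    unfolding tensor_relations_def
  proof (elim UnE CollectE exE conjE, goal_cases)
    case (1 x y t)
    then show ?case using s H_relations(1)[of x y "s \<otimes>\<^bsub>S\<^esub> t"] by (simp add: frag_extend_diff)
  next
    case (2 x t t')
    then show ?case
      using s H_relations(2)[of x "s \<otimes>\<^bsub>S\<^esub> t" "s \<otimes>\<^bsub>S\<^esub> t'"] by (simp add: frag_extend_diff S.r_distr)
  next
    case (3 r x t)
    then show ?case
      using s H_relations(3)[of r x "s \<otimes>\<^bsub>S\<^esub> t"] by (simp add: frag_extend_diff f_closed S.m_lcomm)
  qed
qed (simp_all add: H_zero frag_extend_diff H_diff)

lemma keys_add_X: "Poly_Mapping.keys u \<subseteq> X \<Longrightarrow> Poly_Mapping.keys v \<subseteq> X \<Longrightarrow> Poly_Mapping.keys (u + v) \<subseteq> X"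
  using keys_add[of u v] by blast

lemmas X_induct = free_Abelian_group_induct[where S = X, consumes 1, case_names zero diff gen]

lemma G_abelian_group: "abelian_group G"
proof (rule abelian_groupI)
  fix u assume "u \<in> carrier G"
  then show "\<exists>v \<in> carrier G. v \<oplus>\<^bsub>G\<^esub> u = \<zero>\<^bsub>G\<^esub>" by (intro bexI[of _ "- u"]) simp_all
qed (simp_all add: keys_add_X add.assoc add.commute)

lemma H_additive_subgroup: "subgroup H (add_monoid G)"
proof -
  interpret G: abelian_group G by (rule G_abelian_group)
  show ?thesis
  proof (rule G.add.subgroupI)
    fix u assume "u \<in> H"
    moreover from this have "\<ominus>\<^bsub>G\<^esub> u = - u"
      using H_subset[of u] by (intro G.minus_equality) simp_all
    ultimately show "\<ominus>\<^bsub>G\<^esub> u \<in> H" by (simp add: H_minus)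
  qed (use H_zero H_subset H_add in \<open>auto simp: G_simps\<close>)
qed

lemma G_H: "abelian_subgroup H G"
  by (intro abelian_subgroupI2 abelian_group.a_comm_group G_abelian_group H_additive_subgroup)

abbreviation "cls u \<equiv> a_r_coset G H u"

lemma in_cls_iff:
  assumes "Poly_Mapping.keys u \<subseteq> X" "Poly_Mapping.keys v \<subseteq> X" shows "v \<in> cls u \<longleftrightarrow> v - u \<in> H"
proof -
  have "v \<in> cls u \<longleftrightarrow> (\<exists>h \<in> H. v = h + u)" by (auto simp: a_r_coset_def' )
  then show ?thesis by (metis add_diff_cancel_right' diff_add_cancel)
qed

lemma cls_eqI:
  assumes "Poly_Mapping.keys u \<subseteq> X" "Poly_Mapping.keys v \<subseteq> X" "v - u \<in> H" shows "cls u = cls v"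
  using assms in_cls_iff
  by (intro abelian_group.a_repr_independence[OF G_abelian_group _ _ H_additive_subgroup]) simp_all

lemma T_carrier: "carrier T = cls ` {u. Poly_Mapping.keys u \<subseteq> X}"
  by (auto simp: T_eq A_RCOSETS_def')

lemma T_carrierE:
  assumes "x \<in> carrier T" obtains u where "Poly_Mapping.keys u \<subseteq> X" "x = cls u"
  using assms by (auto simp: T_carrier)

lemma cls_in_T: "Poly_Mapping.keys u \<subseteq> X \<Longrightarrow> cls u \<in> carrier T"
  by (auto simp: T_carrier)

lemma T_zero: "\<zero>\<^bsub>T\<^esub> = cls 0"
proof -
  have "H \<subseteq> carrier G" using H_subset by (intro subsetI) simp
  then have "cls \<zero>\<^bsub>G\<^esub> = H" by (rule abelian_group.a_coset_add_zero[OF G_abelian_group])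
  then show ?thesis by (simp add: T_eq)
qed

lemma T_add:
  assumes "Poly_Mapping.keys u \<subseteq> X" "Poly_Mapping.keys v \<subseteq> X"
  shows "cls u \<oplus>\<^bsub>T\<^esub> cls v = cls (u + v)"
  using abelian_subgroup.a_rcos_sum[OF G_H, of u v] assms by (simp add: T_eq)

lemma T_smult:
  assumes s: "s \<in> carrier S" and u: "Poly_Mapping.keys u \<subseteq> X"
  shows "s \<odot>\<^bsub>T\<^esub> cls u = cls (act s u)"
proof -
  \<comment> \<open>All representatives of a class give the same coset because \<open>act s\<close>
    preserves \<open>H\<close>, so the union defining scalar multiplication collapses.\<close>
  have eq: "cls (act s v) = cls (act s u)" if v: "v \<in> cls u" for v
  proof -
    from v obtain h where h: "h \<in> H" "v = h + u" by (auto simp: a_r_coset_def')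
    have "Poly_Mapping.keys v \<subseteq> X" using h u H_subset[OF h(1)] keys_add[of h u] by blast
    then have "cls (act s u) = cls (act s v)"
      using act_H[OF s h(1)] s u by (intro cls_eqI act_closed) (simp_all add: h(2) frag_extend_add)
    then show ?thesis ..
  qed
  have "s \<odot>\<^bsub>T\<^esub> cls u = (\<Union>v\<in>cls u. cls (act s v))" by (simp add: T_eq)
  also have "\<dots> = (\<Union>v\<in>cls u. cls (act s u))" by (rule SUP_cong[OF refl eq])
  also have "\<dots> = cls (act s u)" using u H_zero in_cls_iff[of u u] by auto
  finally show ?thesis .
qed

lemma T_module: "module S T"
proof (rule moduleI[OF S_cring])
  show "abelian_group T"
  proof (rule abelian_groupI)
    fix x assume "x \<in> carrier T"
    then obtain u where u: "Poly_Mapping.keys u \<subseteq> X" "x = cls u" by (rule T_carrierE)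
    show "\<exists>y \<in> carrier T. y \<oplus>\<^bsub>T\<^esub> x = \<zero>\<^bsub>T\<^esub>"
      using u by (intro bexI[of _ "cls (- u)"] cls_in_T) (simp_all add: T_add T_zero)
    show "\<zero>\<^bsub>T\<^esub> \<oplus>\<^bsub>T\<^esub> x = x" using u by (simp add: T_zero T_add)
  next
    fix x y assume "x \<in> carrier T" "y \<in> carrier T"
    then show "x \<oplus>\<^bsub>T\<^esub> y \<in> carrier T" "x \<oplus>\<^bsub>T\<^esub> y = y \<oplus>\<^bsub>T\<^esub> x"
      by (elim T_carrierE; simp add: T_add cls_in_T keys_add_X add.commute)+
  next
    fix x y z assume "x \<in> carrier T" "y \<in> carrier T" "z \<in> carrier T"
    then show "x \<oplus>\<^bsub>T\<^esub> y \<oplus>\<^bsub>T\<^esub> z = x \<oplus>\<^bsub>T\<^esub> (y \<oplus>\<^bsub>T\<^esub> z)"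
      by (elim T_carrierE) (simp add: T_add keys_add_X add.assoc)
  qed (simp add: T_zero cls_in_T)
next
  fix s x assume "s \<in> carrier S" "x \<in> carrier T"
  then show "s \<odot>\<^bsub>T\<^esub> x \<in> carrier T"
    by (elim T_carrierE) (simp add: T_smult cls_in_T act_closed)
next
  fix s t x assume st: "s \<in> carrier S" "t \<in> carrier S" and x: "x \<in> carrier T"
  from x obtain u where u: "Poly_Mapping.keys u \<subseteq> X" "x = cls u" by (rule T_carrierE)
  \<comment> \<open>Additivity in the scalar holds only modulo \<open>H\<close>: on a generator it
    is the bilinearity relation in the second factor. The other axioms for scalars hold already in
    the free abelian group.\<close>
  have "act (s \<oplus>\<^bsub>S\<^esub> t) u - (act s u + act t u) \<in> H"
    using u(1)
  proof (induction u rule: X_induct)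
    case zero then show ?case by (simp add: H_zero)
  next
    case (diff u v)
    then show ?case using H_diff[OF diff(3,4)] by (simp add: frag_extend_diff algebra_simps)
  next
    case (gen a)
    obtain y c where a: "a = (y, c)" "y \<in> carrier M" "c \<in> carrier S" using gen by auto
    have "frag_of (y, s \<otimes>\<^bsub>S\<^esub> c \<oplus>\<^bsub>S\<^esub> t \<otimes>\<^bsub>S\<^esub> c) - frag_of (y, s \<otimes>\<^bsub>S\<^esub> c) - frag_of (y, t \<otimes>\<^bsub>S\<^esub> c) \<in> H"
      using a st by (intro H_relations) simp_all
    then show ?case using a st by (simp add: S.l_distr diff_diff_eq)
  qed
  then have "cls (act s u + act t u) = cls (act (s \<oplus>\<^bsub>S\<^esub> t) u)"
    using st u by (intro cls_eqI keys_add_X act_closed) simp_all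
  then show "(s \<oplus>\<^bsub>S\<^esub> t) \<odot>\<^bsub>T\<^esub> x = s \<odot>\<^bsub>T\<^esub> x \<oplus>\<^bsub>T\<^esub> t \<odot>\<^bsub>T\<^esub> x"
    using st u by (simp add: T_smult T_add act_closed)
  have "act (s \<otimes>\<^bsub>S\<^esub> t) u = act s (act t u)"
    using u(1)
  proof (induction u rule: X_induct)
    case (gen a) then show ?case using st by (auto simp: S.m_assoc)
  qed (simp_all add: frag_extend_diff)
  then show "(s \<otimes>\<^bsub>S\<^esub> t) \<odot>\<^bsub>T\<^esub> x = s \<odot>\<^bsub>T\<^esub> (t \<odot>\<^bsub>T\<^esub> x)"
    using st u by (simp add: T_smult act_closed)
next
  fix s x y assume "s \<in> carrier S" "x \<in> carrier T" "y \<in> carrier T"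
  then show "s \<odot>\<^bsub>T\<^esub> (x \<oplus>\<^bsub>T\<^esub> y) = s \<odot>\<^bsub>T\<^esub> x \<oplus>\<^bsub>T\<^esub> s \<odot>\<^bsub>T\<^esub> y"
    by (elim T_carrierE) (simp add: T_smult T_add act_closed keys_add_X frag_extend_add)
next
  fix x assume "x \<in> carrier T"
  then obtain u where u: "Poly_Mapping.keys u \<subseteq> X" "x = cls u" by (rule T_carrierE)
  have "act \<one>\<^bsub>S\<^esub> u = u"
    using u(1)
  proof (induction u rule: X_induct)
    case (gen a) then show ?case by auto
  qed (simp_all add: frag_extend_diff)
  then show "\<one>\<^bsub>S\<^esub> \<odot>\<^bsub>T\<^esub> x = x" using u by (simp add: T_smult)
qed

section \<open>Elementary tensors and base change of functionals\<close>

definition tensor :: "'m \<Rightarrow> 'b \<Rightarrow> ('m \<times> 'b \<Rightarrow>\<^sub>0 int) set" where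
  "tensor x s = cls (frag_of (x, s))"

lemma tensor_closed: "x \<in> carrier M \<Longrightarrow> s \<in> carrier S \<Longrightarrow> tensor x s \<in> carrier T"
  by (simp add: tensor_def cls_in_T)

lemma tensor_add_left:
  assumes "x \<in> carrier M" "y \<in> carrier M" "s \<in> carrier S"
  shows "tensor (x \<oplus>\<^bsub>M\<^esub> y) s = tensor x s \<oplus>\<^bsub>T\<^esub> tensor y s"
proof -
  have "frag_of (x \<oplus>\<^bsub>M\<^esub> y, s) - (frag_of (x, s) + frag_of (y, s)) \<in> H"
    using H_relations(1)[OF assms] by (simp add: diff_diff_eq)
  then have "cls (frag_of (x, s) + frag_of (y, s)) = cls (frag_of (x \<oplus>\<^bsub>M\<^esub> y, s))"
    using assms by (intro cls_eqI keys_add_X) simp_all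
  then show ?thesis using assms by (simp add: tensor_def T_add)
qed

lemma tensor_smult_left:
  assumes "r \<in> carrier R" "x \<in> carrier M" "s \<in> carrier S"
  shows "tensor (r \<odot>\<^bsub>M\<^esub> x) s = tensor x (f r \<otimes>\<^bsub>S\<^esub> s)"
proof -
  note H_relations(3)[OF assms]
  then have "cls (frag_of (x, f r \<otimes>\<^bsub>S\<^esub> s)) = cls (frag_of (r \<odot>\<^bsub>M\<^esub> x, s))"
    using assms by (intro cls_eqI) (simp_all add: f_closed)
  then show ?thesis by (simp add: tensor_def)
qed

lemma smult_tensor:
  assumes "s \<in> carrier S" "x \<in> carrier M" "t \<in> carrier S"
  shows "s \<odot>\<^bsub>T\<^esub> tensor x t = tensor x (s \<otimes>\<^bsub>S\<^esub> t)"
  using assms by (simp add: tensor_def T_smult)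

lemma tensor_zero_left:
  assumes "s \<in> carrier S" shows "tensor \<zero>\<^bsub>M\<^esub> s = \<zero>\<^bsub>T\<^esub>"
proof -
  interpret T: module S T by (rule T_module)
  have c: "tensor \<zero>\<^bsub>M\<^esub> s \<in> carrier T" using assms by (intro tensor_closed) auto
  have "tensor \<zero>\<^bsub>M\<^esub> s \<oplus>\<^bsub>T\<^esub> tensor \<zero>\<^bsub>M\<^esub> s = tensor \<zero>\<^bsub>M\<^esub> s"
    using tensor_add_left[of "\<zero>\<^bsub>M\<^esub>" "\<zero>\<^bsub>M\<^esub>" s] assms by simp
  then show ?thesis using c by (metis T.M.add.l_cancel_one')
qed

text \<open>Elementary tensors generate the base change as an abelian group, so additivity
  decides.\<close>

lemma hom_eq_on_tensors:
  fixes N :: "('b, 'n) module"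
  assumes N: "module S N" and g: "mod_hom S T N g" and h: "mod_hom S T N h"
    and eq: "\<And>x s. x \<in> carrier M \<Longrightarrow> s \<in> carrier S \<Longrightarrow> g (tensor x s) = h (tensor x s)"
    and z: "z \<in> carrier T"
  shows "g z = h z"
proof -
  interpret T: module S T by (rule T_module)
  interpret N: module S N by (rule N)
  from z obtain u where u: "Poly_Mapping.keys u \<subseteq> X" "z = cls u" by (rule T_carrierE)
  have "g (cls u) = h (cls u)"
    using u(1)
  proof (induction u rule: X_induct)
    case zero
    show ?case using mod_hom_zero[OF g T_module N] mod_hom_zero[OF h T_module N] by (simp add: T_zero)
  next
    case (diff u v)
    have uv: "Poly_Mapping.keys (u - v) \<subseteq> X" using diff keys_diff[of u v] by blast
    have add: "k (cls u) = k (cls (u - v)) \<oplus>\<^bsub>N\<^esub> k (cls v)" if "mod_hom S T N k" for k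
      using mod_homD(2)[OF that cls_in_T[OF uv] cls_in_T[OF diff(2)]] T_add[OF uv diff(2)] by simp
    show ?case
      using add[OF g] add[OF h] diff N.M.add.r_cancel mod_homD(1)[OF g] mod_homD(1)[OF h] cls_in_T[OF uv] cls_in_T[OF diff(2)]
      by metis
  next
    case (gen a)
    then show ?case using eq by (auto simp: tensor_def)
  qed
  then show ?thesis using u by simp
qed

text \<open>\<open>\<psi>\<close> is \<open>\<phi>\<close> tensored with \<open>S\<close>, followed
  by the identification of the base change of \<open>R\<close> with \<open>S\<close>. It comes from
  the universal property of the free abelian group, once the balanced map is seen to vanish on
  \<open>H\<close>.\<close>

lemma base_change_functional:
  assumes \<phi>: "mod_hom R M (regular_module R) \<phi>"
  obtains \<psi> where "mod_hom S T (regular_module S) \<psi>"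
    "\<And>x s. x \<in> carrier M \<Longrightarrow> s \<in> carrier S \<Longrightarrow> \<psi> (tensor x s) = f (\<phi> x) \<otimes>\<^bsub>S\<^esub> s"
proof -
  note \<phi>D = mod_homD[OF \<phi>, simplified]
  \<comment> \<open>The shape taken by the two bilinearity relations under the map to
    \<open>S\<close>.\<close>
  have cancel: "a \<oplus>\<^bsub>S\<^esub> b \<ominus>\<^bsub>S\<^esub> a \<ominus>\<^bsub>S\<^esub> b = \<zero>\<^bsub>S\<^esub>" if "a \<in> carrier S" "b \<in> carrier S" for a b
    using S.r_neg[of "a \<oplus>\<^bsub>S\<^esub> b"] that by (simp add: a_minus_def S.minus_add S.a_assoc)
  have f\<phi>: "f (\<phi> x) \<in> carrier S" if "x \<in> carrier M" for x using \<phi>D(1)[OF that] by (rule f_closed)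
  have "(\<lambda>(x, s). f (\<phi> x) \<otimes>\<^bsub>S\<^esub> s) ` X \<subseteq> carrier (add_monoid S)"
    using f\<phi> by auto
  then obtain h where h: "h \<in> hom (free_Abelian_group X) (add_monoid S)"
    "\<And>a. a \<in> X \<Longrightarrow> h (frag_of a) = (\<lambda>(x, s). f (\<phi> x) \<otimes>\<^bsub>S\<^esub> s) a"
    by (rule comm_group.free_Abelian_group_universal[OF S.a_comm_group]) blast
  have h_closed: "h u \<in> carrier S" if "Poly_Mapping.keys u \<subseteq> X" for u
    using hom_in_carrier[OF h(1), of u] that by simp
  have h_add: "h (u + v) = h u \<oplus>\<^bsub>S\<^esub> h v" if "Poly_Mapping.keys u \<subseteq> X" "Poly_Mapping.keys v \<subseteq> X" for u v
    using hom_mult[OF h(1), of u v] that by simp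
  have h_diff: "h (u - v) = h u \<ominus>\<^bsub>S\<^esub> h v" if uv: "Poly_Mapping.keys u \<subseteq> X" "Poly_Mapping.keys v \<subseteq> X" for u v
  proof -
    have k: "Poly_Mapping.keys (u - v) \<subseteq> X" using uv keys_diff[of u v] by blast
    have "h u = h (u - v) \<oplus>\<^bsub>S\<^esub> h v" using h_add[OF k uv(2)] by simp
    then show ?thesis using h_closed[OF k] h_closed[OF uv(2)] by (simp add: a_minus_def S.a_assoc S.r_neg)
  qed
  have h_zero: "h 0 = \<zero>\<^bsub>S\<^esub>"
    using h_diff[of 0 0] h_closed[of 0] by (simp add: a_minus_def S.r_neg)
  have hH: "h u = \<zero>\<^bsub>S\<^esub>" if "u \<in> H" for u
    using that
  proof (induction rule: H_induct)
    case (relation u)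
    have k2: "Poly_Mapping.keys (frag_of a - frag_of b) \<subseteq> X" if "a \<in> X" "b \<in> X" for a b
      using that keys_diff[of "frag_of a" "frag_of b"] by auto
    from relation show ?case
      unfolding tensor_relations_def
    proof (elim UnE CollectE exE conjE, goal_cases)
      case (1 x y s)
      have "h u = f (\<phi> x \<oplus>\<^bsub>R\<^esub> \<phi> y) \<otimes>\<^bsub>S\<^esub> s \<ominus>\<^bsub>S\<^esub> f (\<phi> x) \<otimes>\<^bsub>S\<^esub> s \<ominus>\<^bsub>S\<^esub> f (\<phi> y) \<otimes>\<^bsub>S\<^esub> s"
        using 1 k2 by (simp add: h_diff h(2) \<phi>D)
      also have "f (\<phi> x \<oplus>\<^bsub>R\<^esub> \<phi> y) = f (\<phi> x) \<oplus>\<^bsub>S\<^esub> f (\<phi> y)"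
        using ring_hom_add[OF f_hom] 1 \<phi>D by blast
      finally show ?case using 1 f\<phi> by (simp add: S.l_distr cancel)
    next
      case (2 x s t)
      then have "h u = f (\<phi> x) \<otimes>\<^bsub>S\<^esub> (s \<oplus>\<^bsub>S\<^esub> t) \<ominus>\<^bsub>S\<^esub> f (\<phi> x) \<otimes>\<^bsub>S\<^esub> s \<ominus>\<^bsub>S\<^esub> f (\<phi> x) \<otimes>\<^bsub>S\<^esub> t"
        using k2 by (simp add: h_diff h(2))
      then show ?case using 2 f\<phi> by (simp add: S.r_distr cancel)
    next
      case (3 r x s)
      then have "h u = f (r \<otimes>\<^bsub>R\<^esub> \<phi> x) \<otimes>\<^bsub>S\<^esub> s \<ominus>\<^bsub>S\<^esub> f (\<phi> x) \<otimes>\<^bsub>S\<^esub> (f r \<otimes>\<^bsub>S\<^esub> s)"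
        using k2 f_closed by (simp add: h_diff h(2) \<phi>D)
      also have "f (r \<otimes>\<^bsub>R\<^esub> \<phi> x) = f r \<otimes>\<^bsub>S\<^esub> f (\<phi> x)"
        using ring_hom_mult[OF f_hom] 3 \<phi>D by blast
      finally show ?case using 3 f\<phi> f_closed by (simp add: S.m_ac a_minus_def S.r_neg)
    qed
  next
    case (diff u v)
    then show ?case using H_subset by (simp add: h_diff a_minus_def S.r_neg)
  qed (rule h_zero)
  \<comment> \<open>Any representative may be chosen: two of them differ by an element of
    \<open>H\<close>, where \<open>h\<close> is zero.\<close>
  define \<psi> where "\<psi> z = h (SOME u. Poly_Mapping.keys u \<subseteq> X \<and> z = cls u)" for z
  have \<psi>: "\<psi> (cls u) = h u" if u: "Poly_Mapping.keys u \<subseteq> X" for u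
  proof -
    let ?v = "SOME v. Poly_Mapping.keys v \<subseteq> X \<and> cls u = cls v"
    have v: "Poly_Mapping.keys ?v \<subseteq> X \<and> cls u = cls ?v"
      by (rule someI[of "\<lambda>v. Poly_Mapping.keys v \<subseteq> X \<and> cls u = cls v" u]) (simp add: u)
    then have "?v \<in> cls u" using in_cls_iff[of ?v ?v] H_zero by simp
    then have "?v - u \<in> H" using in_cls_iff u v by blast
    then have "h (?v - u) = \<zero>\<^bsub>S\<^esub>" by (rule hH)
    then have "h (?v - u + u) = h u"
      using h_add[of "?v - u" u] H_subset[OF \<open>?v - u \<in> H\<close>] u h_closed[OF u] by simp
    then show ?thesis by (simp add: \<psi>_def)
  qed
  show thesis
  proof (rule that)
    have h_act: "h (act s u) = s \<otimes>\<^bsub>S\<^esub> h u" if s: "s \<in> carrier S" and u: "Poly_Mapping.keys u \<subseteq> X" for s u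
      using u
    proof (induction u rule: X_induct)
      case zero then show ?case using s h_zero by simp
    next
      case (diff u v)
      then show ?case
        using s h_closed by (simp add: frag_extend_diff h_diff act_closed a_minus_def S.r_distr S.r_minus)
    next
      case (gen a)
      then obtain x t where "a = (x, t)" "x \<in> carrier M" "t \<in> carrier S" by auto
      then show ?case using s f\<phi> by (simp add: h(2) S.m_lcomm)
    qed
    show "mod_hom S T (regular_module S) \<psi>"
    proof (rule mod_homI)
      fix z assume "z \<in> carrier T"
      then show "\<psi> z \<in> carrier (regular_module S)"
        by (elim T_carrierE) (simp add: \<psi> h_closed)
    next
      fix z w assume "z \<in> carrier T" "w \<in> carrier T"
      then show "\<psi> (z \<oplus>\<^bsub>T\<^esub> w) = \<psi> z \<oplus>\<^bsub>regular_module S\<^esub> \<psi> w"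
        by (elim T_carrierE) (simp add: T_add \<psi> h_add keys_add_X)
    next
      fix s z assume "s \<in> carrier S" "z \<in> carrier T"
      then show "\<psi> (s \<odot>\<^bsub>T\<^esub> z) = s \<odot>\<^bsub>regular_module S\<^esub> \<psi> z"
        by (elim T_carrierE) (simp add: T_smult \<psi> h_act act_closed)
    qed
    show "\<psi> (tensor x s) = f (\<phi> x) \<otimes>\<^bsub>S\<^esub> s" if "x \<in> carrier M" "s \<in> carrier S" for x s
      using that by (simp add: tensor_def \<psi> h(2))
  qed
qed

text \<open>A summand with functional \<open>\<phi>\<close> and vector \<open>n\<close> turns into
  the one with functional \<open>\<psi>\<close> and vector \<open>tensor n 1\<close>, since scalars
  from \<open>R\<close> move across the tensor sign.\<close>

lemma finite_rank_base_change:
  assumes "finite_rank R M M t"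
  obtains t' where "finite_rank S T T t'"
    "\<And>x s. x \<in> carrier M \<Longrightarrow> s \<in> carrier S \<Longrightarrow> t' (tensor x s) = tensor (t x) s"
  using assms
proof (induction arbitrary: thesis)
  case (zero t)
  have "finite_rank S T T (\<lambda>z. \<zero>\<^bsub>T\<^esub>)" by (rule finite_rank.zero) simp
  then show ?case by (rule zero(2)) (simp add: zero(1) tensor_zero_left)
next
  case (add t \<phi> n t1)
  interpret T: module S T by (rule T_module)
  obtain t' where t': "finite_rank S T T t'"
    "\<And>x s. x \<in> carrier M \<Longrightarrow> s \<in> carrier S \<Longrightarrow> t' (tensor x s) = tensor (t x) s"
    using add.IH by blast
  obtain \<psi> where \<psi>: "mod_hom S T (regular_module S) \<psi>"
    "\<And>x s. x \<in> carrier M \<Longrightarrow> s \<in> carrier S \<Longrightarrow> \<psi> (tensor x s) = f (\<phi> x) \<otimes>\<^bsub>S\<^esub> s"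
    using base_change_functional[OF add.hyps(2)] by blast
  have n: "tensor n \<one>\<^bsub>S\<^esub> \<in> carrier T" using add.hyps(3) by (intro tensor_closed) auto
  have "finite_rank S T T (\<lambda>z. t' z \<oplus>\<^bsub>T\<^esub> \<psi> z \<odot>\<^bsub>T\<^esub> tensor n \<one>\<^bsub>S\<^esub>)"
    by (rule finite_rank.add[OF t'(1) \<psi>(1) n]) simp
  then show ?case
  proof (rule add.prems)
    fix x s assume xs: "x \<in> carrier M" "s \<in> carrier S"
    have c: "\<phi> x \<in> carrier R" "t x \<in> carrier M"
      using mod_homD(1)[OF add.hyps(2) xs(1)] mod_homD(1)[OF finite_rank_mod_hom[OF add.hyps(1) M_module M_module] xs(1)]
      by simp_all
    have "tensor (t1 x) s = tensor (t x) s \<oplus>\<^bsub>T\<^esub> tensor n (f (\<phi> x) \<otimes>\<^bsub>S\<^esub> s)"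
      using xs c add.hyps(3) by (simp add: add.hyps(4) tensor_add_left tensor_smult_left)
    then show "t' (tensor x s) \<oplus>\<^bsub>T\<^esub> \<psi> (tensor x s) \<odot>\<^bsub>T\<^esub> tensor n \<one>\<^bsub>S\<^esub> = tensor (t1 x) s"
      using xs c add.hyps(3) by (simp add: t'(2) \<psi>(2) smult_tensor f_closed)
  qed
qed

text \<open>The base change of multiplication by \<open>r\<close> is multiplication by
  \<open>f r\<close>: both agree on elementary tensors.\<close>

lemma finite_rank_scalar_base_change:
  assumes r: "r \<in> carrier R" and M: "finite_rank_scalar R M r"
  shows "finite_rank_scalar S T (f r)"
proof -
  obtain t' where t': "finite_rank S T T t'"
    "\<And>x s. x \<in> carrier M \<Longrightarrow> s \<in> carrier S \<Longrightarrow> t' (tensor x s) = tensor (r \<odot>\<^bsub>M\<^esub> x) s"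
    using finite_rank_base_change[OF M] by blast
  show ?thesis
  proof (rule finite_rank_cong[OF t'(1)])
    fix z assume z: "z \<in> carrier T"
    show "f r \<odot>\<^bsub>T\<^esub> z = t' z"
      by (rule hom_eq_on_tensors[OF T_module mod_hom_scalar[OF T_module f_closed[OF r]]
            finite_rank_mod_hom[OF t'(1) T_module T_module] _ z])
        (simp add: t'(2) smult_tensor tensor_smult_left r f_closed)
  qed
qed

end

section \<open>The stable category\<close>

lemma finite_rank_scalar_retract:
  assumes M: "module R M" and N: "module R N" and r: "r \<in> carrier R"
    and p: "mod_hom R M N p" and i: "mod_hom R N M i" and pi: "\<And>y. y \<in> carrier N \<Longrightarrow> p (i y) = y"
    and s: "finite_rank_scalar R M r"
  shows "finite_rank_scalar R N r"
  by (rule finite_rank_cong[OF finite_rank_comp[OF s i p M M N]])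
    (simp add: mod_homD(3)[OF p r] mod_homD(1)[OF i] pi)

lemma finite_rank_scalar_direct_sum:
  assumes A: "module R A" and B: "module R B" and r: "r \<in> carrier R"
    and rA: "finite_rank_scalar R A r" and rB: "finite_rank_scalar R B r"
  shows "finite_rank_scalar R (direct_sum A B) r"
proof -
  interpret A: module R A by fact
  interpret B: module R B by fact
  note D = direct_sum_module[OF A B] and h = mod_hom_direct_sum[OF A B]
  show ?thesis
    by (rule finite_rank_cong[OF finite_rank_add[OF finite_rank_comp[OF rA h(1,3) A A D]
            finite_rank_comp[OF rB h(2,4) B B D] D D]]) (use r in auto)
qed

lemma finite_rank_scalar_direct_summand:
  assumes "direct_summand R N M" and M: "module R M" and N: "module R N" and r: "r \<in> carrier R"
    and s: "finite_rank_scalar R M r"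
  shows "finite_rank_scalar R N r"
proof -
  obtain Y :: "'a small_module" and h where Y: "fg_module R Y"
    and h: "h \<in> module_Hom R M (direct_sum N Y)" "bij_betw h (carrier M) (carrier (direct_sum N Y))"
    using assms(1) by (auto simp: direct_summand_def module_iso_def)
  have YM: "module R Y" using Y by (rule fg_module_module)
  have hm: "mod_hom R M (direct_sum N Y) h" using h(1) by (simp add: module_Hom_iff)
  note inv = mod_hom_inv[OF hm h(2) M] and D = direct_sum_module[OF N YM]
  have "finite_rank_scalar R (direct_sum N Y) r"
    by (rule finite_rank_scalar_retract[OF M D r hm inv bij_betw_inv_into_right[OF h(2)] s])
  then show ?thesis
    by (intro finite_rank_scalar_retract[OF D N r mod_hom_direct_sum(1,3)[OF N YM] fst_conv])
qed

lemma factors_through_projective_finite_rank: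
  fixes M :: "('a, 'm) module" and N :: "('a, 'n) module"
  assumes "factors_through_projective R M N h" and N: "module R N"
  shows "finite_rank R M N h"
proof -
  obtain P :: "'a small_module" and u v where P: "fg_module R P" "projective_module R P"
    and uv: "u \<in> module_Hom R M P" "v \<in> module_Hom R P N" "h = compose (carrier M) v u"
    using assms(1) unfolding factors_through_projective_def by blast
  note PM = fg_module_module[OF P(1)]
  have u: "mod_hom R M P u" and v: "mod_hom R P N v" using uv by (simp_all add: module_Hom_iff)
  show ?thesis
    by (rule finite_rank_cong[OF finite_rank_comp[OF projective_finite_rank_id[OF P] u v PM PM N]])
      (simp add: uv(3) compose_def)
qed

text \<open>Even for the zero map a factorisation has to name a projective module, hence the
  parameter \<open>P\<close>. Reflexivity ensures that a homomorphism belongs to its own stable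
  class.\<close>

lemma stable_rel_refl:
  fixes M :: "('a, 'm) module" and N :: "('a, 'n) module" and P :: "'a small_module"
  assumes M: "module R M" and N: "module R N" and P: "fg_module R P" "projective_module R P"
    and g: "g \<in> module_Hom R M N"
  shows "(g, g) \<in> stable_rel R M N"
proof -
  interpret M: module R M by fact
  interpret N: module R N by fact
  note PM = fg_module_module[OF P(1)]
  interpret P: module R P by (rule PM)
  let ?u = "\<lambda>x\<in>carrier M. \<zero>\<^bsub>P\<^esub>" and ?v = "\<lambda>x\<in>carrier P. \<zero>\<^bsub>N\<^esub>"
  have "?u \<in> module_Hom R M P" "?v \<in> module_Hom R P N"
    using restrict_in_module_Hom[OF mod_hom_const_zero[OF PM] M]
      restrict_in_module_Hom[OF mod_hom_const_zero[OF N] PM] by blast+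
  moreover have "(\<lambda>x\<in>carrier M. g x \<ominus>\<^bsub>N\<^esub> g x) = compose (carrier M) ?v ?u"
    using g by (auto simp: compose_def module_Hom_iff a_minus_def N.M.r_neg mod_homD(1) intro!: restrict_ext)
  ultimately show ?thesis
    using g P by (auto simp: stable_rel_def factors_through_projective_def)
qed

text \<open>Turns classes into representatives that are mutually inverse up to finite rank.\<close>

lemma stable_isoE:
  fixes M :: "('a, 'm) module" and N :: "('a, 'n) module" and P :: "'a small_module"
  assumes iso: "stable_iso R M N" and M: "module R M" and N: "module R N"
    and P: "fg_module R P" "projective_module R P"
  obtains u v where "mod_hom R M N u" "mod_hom R N M v"
    "finite_rank R M M (\<lambda>x. x \<ominus>\<^bsub>M\<^esub> v (u x))" "finite_rank R N N (\<lambda>y. y \<ominus>\<^bsub>N\<^esub> u (v y))"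
proof -
  note refl = stable_rel_refl[OF _ _ P]
  obtain F K where FK: "F \<in> stable_hom R M N" "K \<in> stable_hom R N M"
    "stable_comp R M M K F = stable_id R M" "stable_comp R N N F K = stable_id R N"
    using iso unfolding stable_iso_def by blast
  obtain u where u: "u \<in> module_Hom R M N" "F = stable_rel R M N `` {u}"
    using FK(1) unfolding stable_hom_def by (rule quotientE)
  obtain v where v: "v \<in> module_Hom R N M" "K = stable_rel R N M `` {v}"
    using FK(2) unfolding stable_hom_def by (rule quotientE)
  have uF: "u \<in> F" and vK: "v \<in> K" using u v refl[OF M N u(1)] refl[OF N M v(1)] by auto
  have um: "mod_hom R M N u" and vm: "mod_hom R N M v" using u v by (simp_all add: module_Hom_iff)
  have comp: "finite_rank R L L (\<lambda>x. x \<ominus>\<^bsub>L\<^esub> k (h x))"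
    if L: "module R L" and h: "mod_hom R L L' h" "h \<in> F'" and k: "k \<in> module_Hom R L' L" "k \<in> K'"
      and id: "stable_comp R L L K' F' = stable_id R L"
    for L :: "('a, 'l) module" and L' :: "('a, 'k) module" and h k F' K'
  proof -
    have c: "compose (carrier L) k h \<in> module_Hom R L L"
      by (rule compose_in_module_Hom[OF k(1) h(1) L])
    \<comment> \<open>The composite of classes is a union over all representatives, so it contains
      this particular composite; as it equals the class of the identity, the two maps are
      related.\<close>
    have "compose (carrier L) k h \<in> stable_comp R L L K' F'"
      using refl[OF L L c] h(2) k(2) unfolding stable_comp_def by blast
    then have "(\<lambda>x\<in>carrier L. x, compose (carrier L) k h) \<in> stable_rel R L L"
      unfolding id by (simp add: stable_id_def)
    then have "factors_through_projective R L L (\<lambda>x\<in>carrier L. (\<lambda>x\<in>carrier L. x) x \<ominus>\<^bsub>L\<^esub> compose (carrier L) k h x)"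
      by (simp add: stable_rel_def)
    from factors_through_projective_finite_rank[OF this L] show ?thesis
      by (rule finite_rank_cong) (simp add: compose_def)
  qed
  show thesis
    by (rule that[OF um vm comp[OF M um uF v(1) vK FK(3)] comp[OF N vm vK u(1) uF FK(4)]])
qed

text \<open>Split \<open>r y\<close> into \<open>r (y - u (v y))\<close> and
  \<open>u (r (v y))\<close>: the first has finite rank because \<open>u v\<close> is the identity
  up to finite rank, the second because \<open>r\<close> has finite rank on
  \<open>M\<close>.\<close>

lemma finite_rank_scalar_up_to_finite_rank:
  assumes M: "module R M" and N: "module R N" and r: "r \<in> carrier R"
    and u: "mod_hom R M N u" and v: "mod_hom R N M v"
    and uv: "finite_rank R N N (\<lambda>y. y \<ominus>\<^bsub>N\<^esub> u (v y))"
    and s: "finite_rank_scalar R M r"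
  shows "finite_rank_scalar R N r"
proof -
  interpret N: module R N by fact
  have "finite_rank R N N (\<lambda>y. r \<odot>\<^bsub>N\<^esub> (y \<ominus>\<^bsub>N\<^esub> u (v y)) \<oplus>\<^bsub>N\<^esub> u (r \<odot>\<^bsub>M\<^esub> v y))"
    by (rule finite_rank_add[OF finite_rank_comp[OF uv mod_hom_id mod_hom_scalar[OF N r] N N N]
          finite_rank_comp[OF s v u M M N] N N])
  then show ?thesis
  proof (rule finite_rank_cong)
    fix y assume y: "y \<in> carrier N"
    have c: "v y \<in> carrier M" "u (v y) \<in> carrier N" using y mod_homD(1)[OF v] mod_homD(1)[OF u] by auto
    then show "r \<odot>\<^bsub>N\<^esub> y = r \<odot>\<^bsub>N\<^esub> (y \<ominus>\<^bsub>N\<^esub> u (v y)) \<oplus>\<^bsub>N\<^esub> u (r \<odot>\<^bsub>M\<^esub> v y)"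
      using y r mod_homD(3)[OF u r c(1)]
      by (simp add: a_minus_def N.smult_r_distr N.smult_r_minus N.M.a_assoc N.M.l_neg)
  qed
qed

text \<open>The Cohen-Macaulay condition is carried through the induction because it supplies finite
  generation, hence the module axioms, for the object \<open>A\<close> that a rule starts
  from.\<close>

lemma stable_closure_finite_rank_scalar:
  fixes R :: "('a, 'c) ring_scheme" and X :: "'a small_module"
  assumes R: "noetherian_ring R" and r: "r \<in> carrier R" and X: "finite_rank_scalar R X r"
    and "stable_closure R X A"
  shows "mcm R A \<and> finite_rank_scalar R A r"
  using assms(4)
proof induction
  case base
  then show ?case using X by blast
next
  case (zero Z)
  then have "module R Z" by (simp add: mcm_def fg_module_def)
  then interpret Z: module R Z .
  have "finite_rank_scalar R Z r"
    using zero(2) r by (intro finite_rank.zero) (simp add: zero_module_def)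
  then show ?case using zero by blast
next
  case (sum A B C)
  have fg: "fg_module R A" "fg_module R B" "fg_module R C" using sum by (auto simp: mcm_def)
  note A = fg_module_module[OF fg(1)] and B = fg_module_module[OF fg(2)] and C = fg_module_module[OF fg(3)]
  note AB = direct_sum_module[OF A B]
  \<comment> \<open>Any finitely generated projective will do here: it feeds the reflexivity
    argument behind \<open>stable_isoE\<close>.\<close>
  obtain P :: "'a small_module" and e where P: "fg_module R P" "projective_module R P"
    "e \<in> module_Hom R P C" "e ` carrier P = carrier C" by (rule projective_cover_exists[OF fg(3)])
  obtain u v where "mod_hom R C (direct_sum A B) u" "mod_hom R (direct_sum A B) C v"
    "finite_rank R C C (\<lambda>x. x \<ominus>\<^bsub>C\<^esub> v (u x))"
    using stable_isoE[OF sum(4) C AB P(1,2)] by blast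
  then have "finite_rank_scalar R C r"
    using finite_rank_scalar_up_to_finite_rank[OF AB C r] finite_rank_scalar_direct_sum[OF A B r] sum.IH by blast
  then show ?case using sum by blast
next
  case (summand A B C)
  have fg: "fg_module R A" "fg_module R B" "fg_module R C" using summand by (auto simp: mcm_def)
  note A = fg_module_module[OF fg(1)] and B = fg_module_module[OF fg(2)] and C = fg_module_module[OF fg(3)]
  note BC = direct_sum_module[OF B C]
  obtain P :: "'a small_module" and e where P: "fg_module R P" "projective_module R P"
    "e \<in> module_Hom R P A" "e ` carrier P = carrier A" by (rule projective_cover_exists[OF fg(1)])
  obtain u v where "mod_hom R A (direct_sum B C) u" "mod_hom R (direct_sum B C) A v"
    "finite_rank R (direct_sum B C) (direct_sum B C) (\<lambda>y. y \<ominus>\<^bsub>direct_sum B C\<^esub> u (v y))"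
    using stable_isoE[OF summand(4) A BC P(1,2)] by blast
  then have "finite_rank_scalar R (direct_sum B C) r"
    using finite_rank_scalar_up_to_finite_rank[OF A BC r] summand.IH by blast
  then have "finite_rank_scalar R B r"
    by (intro finite_rank_scalar_retract[OF BC B r mod_hom_direct_sum(1,3)[OF B C] fst_conv])
  then show ?case using summand by blast
next
  case (cosyzygy A B P)
  have fg: "fg_module R A" "fg_module R B" using cosyzygy by (auto simp: mcm_def)
  note A = fg_module_module[OF fg(1)] and B = fg_module_module[OF fg(2)] and P = fg_module_module[OF cosyzygy(3)]
  obtain g h where g: "mod_hom R A P g" and h: "mod_hom R P B h" and inj: "inj_on g (carrier A)"
    and ex: "g ` carrier A = a_kernel P B h" and im: "h ` carrier P = carrier B"
    using cosyzygy(5) by (auto simp: short_exact_def module_Hom_iff)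
  have surj: "\<exists>x \<in> carrier P. h x = y" if "y \<in> carrier B" for y using that unfolding im[symmetric] by blast
  have hg: "h (g a) = \<zero>\<^bsub>B\<^esub>" if "a \<in> carrier A" for a
    using in_a_kernel_iff[of "g a" P B h, folded ex] that by blast
  have ker: "\<exists>a \<in> carrier A. x = g a" if "x \<in> carrier P" "h x = \<zero>\<^bsub>B\<^esub>" for x
    using in_a_kernel_iff[of x P B h, folded ex] that by blast
  \<comment> \<open>The cokernel \<open>B\<close> is maximal Cohen-Macaulay, so functionals on
    \<open>A\<close> extend along \<open>g\<close>.\<close>
  have "finite_rank_scalar R B r"
    using short_exact_extend_functional[OF R cosyzygy(2) A P g h inj surj hg ker] cosyzygy.IH
    by (intro finite_rank_scalar_cokernel[OF A P B g h surj hg ker _ projective_finite_rank_id[OF cosyzygy(3,4)] r]) blast+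
  then show ?case using cosyzygy by blast
next
  case (syzygy A B P)
  have fg: "fg_module R A" "fg_module R B" using syzygy by (auto simp: mcm_def)
  note A = fg_module_module[OF fg(1)] and B = fg_module_module[OF fg(2)] and P = fg_module_module[OF syzygy(3)]
  obtain g h where g: "mod_hom R B P g" and h: "mod_hom R P A h" and inj: "inj_on g (carrier B)"
    and ex: "g ` carrier B = a_kernel P A h" and im: "h ` carrier P = carrier A"
    using syzygy(5) by (auto simp: short_exact_def module_Hom_iff)
  have surj: "\<exists>x \<in> carrier P. h x = y" if "y \<in> carrier A" for y using that unfolding im[symmetric] by blast
  have hg: "h (g b) = \<zero>\<^bsub>A\<^esub>" if "b \<in> carrier B" for b
    using in_a_kernel_iff[of "g b" P A h, folded ex] that by blast
  have ker: "\<exists>b \<in> carrier B. x = g b" if "x \<in> carrier P" "h x = \<zero>\<^bsub>A\<^esub>" for x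
    using in_a_kernel_iff[of x P A h, folded ex] that by blast
  have "finite_rank_scalar R B r"
    using syzygy.IH
    by (intro finite_rank_scalar_kernel[OF B P A g h inj surj hg ker projective_finite_rank_id[OF syzygy(3,4)] r]) blast+
  then show ?case using syzygy by blast
qed

text \<open>An empty intersection would be the whole type, so one finitely generated small module
  has to be exhibited: a copy of the free module on no generators.\<close>

lemma ca_subset:
  fixes R :: "('a, 'c) ring_scheme"
  assumes "cring R" shows "ca R \<subseteq> carrier R"
proof -
  obtain M :: "'a small_module" where "fg_module R M"
    using fg_module_small_copy[OF finite_rank_id_fg[OF free_module_finite_rank_id free_module_module]]
      assms finite.emptyI by blast
  then show ?thesis by (auto simp: ca_def ca_level_def annihilator_def)
qed

theorem proposition5p1:
  fixes R :: "('a, 'c) ring_scheme" and S :: "('b, 'd) ring_scheme" and f :: "'a \<Rightarrow> 'b"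
  assumes "gorenstein_ring R" and "gorenstein_ring S"
    and "f \<in> ring_hom R S"
    and "weak_mcm_extending R S f"
  shows "f ` ca R \<subseteq> ca S"
proof
  fix s assume "s \<in> f ` ca R"
  then obtain r where r: "r \<in> ca R" "s = f r" by blast
  have R: "noetherian_ring R" and S: "noetherian_ring S" "cring S"
    using assms(1,2) by (simp_all add: gorenstein_ring_def)
  have rR: "r \<in> carrier R"
    by (rule ca_subset[THEN subsetD, OF _ r(1)]) (use assms(1) in \<open>simp add: gorenstein_ring_def\<close>)
  have s: "s \<in> carrier S" unfolding r(2) by (rule ring_hom_closed[OF assms(3) rR])
  show "s \<in> ca S"
  proof (rule ca_if_finite_rank_scalars[OF assms(2) s])
    fix N :: "'b small_module" assume "mcm S N"
    then obtain M :: "'a small_module" and N' :: "'b small_module" where M: "mcm R M" and N': "mcm S N'"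
      and summand: "direct_summand S N' (base_change R S f M)" and closure: "stable_closure S N' N"
      using assms(4) unfolding weak_mcm_extending_def by blast
    interpret base_change_module R S f M
      by (rule base_change_module.intro) (use assms(3) S M in \<open>auto simp: mcm_def fg_module_def\<close>)
    have "finite_rank_scalar S (base_change R S f M) s"
      unfolding r(2) by (rule finite_rank_scalar_base_change[OF rR mcm_finite_rank_scalar[OF R M r(1)]])
    then have "finite_rank_scalar S N' s"
      using N' by (intro finite_rank_scalar_direct_summand[OF summand T_module _ s]) (simp_all add: mcm_def fg_module_def)
    then show "finite_rank_scalar S N s"
      using stable_closure_finite_rank_scalar[OF S(1) s _ closure] by blast
  qed
qed

end
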